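(* Let $t$ be an odd positive integer and let $p_1,\dots,p_t$ and $q$ be distinct primes such that $p_i\equiv 5\pmod 8$ for all $1\le i\le t$ and $q\equiv 7\pmod 8$. Set $P=p_1p_2\cdots p_t$ and $n=Pq$. Assume that: (a) $\operatorname{rank}_{\mathbb F_2}(A_P)=t-1$; (b) $\left(\frac{p_i}{q}\right)=1$ for all $i\in\{1,\dots,t\}$. If $n$ is a congruent number, then $$h(-n)\equiv 0\pmod{2^{t+2}}.$$
   Context: A positive integer is a congruent number if it is the area of a right-angled triangle all of whose sides have rational length. For a square-free positive integer $m$, $h(-m)$ denotes the ideal class number of the imaginary quadratic field $\mathbb Q(\sqrt{-m})$. $\left(\frac{\cdot}{\cdot}\right)$ is the Legendre symbol. $\mathbb F_2$ is the field with two elements. For distinct primes $p_1,\dots,p_t$ and $P=p_1\cdots p_t$, $A_P=[a_{ij}]$ is the $t\times t$ matrix over $\mathbb F_2$ defined, for $i\ne j$, by $a_{ij}=1$ if $\left(\frac{p_j}{p_i}\right)=-1$ and $a_{ij}=0$ if $\left(\frac{p_j}{p_i}\right)=1$, and $a_{ii}=\sum_{j\neq i}a_{ij}$. If $t=1$, $A_P$ is the $1\times1$ zero matrix. *)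

theory Defs
  imports
    Complex_Main
    "HOL-Library.Z2"
    "HOL-Computational_Algebra.Polynomial"
    "HOL-Algebra.Ideal"
    "HOL-Number_Theory.Number_Theory"
    "Jordan_Normal_Form.DL_Rank"
begin

definition congruent_number :: "nat \<Rightarrow> bool" where
  "congruent_number n \<longleftrightarrow> n > 0 \<and>
     (\<exists>a b c :: rat. a > 0 \<and> b > 0 \<and> c > 0 \<and> a\<^sup>2 + b\<^sup>2 = c\<^sup>2 \<and> of_nat n = a * b / 2)"

definition imag_quadratic_field :: "nat \<Rightarrow> complex set" where
  "imag_quadratic_field m =
     {of_rat a + of_rat b * (\<i> * complex_of_real (sqrt (real m))) | a b :: rat. True}"

definition ring_of_integers :: "nat \<Rightarrow> complex ring" where
  "ring_of_integers m =
     \<lparr>carrier = {z \<in> imag_quadratic_field m. algebraic_int z},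
      mult = (*), one = 1, zero = 0, add = (+)\<rparr>"

definition nonzero_ideals :: "nat \<Rightarrow> complex set set" where
  "nonzero_ideals m = {I. ideal I (ring_of_integers m) \<and> I \<noteq> {0}}"

text \<open>Ideal classes are taken on integral ideals: every fractional ideal is a scalar multiple
  of an integral one, so these classes are those of fractional modulo principal fractional ideals.\<close>

definition ideal_class_rel :: "nat \<Rightarrow> (complex set \<times> complex set) set" where
  "ideal_class_rel m =
     {(I, J). I \<in> nonzero_ideals m \<and> J \<in> nonzero_ideals m \<and>
        (\<exists>a \<in> carrier (ring_of_integers m) - {0}. \<exists>b \<in> carrier (ring_of_integers m) - {0}.
           (\<lambda>x. a * x) ` I = (\<lambda>x. b * x) ` J)}"

text \<open>The number \<open>h(-m)\<close>, for square-free \<open>m > 0\<close>.\<close>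

definition class_number_neg :: "nat \<Rightarrow> nat" where
  "class_number_neg m = card (nonzero_ideals m // ideal_class_rel m)"

text \<open>The matrix \<open>A\<^sub>P\<close> of the primes \<open>p 0, \<dots>, p (t - 1)\<close>; indices are shifted to start at \<open>0\<close>.\<close>

definition legendre_entry :: "(nat \<Rightarrow> nat) \<Rightarrow> nat \<Rightarrow> nat \<Rightarrow> bit" where
  "legendre_entry p i j = (if Legendre (int (p j)) (int (p i)) = -1 then 1 else 0)"

definition legendre_matrix :: "nat \<Rightarrow> (nat \<Rightarrow> nat) \<Rightarrow> bit mat" where
  "legendre_matrix t p = mat t t (\<lambda>(i, j).
     if i = j then (\<Sum>k\<in>{..<t} - {i}. legendre_entry p i k) else legendre_entry p i j)"

end

theory Submission
  imports
    Defs
    "HOL-Computational_Algebra.Squarefree"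
    "HOL-Computational_Algebra.Nth_Powers"
    "HOL-Algebra.Ideal_Product"
begin

text \<open>Let \<open>\<omega> = \<surd>-n\<close>. Infinite descent turns a congruent number \<open>n = P q\<close> into a solution of
  \<open>\<alpha> r\<^sup>2 + \<beta> s\<^sup>2 = \<gamma> u\<^sup>2\<close>, \<open>\<alpha> r\<^sup>2 - \<beta> s\<^sup>2 = \<delta> v\<^sup>2\<close> with \<open>\<alpha> \<beta> \<gamma> \<delta> = n\<close> and \<open>\<beta> \<noteq> n\<close>. Local conditions at
  the primes dividing \<open>n\<close>, the rank of \<open>A\<^sub>P\<close> and the parity of \<open>t\<close> leave three possibilities for
  \<open>(\<alpha>, \<beta>, \<gamma>, \<delta>)\<close>, and each of them gives \<open>P w\<^sup>2 + q y\<^sup>2 = 4 Z\<^sup>2\<close> with \<open>Z\<close> odd and Jacobi symbol \<open>(Z/P) = 1\<close>.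
  This equation produces an ideal \<open>M\<close> of norm \<open>Z\<close> with \<open>[M]\<^sup>2 = [(P, \<omega>)]\<close>. As \<open>(Z/P) = 1\<close> and \<open>A\<^sub>P\<close> has
  corank one, \<open>M (d, \<omega>)\<close> lies in the principal genus for some \<open>d\<close> dividing \<open>P\<close>; equivalently
  \<open>d x\<^sup>2 + (n/d) y\<^sup>2 = Z z\<^sup>2\<close> is solvable, and then \<open>[M (d, \<omega>)] = [D]\<^sup>-\<^sup>2\<close> for some \<open>D\<close>. Now
  \<open>[D]\<^sup>4 = [(P, \<omega>)] \<noteq> 1\<close>, so \<open>[D]\<close> and the \<open>2\<^sup>t\<close> classes \<open>[(d, \<omega>)]\<close>, \<open>d\<close> dividing \<open>P\<close>, generate a group of
  order \<open>2\<^sup>t\<^sup>+\<^sup>2\<close>.\<close>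

section \<open>Matrices of corank one over the field with two elements\<close>

text \<open>The field has discriminant -n with t + 1 prime factors, so its 2-torsion classes number
  2^t. They are the [(d, \<omega>)]; d and n/d give the same class, and the divisors of P represent
  each pair once. By (b) the Redei matrix is A_P bordered by zeros, so (a) makes the 4-rank one, and
  [(P, \<omega>)] is the only nontrivial 2-torsion class that is a square. Congruence of n makes it
  a fourth power, whence the exponent t + 2 instead of t + 1. The obstacle is that [M], a square
  root of this class, need not be a square itself. Its genus is given by the symbols (Z/p_i), and
  multiplication by (d, \<omega>) shifts them by a combination of columns of A_P. Such combinations
  fill exactly the hyperplane of vectors with zero sum, so only the product (Z/P) obstructs; the
  character at q is trivial by reciprocity. Controlling (Z/P) is the purpose of the three explicit
  forms of the equation.\<close>

text \<open>A maximal independent set of columns has t - 1 members and so omits one index k. Over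
  F_2 the only nonzero coefficient is 1, so independence of the others says that no nonempty set of
  them sums to zero.\<close>

lemma independent_columns_of_rank:
  assumes rk: "vec_space.rank t (A :: bit mat) = t - 1" and A: "A \<in> carrier_mat t t" and t: "t > 0"
  obtains k where "k < t"
    "\<And>S. S \<subseteq> {..<t} - {k} \<Longrightarrow> S \<noteq> {} \<Longrightarrow> \<exists>i<t. (\<Sum>j\<in>S. A $$ (i, j)) \<noteq> 0"
proof -
  interpret vec_space "TYPE(bit)" t .
  obtain U where U: "maximal U (\<lambda>T. T \<subseteq> set (cols A) \<and> lin_indpt T)"
    using maximal_exists[of "(\<lambda>T. T \<subseteq> set (cols A) \<and> lin_indpt T)" "card (set (cols A))" "{}"]
    by (meson List.finite_set card_mono empty_iff empty_subsetI finite_lin_indpt2 rev_finite_subset)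
  have Ui: "U \<subseteq> set (cols A)" "lin_indpt U" using U by (auto simp: maximal_def)
  have cardU: "card U = t - 1" using rank_card_indpt[OF A U] rk by simp
  have finU: "finite U" using Ui(1) finite_subset by blast
  have setc: "set (cols A) = col A ` {..<t}" using A by (auto simp: cols_def)
  \<comment> \<open>The rank counts column vectors; choosing one index for each vector of
    \<open>U\<close> returns to indices, and the count t - 1 leaves exactly one index out.\<close>
  obtain T where T: "T \<subseteq> {..<t}" "inj_on (col A) T" "col A ` T = U"
    using Ui(1) setc by (metis subset_image_inj)
  have cT: "card T = t - 1" using T cardU by (metis card_image)
  have fT: "finite T" using T(1) finite_subset by blast
  have "card ({..<t} - T) = 1" using cT t card_Diff_subset[OF fT T(1)] by simp
  then obtain k where k: "{..<t} - T = {k}" using card_1_singletonE by blast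
  have Teq: "T = {..<t} - {k}" using k T(1) by auto
  show thesis
  proof (rule that)
    show "k < t" using k by auto
    fix S assume S: "S \<subseteq> {..<t} - {k}" "S \<noteq> {}"
    show "\<exists>i<t. (\<Sum>j\<in>S. A $$ (i, j)) \<noteq> 0"
    proof (rule ccontr)
      assume neg: "\<not> ?thesis"
      have ST: "S \<subseteq> T" using S Teq by simp
      have fS: "finite S" using ST fT finite_subset by blast
      have injS: "inj_on (col A) S" using T(2) ST inj_on_subset by blast
      obtain s where s: "s \<in> S" using S by auto
      have sub: "col A ` S \<subseteq> U" using ST T(3) by auto
      have carr: "col A ` S \<subseteq> carrier_vec t" using A by auto
      have "lincomb (\<lambda>_. 1) (col A ` S) = 0\<^sub>v t"
      proof (rule eq_vecI)
        show "dim_vec (lincomb (\<lambda>_. 1) (col A ` S)) = dim_vec (0\<^sub>v t)" 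
          using lincomb_dim[OF _ carr] fS by simp
        fix i assume "i < dim_vec (0\<^sub>v t :: bit vec)"
        hence i: "i < t" by simp
        have "lincomb (\<lambda>_. 1) (col A ` S) $ i = (\<Sum>x\<in>col A ` S. 1 * x $ i)"
          by (rule lincomb_index[OF i carr])
        also have "\<dots> = (\<Sum>j\<in>S. col A j $ i)"
          by (subst sum.reindex[OF injS]) (simp only: o_def mult_1_left)
        also have "\<dots> = (\<Sum>j\<in>S. A $$ (i, j))"
          using S A i by (intro sum.cong) auto
        finally show "lincomb (\<lambda>_. 1) (col A ` S) $ i = 0\<^sub>v t $ i" using neg i by simp
      qed
      thus False using Ui(2)

        using lin_dep_crit[OF finite_imageI[OF fS] sub _ imageI[OF s], of "\<lambda>_. 1"] by simp
    qed
  qed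
qed

lemma bit_add_eq_0_iff: "a + b = 0 \<longleftrightarrow> a = b" for a b :: bit
  by (cases a; cases b) simp_all

lemma bit_eq_if_nonzero_iff: "(a \<noteq> 0 \<longleftrightarrow> b \<noteq> 0) \<Longrightarrow> a = b" for a b :: bit
  by (cases a; cases b) simp_all

lemma bit_set_sum_symm_diff:
  assumes "finite S" "finite T"
  shows "(\<Sum>j\<in>(S - T) \<union> (T - S). f j :: bit) = sum f S + sum f T"
proof -
  have "sum f S = sum f (S - T) + sum f (S \<inter> T)"
    using assms by (metis sum.Int_Diff add.commute)
  moreover have "sum f T = sum f (T - S) + sum f (S \<inter> T)"
    using assms by (metis sum.Int_Diff add.commute Int_commute)
  moreover have "(\<Sum>j\<in>(S - T) \<union> (T - S). f j) = sum f (S - T) + sum f (T - S)"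
    using assms by (intro sum.union_disjoint) auto
  ultimately show ?thesis
    by (cases "sum f (S - T)"; cases "sum f (T - S)"; cases "sum f (S \<inter> T)") simp_all
qed

text \<open>Zero row sums put a set and its complement into the kernel together. One of the two
  avoids the omitted index k, and there only the empty set has sum zero.\<close>

lemma kernel_of_corank_one:
  fixes A :: "bit mat"
  assumes "vec_space.rank t A = t - 1" "A \<in> carrier_mat t t" "t > 0"
    and rows: "\<And>i. i < t \<Longrightarrow> (\<Sum>j<t. A $$ (i, j)) = 0"
    and S: "S \<subseteq> {..<t}" and ker: "\<And>i. i < t \<Longrightarrow> (\<Sum>j\<in>S. A $$ (i, j)) = 0"
  shows "S = {} \<or> S = {..<t}"
proof -
  obtain k where k: "k < t"
    "\<And>S. S \<subseteq> {..<t} - {k} \<Longrightarrow> S \<noteq> {} \<Longrightarrow> \<exists>i<t. (\<Sum>j\<in>S. A $$ (i, j)) \<noteq> 0"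
    using independent_columns_of_rank[OF assms(1-3)] by blast
  show ?thesis
  proof (cases "k \<in> S")
    case False
    hence "S \<subseteq> {..<t} - {k}" using S by auto
    thus ?thesis using k(2)[of S] ker by blast
  next
    case True
    have *: "(\<Sum>j\<in>{..<t} - S. A $$ (i, j)) = 0" if "i < t" for i
      using rows[OF that] ker[OF that] sum.subset_diff[OF S finite_lessThan, of "\<lambda>j. A $$ (i, j)"] by simp
    have "{..<t} - S \<subseteq> {..<t} - {k}" using True by auto
    hence "{..<t} - S = {}" using k(2)[of "{..<t} - S"] * by metis
    thus ?thesis using S by auto
  qed
qed

text \<open>A counting argument: \<open>F\<close> maps a set of columns without k to the support of
  its sum outside k. It is an injective map of a finite power set to itself, hence surjective, and
  so reaches the support of z.\<close>

lemma range_of_corank_one: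
  fixes A :: "bit mat"
  assumes "vec_space.rank t A = t - 1" "A \<in> carrier_mat t t" "t > 0"
    and columns: "\<And>j. j < t \<Longrightarrow> (\<Sum>i<t. A $$ (i, j)) = 0"
    and z: "(\<Sum>i<t. z i) = 0"
  shows "\<exists>S\<subseteq>{..<t}. \<forall>i<t. (\<Sum>j\<in>S. A $$ (i, j)) = z i"
proof -
  obtain k where k: "k < t"
    "\<And>S. S \<subseteq> {..<t} - {k} \<Longrightarrow> S \<noteq> {} \<Longrightarrow> \<exists>i<t. (\<Sum>j\<in>S. A $$ (i, j)) \<noteq> 0"
    using independent_columns_of_rank[OF assms(1-3)] by blast
  let ?T = "{..<t} - {k}"
  define F where "F S = {i\<in>?T. (\<Sum>j\<in>S. A $$ (i, j)) \<noteq> 0}" for S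
  \<comment> \<open>The rows add up to zero, so row k is the sum of the others and only the rows in
    \<open>?T\<close> need to be matched.\<close>
  have last: "(\<Sum>j\<in>S. A $$ (k, j)) = (\<Sum>i\<in>?T. \<Sum>j\<in>S. A $$ (i, j))" if "S \<subseteq> {..<t}" for S
  proof -
    have "(\<Sum>i<t. \<Sum>j\<in>S. A $$ (i, j)) = (\<Sum>j\<in>S. \<Sum>i<t. A $$ (i, j))" by (rule sum.swap)
    also have "\<dots> = 0" using that columns by (intro sum.neutral) auto
    finally have "(\<Sum>j\<in>S. A $$ (k, j)) + (\<Sum>i\<in>?T. \<Sum>j\<in>S. A $$ (i, j)) = 0"
      using k(1) by (simp only: sum.remove[of "{..<t}" k] finite_lessThan lessThan_iff)
    thus ?thesis by (simp only: bit_add_eq_0_iff)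
  qed
  have inj: "inj_on F (Pow ?T)"
  proof (rule inj_onI)
    fix S S' assume S: "S \<in> Pow ?T" "S' \<in> Pow ?T" and eq: "F S = F S'"
    have fin: "finite S" "finite S'"
      using S by (auto intro: finite_subset[OF _ finite_lessThan[of t]])
    let ?D = "(S - S') \<union> (S' - S)"
    have *: "(\<Sum>j\<in>S. A $$ (i, j)) = (\<Sum>j\<in>S'. A $$ (i, j))" if "i \<in> ?T" for i
    proof (rule bit_eq_if_nonzero_iff)
      show "(\<Sum>j\<in>S. A $$ (i, j)) \<noteq> 0 \<longleftrightarrow> (\<Sum>j\<in>S'. A $$ (i, j)) \<noteq> 0"
        using eq that unfolding F_def by blast
    qed
    have "(\<Sum>j\<in>S. A $$ (k, j)) = (\<Sum>j\<in>S'. A $$ (k, j))"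
    proof -
      have "S \<subseteq> {..<t}" "S' \<subseteq> {..<t}" using S by auto
      moreover have "(\<Sum>i\<in>?T. \<Sum>j\<in>S. A $$ (i, j)) = (\<Sum>i\<in>?T. \<Sum>j\<in>S'. A $$ (i, j))"
        by (rule sum.cong[OF refl]) (rule *)
      ultimately show ?thesis using last by metis
    qed
    hence "(\<Sum>j\<in>S. A $$ (i, j)) = (\<Sum>j\<in>S'. A $$ (i, j))" if "i < t" for i
      using * that by (cases "i = k") blast+
    hence "(\<Sum>j\<in>?D. A $$ (i, j)) = 0" if "i < t" for i
      using that by (simp only: bit_set_sum_symm_diff[OF fin] bit_add_eq_0_iff)
    hence "?D = {}" using k(2)[of ?D] S by blast
    thus "S = S'" by auto
  qed
  have "F ` Pow ?T \<subseteq> Pow ?T" by (auto simp: F_def)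
  hence "F ` Pow ?T = Pow ?T"
    using endo_inj_surj[OF _ _ inj] by simp
  moreover have "{i\<in>?T. z i \<noteq> 0} \<in> Pow ?T" by auto
  ultimately obtain S where S: "S \<in> Pow ?T" "F S = {i\<in>?T. z i \<noteq> 0}" by (metis (no_types, lifting) imageE)
  have *: "(\<Sum>j\<in>S. A $$ (i, j)) = z i" if "i \<in> ?T" for i
  proof (rule bit_eq_if_nonzero_iff)
    show "(\<Sum>j\<in>S. A $$ (i, j)) \<noteq> 0 \<longleftrightarrow> z i \<noteq> 0"
      using S(2) that unfolding F_def by blast
  qed
  have sumz: "(\<Sum>j\<in>S. A $$ (k, j)) = (\<Sum>i\<in>?T. z i)"
  proof -
    have "S \<subseteq> {..<t}" using S by auto
    moreover have "(\<Sum>i\<in>?T. \<Sum>j\<in>S. A $$ (i, j)) = (\<Sum>i\<in>?T. z i)"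
      by (rule sum.cong[OF refl]) (rule *)
    ultimately show ?thesis using last by metis
  qed
  have "z k + (\<Sum>i\<in>?T. z i) = 0"
    using z sum.remove[of "{..<t}" k z] k(1) by (metis finite_lessThan lessThan_iff)
  hence zk: "z k = (\<Sum>i\<in>?T. z i)" by (rule bit_add_eq_0_iff[THEN iffD1])
  have "(\<Sum>j\<in>S. A $$ (i, j)) = z i" if "i < t" for i
  proof (cases "i = k")
    case True
    show ?thesis unfolding True by (rule trans[OF sumz zk[symmetric]])
  next
    case False
    thus ?thesis using that by (intro *) auto
  qed
  thus ?thesis using S(1) by blast
qed

section \<open>Legendre symbols\<close>

lemma Legendre_values: "Legendre a p \<in> {-1, 0, 1}"
  by (simp add: Legendre_def)

lemma Legendre_eq_0_iff: "Legendre a p = 0 \<longleftrightarrow> p dvd a"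
  by (simp add: Legendre_def cong_0_iff)

lemma Legendre_cong: "[a = b] (mod p) \<Longrightarrow> Legendre a p = Legendre b p"
  unfolding Legendre_def QuadRes_def by (simp add: cong_def)

lemma Legendre_1_iff: "Legendre a p = 1 \<longleftrightarrow> \<not> p dvd a \<and> (\<exists>c. [c\<^sup>2 = a] (mod p))"
  by (auto simp: Legendre_def QuadRes_def cong_0_iff)

text \<open>Two values among -1, 0, 1 differ by at most 2 < p. This turns the congruences of Euler's
  criterion into equalities.\<close>

lemma sign_cong_eq:
  fixes x y :: int
  assumes "x \<in> {-1, 0, 1}" "y \<in> {-1, 0, 1}" "[x = y] (mod int p)" "p > 2"
  shows "x = y"
proof (rule ccontr)
  assume "x \<noteq> y"
  have "int p dvd x - y" using assms(3) by (simp add: cong_iff_dvd_diff)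
  hence "int p \<le> \<bar>x - y\<bar>" using \<open>x \<noteq> y\<close> by (intro zdvd_imp_le[of "int p" "\<bar>x - y\<bar>"]) auto
  thus False using assms by auto
qed

lemma Legendre_mult:
  assumes "prime p" "p > (2::nat)"
  shows "Legendre (a * b) (int p) = Legendre a (int p) * Legendre b (int p)"
proof (rule sign_cong_eq[OF _ _ _ assms(2)])
  show "Legendre a (int p) * Legendre b (int p) \<in> {-1, 0, 1}"
    using Legendre_values[of a "int p"] Legendre_values[of b "int p"] by auto
  let ?k = "(p - 1) div 2"
  have "[Legendre a p * Legendre b p = a ^ ?k * b ^ ?k] (mod p)"
    by (intro cong_mult euler_criterion assms)
  moreover have "[Legendre (a * b) p = (a * b) ^ ?k] (mod p)"
    by (intro euler_criterion assms)
  ultimately show "[Legendre (a * b) (int p) = Legendre a (int p) * Legendre b (int p)] (mod int p)"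
    by (metis cong_sym cong_trans power_mult_distrib)
qed (rule Legendre_values)

lemma Legendre_1: "p > (1::nat) \<Longrightarrow> Legendre 1 (int p) = 1"
  unfolding Legendre_1_iff by (auto intro!: exI[of _ 1])

lemma Legendre_prod:
  assumes "prime p" "p > (2::nat)" "finite S"
  shows "Legendre (\<Prod>i\<in>S. f i) (int p) = (\<Prod>i\<in>S. Legendre (f i) (int p))"
  using assms(3) by (induction S rule: finite_induct)
    (use assms in \<open>auto simp: Legendre_mult Legendre_1\<close>)

lemma Legendre_mult_square:
  assumes "prime p" "p > (2::nat)" "\<not> int p dvd s"
  shows "Legendre (a * s\<^sup>2) (int p) = Legendre a (int p)"
proof -
  have "Legendre (s\<^sup>2) (int p) = 1"
    unfolding Legendre_1_iff using assms
    by (auto simp: prime_dvd_power_iff intro!: exI[of _ s])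
  thus ?thesis using Legendre_mult[OF assms(1,2)] by simp
qed

lemma Legendre_minus_1:
  assumes "prime p" "p > (2::nat)"
  shows "Legendre (-1) (int p) = (if p mod 4 = 1 then 1 else -1)"
proof (rule sign_cong_eq[OF _ _ _ assms(2)])
  have "odd p" using assms prime_odd_nat by auto
  hence "even ((p - 1) div 2) \<longleftrightarrow> p mod 4 = 1" by presburger
  hence "(-1::int) ^ ((p - 1) div 2) = (if p mod 4 = 1 then 1 else -1)" by simp
  thus "[Legendre (-1) (int p) = (if p mod 4 = 1 then 1 else -1)] (mod int p)"
    using euler_criterion[OF assms, of "-1"] by simp
qed (auto simp: Legendre_def)

lemma Legendre_uminus:
  assumes "prime p" "p > (2::nat)"
  shows "Legendre (- a) (int p) = (if p mod 4 = 1 then Legendre a (int p) else - Legendre a (int p))"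
  using Legendre_mult[OF assms, of "-1" a] Legendre_minus_1[OF assms] by auto

lemma Legendre_reciprocal:
  assumes "prime p" "p > 2" "prime l" "l > 2" "p \<noteq> l" "p mod 4 = (1::nat)"
  shows "Legendre (int p) (int l) = Legendre (int l) (int p)"
proof -
  have "even ((p - 1) div 2)" using assms(6) by presburger
  hence "Legendre p l * Legendre l p = 1"
    using Quadratic_Reciprocity[OF assms(1-5)] by simp
  thus ?thesis using zmult_eq_1_iff by auto
qed

text \<open>For q = 3 modulo 4 the prime discriminant is -q, which gives a reciprocity law without a
  case distinction on l.\<close>

lemma Legendre_reciprocal_3:
  assumes "prime q" "q > 2" "prime l" "l > 2" "q \<noteq> l" "q mod 4 = (3::nat)"
  shows "Legendre (int l) (int q) = Legendre (- int q) (int l)"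
proof (cases "l mod 4 = 1")
  case True
  thus ?thesis using assms Legendre_reciprocal[of l q] Legendre_uminus[of l q] by simp
next
  case False
  have "odd ((q - 1) div 2)" using assms(6) by presburger
  moreover have "odd l" using assms prime_odd_nat by auto
  hence "odd ((l - 1) div 2)" using False by presburger
  ultimately have "Legendre q l * Legendre l q = -1"
    using Quadratic_Reciprocity[OF assms(1-5)] by simp
  thus ?thesis using Legendre_uminus[of l q] assms False
      Legendre_values[of q l] Legendre_values[of l q] by auto
qed

section \<open>The quadratic character of 2 and comparison of multiplicative functions\<close>

text \<open>The Kronecker symbol (2/m), extended by 0 to even m so that it is multiplicative on all
  natural numbers.\<close>

definition chi2 :: "nat \<Rightarrow> int" where
  "chi2 m = (if even m then 0 else if m mod 8 = 1 \<or> m mod 8 = 7 then 1 else -1)"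

lemma chi2_mult: "chi2 (a * b) = chi2 a * chi2 b"
proof -
  have mod: "chi2 m = chi2 (m mod 8)" for m by (simp add: chi2_def dvd_mod_iff)
  have "c \<in> {0, 1, 2, 3, 4, 5, 6, 7} \<Longrightarrow> d \<in> {0, 1, 2, 3, 4, 5, 6, 7} \<Longrightarrow>
      chi2 (c * d) = chi2 c * chi2 d" for c d
    by (elim insertE) (simp_all add: chi2_def)
  moreover have "m mod 8 \<in> {0, 1, 2, 3, 4, 5, 6, 7::nat}" for m
  proof -
    show ?thesis unfolding insert_iff empty_iff by presburger
  qed
  ultimately have "chi2 ((a mod 8) * (b mod 8)) = chi2 (a mod 8) * chi2 (b mod 8)" by blast
  thus ?thesis using mod[of a] mod[of b] mod[of "a * b"] mod[of "(a mod 8) * (b mod 8)"]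
    by (simp add: mod_mult_eq)
qed

text \<open>Gauss's lemma for the multiplier 2: the doubles 2x with x \<le> h = (p - 1)/2 need no
  reduction, and those above h come from h/2 < x \<le> h. The parity of their number depends on p
  modulo 8.\<close>

lemma Legendre_2:
  assumes "prime p" "p > (2::nat)"
  shows "Legendre 2 (int p) = chi2 p"
proof -
  have odd: "odd p" using assms prime_odd_nat by auto
  have nd: "\<not> [2 = 0] (mod int p)"
    using assms(2) by (simp add: cong_0_iff zdvd_not_zless)
  interpret GAUSS p 2 using assms nd by unfold_locales auto
  let ?h = "(int p - 1) div 2"
  have p2: "int p = 2 * ?h + 1" using odd by presburger
  have E: "E = (\<lambda>x. 2 * x) ` {?h div 2 <.. ?h}"
  proof -
    have "C = (\<lambda>x. 2 * x) ` {0<..?h}"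
      unfolding C_def B_def A_def image_image
    proof (intro image_cong refl)
      fix x assume "x \<in> {0<..?h}"
      hence "0 \<le> x * 2" "x * 2 < int p" using p2 by auto
      thus "x * 2 mod int p = 2 * x" by simp
    qed
    hence "E = (\<lambda>x. 2 * x) ` {0<..?h} \<inter> {?h<..}" by (simp add: E_def)
    also have "\<dots> = (\<lambda>x. 2 * x) ` {?h div 2 <.. ?h}"
    proof -
      have "?h \<ge> 0" using p2 assms by linarith
      thus ?thesis by auto
    qed
    finally show ?thesis .
  qed
  have "card E = card {?h div 2 <.. ?h}" unfolding E by (rule card_image) (auto simp: inj_on_def)
  hence "card E = nat (?h - ?h div 2)" by simp
  moreover have "?h \<ge> 0" using p2 assms by linarith
  ultimately have card: "int (card E) = ?h - ?h div 2" by simp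
  have "even (card E) \<longleftrightarrow> p mod 8 = 1 \<or> p mod 8 = 7"
    using card odd by presburger
  thus ?thesis using gauss_lemma odd unfolding chi2_def by auto
qed

text \<open>Jacobi symbols are evaluated through this principle: a completely multiplicative
  function is fixed by its values at the prime divisors of the argument, where reciprocity for
  primes applies.\<close>

lemma multiplicative_eqI:
  fixes f g :: "nat \<Rightarrow> int"
  assumes f: "f 1 = 1" "\<And>a b. f (a * b) = f a * f b"
    and g: "g 1 = 1" "\<And>a b. g (a * b) = g a * g b"
    and "m > 0" "\<And>l. prime l \<Longrightarrow> l dvd m \<Longrightarrow> f l = g l"
  shows "f m = g m"
  using assms(5,6)
proof (induction m rule: less_induct)
  case (less m)
  show ?case
  proof (cases "m = 1")
    case False
    then obtain l where l: "prime l" "l dvd m" using prime_factor_nat by blast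
    then obtain k where k: "m = l * k" by auto
    have "k > 0" using k less.prems(1) by (cases k) auto
    moreover from this have "1 * k < l * k"
      using prime_gt_1_nat[OF l(1)] by (intro mult_strict_right_mono)
    ultimately have "f k = g k" using less k by auto
    thus ?thesis using k f(2) g(2) less.prems(2)[OF l] by simp
  qed (simp only: f(1) g(1))
qed

lemma chinese_remainder_family:
  fixes m u :: "'a \<Rightarrow> int"
  assumes "finite I" "\<And>i j. i \<in> I \<Longrightarrow> j \<in> I \<Longrightarrow> i \<noteq> j \<Longrightarrow> coprime (m i) (m j)"
  shows "\<exists>c. \<forall>i\<in>I. [c = u i] (mod m i)"
  using assms
proof (induction I rule: finite_induct)
  case (insert k I)
  then obtain c where c: "\<forall>i\<in>I. [c = u i] (mod m i)" by auto
  have "coprime (\<Prod>i\<in>I. m i) (m k)"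
    using insert by (intro prod_coprime_left) auto
  then obtain d where d: "[d = c] (mod (\<Prod>i\<in>I. m i))" "[d = u k] (mod m k)"
    using binary_chinese_remainder_int by blast
  have "[d = u i] (mod m i)" if "i \<in> I" for i
    using d(1) c that insert(1) by (meson cong_dvd_modulus cong_trans dvd_prodI)
  thus ?case using d(2) by auto
qed auto

lemma square_root_mod_prod:
  fixes m :: "'a \<Rightarrow> int"
  assumes "finite I" "\<And>i j. i \<in> I \<Longrightarrow> j \<in> I \<Longrightarrow> i \<noteq> j \<Longrightarrow> coprime (m i) (m j)"
    and "\<And>i. i \<in> I \<Longrightarrow> \<exists>c. [c\<^sup>2 = x] (mod m i)"
  shows "\<exists>c. [c\<^sup>2 = x] (mod (\<Prod>i\<in>I. m i))"
proof -
  obtain u where u: "\<And>i. i \<in> I \<Longrightarrow> [(u i)\<^sup>2 = x] (mod m i)" using assms(3) by metis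
  obtain c where c: "\<And>i. i \<in> I \<Longrightarrow> [c = u i] (mod m i)"
    using chinese_remainder_family[of I m u] assms by blast
  have "[c\<^sup>2 = x] (mod m i)" if "i \<in> I" for i
    using cong_pow[OF c[OF that], of 2] u[OF that] by (rule cong_trans)
  thus ?thesis
    using assms(1,2) by (intro exI[of _ c] cong_cong_prod_coprime) auto
qed

section \<open>Congruent numbers and descent\<close>

lemma coprime_mult_eq_square:
  fixes x y k :: int
  assumes "coprime x y" "x > 0" "y > 0" "x * y = k\<^sup>2"
  obtains r where "r > 0" "x = r\<^sup>2"
proof -
  have "int (nat x * nat y) = int (nat \<bar>k\<bar> ^ 2)" using assms by simp
  hence "nat x * nat y = nat \<bar>k\<bar> ^ 2" by (simp only: of_nat_eq_iff)
  hence "is_nth_power 2 (nat x * nat y)" unfolding is_nth_power_def by blast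
  moreover have "coprime (nat x) (nat y)"
    using assms(1-3) coprime_int_iff[of "nat x" "nat y"] by simp
  moreover have "nat x > 0" "nat y > 0" using assms(2,3) by simp_all
  ultimately have "is_nth_power 2 (nat x)" by (metis is_nth_power_mult_coprime_natD(1))
  then obtain r where "nat x = r ^ 2" by (auto simp: is_nth_power_def)
  hence "int (nat x) = int (r ^ 2)" by simp
  hence r: "x = (int r)\<^sup>2" using assms(2) by simp
  hence "int r > 0" using assms(2) by (cases "r = 0") auto
  thus thesis using r that by blast
qed

lemma not_coprime_prime_divisor:
  fixes a b :: int
  assumes "\<not> coprime a b" "b \<noteq> 0"
  obtains l where "prime l" "l dvd a" "l dvd b"
proof -
  have "\<not> is_unit (gcd a b)" "gcd a b \<noteq> 0" using assms by (auto simp: coprime_iff_gcd_eq_1)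
  then obtain l where "prime l" "l dvd gcd a b" using prime_divisor_exists by blast
  thus thesis using that by simp
qed

lemma squarefree_int_iff: "squarefree (int n) \<longleftrightarrow> squarefree n"
proof
  assume n: "squarefree n"
  show "squarefree (int n)"
  proof (rule squarefreeI)
    fix z :: int assume "z\<^sup>2 dvd int n"
    hence "int (nat \<bar>z\<bar> ^ 2) dvd int n" by simp
    hence "nat \<bar>z\<bar> ^ 2 dvd n" by (simp only: int_dvd_int_iff)
    hence "nat \<bar>z\<bar> dvd 1" using n squarefreeD by blast
    thus "z dvd 1" by (simp add: nat_eq_iff)
  qed
next
  assume n: "squarefree (int n)"
  show "squarefree n"
  proof (rule squarefreeI)
    fix x :: nat assume "x\<^sup>2 dvd n"
    hence "(int x)\<^sup>2 dvd int n" by (metis int_dvd_int_iff of_nat_power)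
    hence "is_unit (int x)" using n squarefreeD by blast
    thus "is_unit x" by simp
  qed
qed

lemma squarefree_square_eq_1:
  fixes w n :: int
  assumes "squarefree n" "w\<^sup>2 dvd n"
  shows "w\<^sup>2 = 1"
proof -
  have "is_unit w" using assms squarefreeD by blast
  thus ?thesis by (auto simp: zdvd1_eq power2_eq_1_iff abs_if split: if_splits)
qed

text \<open>Once gcd(x, y) is cancelled, the square of what remains of x divides n, so the rest is a
  unit.\<close>

lemma square_dvd_squarefree_mult_square:
  fixes n x y :: int
  assumes n: "squarefree n" and dvd: "x\<^sup>2 dvd n * y\<^sup>2" and y: "y \<noteq> 0"
  shows "x dvd y"
proof -
  define g where "g = gcd x y"
  have g: "g \<noteq> 0" using y by (simp add: g_def)
  obtain x' y' where xy: "x = x' * g" "y = y' * g" "coprime x' y'"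
    unfolding g_def using gcd_coprime_exists[of x y] y by (metis gcd_eq_0_iff)
  have "x'\<^sup>2 dvd n * y'\<^sup>2"
    using dvd g unfolding xy(1,2) power_mult_distrib mult.assoc[symmetric]
    by (subst (asm) dvd_mult_cancel_right) simp
  moreover have "coprime (x'\<^sup>2) (y'\<^sup>2)" using xy(3) by simp
  ultimately have "x'\<^sup>2 dvd n" by (simp add: coprime_dvd_mult_left_iff)
  hence "x' dvd 1" using n squarefreeD by blast
  hence "x' dvd y'" by (meson dvd_trans one_dvd)
  thus ?thesis unfolding xy(1,2) by (intro mult_dvd_mono) auto
qed

text \<open>The basic step of the 2-descent: n divides w x with w and x coprime, so it splits as
  gcd(w, n) gcd(x, n), and the two cofactors are coprime with product m^2.\<close>

lemma squarefree_coprime_split: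
  fixes n w x m :: int
  assumes n: "squarefree n" "n > 0" and "coprime w x" "w > 0" "x > 0" "m > 0" "w * x = n * m\<^sup>2"
  obtains \<alpha> \<beta> r s where "\<alpha> > 0" "\<beta> > 0" "r > 0" "s > 0" "n = \<alpha> * \<beta>"
    "w = \<alpha> * r\<^sup>2" "x = \<beta> * s\<^sup>2" "m = r * s"
proof -
  define \<alpha> where "\<alpha> = gcd w n"
  define \<beta> where "\<beta> = gcd x n"
  have pos: "\<alpha> > 0" "\<beta> > 0" using n by (simp_all add: \<alpha>_def \<beta>_def)
  have nab: "n = \<alpha> * \<beta>"
  proof (rule zdvd_antisym_nonneg)
    have "n dvd w * x" using assms(7) by simp
    then obtain b c where bc: "n = b * c" "b dvd w" "c dvd x"
      using division_decomp by blast
    thus "n dvd \<alpha> * \<beta>" unfolding \<alpha>_def \<beta>_def by (simp add: mult_dvd_mono)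
    have "coprime \<alpha> \<beta>"
      unfolding \<alpha>_def \<beta>_def using assms(3) by (meson coprime_divisors gcd_dvd1)
    thus "\<alpha> * \<beta> dvd n" by (intro divides_mult) (simp_all add: \<alpha>_def \<beta>_def)
  qed (use n pos in auto)
  obtain w' where w: "w = \<alpha> * w'" unfolding \<alpha>_def by (meson dvdE gcd_dvd1)
  obtain x' where x: "x = \<beta> * x'" unfolding \<beta>_def by (meson dvdE gcd_dvd1)
  have p': "w' > 0" "x' > 0" using w x pos assms by (simp_all add: zero_less_mult_iff)
  have wx: "w' * x' = m\<^sup>2"
    using assms(7) pos unfolding nab w x by (simp add: mult_ac)
  have cop: "coprime w' x'" using assms(3) w x by simp
  obtain r where r: "r > 0" "w' = r\<^sup>2" using coprime_mult_eq_square[OF cop p' wx] by blast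
  obtain s where s: "s > 0" "x' = s\<^sup>2"
    using coprime_mult_eq_square[of x' w' m] cop p' wx by (auto simp: mult.commute coprime_commute)
  have "(r * s)\<^sup>2 = m\<^sup>2" using wx r s by (simp add: power_mult_distrib)
  hence "m = r * s" using r s assms(6) by (simp add: power2_eq_iff_nonneg)
  thus thesis using that[OF pos r(1) s(1) nab] w x r s by simp
qed

text \<open>\<open>(a\<^sup>2 - b\<^sup>2, 2 a b, a\<^sup>2 + b\<^sup>2)\<close> is a right triangle of area \<open>n m\<^sup>2\<close>.\<close>

definition primitive_triangle :: "int \<Rightarrow> int \<Rightarrow> int \<Rightarrow> int \<Rightarrow> bool" where
  "primitive_triangle n m a b \<longleftrightarrow> 0 < b \<and> b < a \<and> coprime a b \<and> odd (a + b) \<and>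
     a * b * ((a + b) * (a - b)) = n * m\<^sup>2"

text \<open>Parametrisation of primitive Pythagorean triples: (z + x)/2 and (z - x)/2 are coprime
  with product (y/2)^2, so they are squares a^2 and b^2. Their sum z is odd, whence the opposite
  parity of a and b.\<close>

lemma primitive_triangle_of_coprime_legs:
  fixes x y z n m :: int
  assumes "x > 0" "y > 0" "z > 0" "x\<^sup>2 + y\<^sup>2 = z\<^sup>2" "coprime x y" "even y" "x * y = 2 * n * m\<^sup>2"
  shows "\<exists>a b. primitive_triangle n m a b"
proof -
  have ox: "odd x" using assms(5,6) by (metis coprime_common_divisor even_numeral odd_one)
  have oz: "odd z" 
  proof -
    have "odd (x\<^sup>2 + y\<^sup>2)" using ox assms(6) by simp
    thus ?thesis using assms(4) by simp
  qed
  obtain k where k: "y = 2 * k" using assms(6) by blast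
  obtain i where i: "z + x = 2 * i" using ox oz by (metis evenE odd_even_add)
  obtain j where j: "z - x = 2 * j" using ox oz by (metis evenE even_diff odd_even_add)
  have "x < z" using assms by (smt (verit) power2_less_imp_less zero_less_power2)
  hence pos: "i > 0" "j > 0" using i j assms by auto
  have zx: "z = i + j" "x = i - j" using i j by auto
  have ij: "i * j = k\<^sup>2"
  proof -
    have "4 * (i * j) = z\<^sup>2 - x\<^sup>2" unfolding zx by (simp add: power2_eq_square algebra_simps)
    also have "\<dots> = 4 * k\<^sup>2" using assms(4) k by (simp add: power_mult_distrib)
    finally show ?thesis by simp
  qed
  have cop: "coprime i j"
  proof (rule ccontr)
    assume "\<not> coprime i j"
    then obtain p where p: "prime p" "p dvd i" "p dvd j"
      using pos(2) by (elim not_coprime_prime_divisor) auto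
    hence "p dvd x" unfolding zx by simp
    moreover have "p dvd k\<^sup>2" using p ij by (metis dvd_mult2)
    hence "p dvd y" using p(1) k by (simp add: prime_dvd_power_iff)
    ultimately show False using assms(5) p(1) by (meson coprime_common_divisor not_prime_unit)
  qed
  obtain a where a: "a > 0" "i = a\<^sup>2" using coprime_mult_eq_square[OF cop pos ij] by blast
  obtain b where b: "b > 0" "j = b\<^sup>2"
    using coprime_mult_eq_square[of j i k] cop pos ij by (auto simp: mult.commute coprime_commute)
  have "b\<^sup>2 < a\<^sup>2" using zx(2) assms(1) a b by simp
  hence ba: "b < a" using a b by (simp add: power2_less_imp_less)
  have "odd (a + b)" using oz unfolding zx a b by simp
  moreover have "coprime a b" using cop unfolding a b by simp
  moreover have kab: "k = a * b"
  proof -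
    have "(a * b)\<^sup>2 = k\<^sup>2" using ij a b by (simp add: power_mult_distrib)
    thus ?thesis using a b assms(2) k by (simp add: power2_eq_iff_nonneg)
  qed
  have "a * b * ((a + b) * (a - b)) = n * m\<^sup>2"
  proof -
    have "x = (a + b) * (a - b)" unfolding zx a b by (simp add: power2_eq_square algebra_simps)
    hence "2 * (a * b * ((a + b) * (a - b))) = x * y" unfolding k kab by (simp only: mult_ac)
    thus ?thesis using assms(7) by simp
  qed
  ultimately show ?thesis unfolding primitive_triangle_def using a b ba by auto
qed

text \<open>Dividing the legs by their gcd g keeps the shape of the area: g^2 divides n m^2 and n is
  square-free, so g divides m. The bound on \<open>m'\<close> is for the descent.\<close>

lemma primitive_triangle_of_legs:
  fixes x y z n m :: int
  assumes n: "squarefree n" "n > 0"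
    and xyz: "x > 0" "y > 0" "z > 0" "x\<^sup>2 + y\<^sup>2 = z\<^sup>2" and area: "x * y = 2 * n * m\<^sup>2" "m > 0"
  shows "\<exists>m' a b. 0 < m' \<and> m' \<le> m \<and> primitive_triangle n m' a b"
proof -
  define g where "g = gcd x y"
  have g: "g > 0" using xyz by (simp add: g_def)
  obtain x' y' where xy: "x = x' * g" "y = y' * g" "coprime x' y'"
    unfolding g_def using gcd_coprime_exists[of x y] xyz by (metis gcd_eq_0_iff less_irrefl)
  have pos: "x' > 0" "y' > 0" using xy xyz g by (simp_all add: zero_less_mult_iff)
  have "g\<^sup>2 dvd z\<^sup>2" using xyz(4) unfolding xy by (metis dvd_add dvd_triv_right power_mult_distrib)
  hence "g dvd z" by simp
  then obtain z' where z: "z = z' * g" by (metis dvd_def mult.commute)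
  have z': "z' > 0" using z xyz g by (simp add: zero_less_mult_iff)
  have eq: "x'\<^sup>2 + y'\<^sup>2 = z'\<^sup>2"
  proof -
    have "g\<^sup>2 * (x'\<^sup>2 + y'\<^sup>2) = g\<^sup>2 * z'\<^sup>2"
      using xyz(4) unfolding xy z by (simp add: power_mult_distrib algebra_simps)
    thus ?thesis using g by simp
  qed
  \<comment> \<open>Two odd legs would give z'^2 = 2 modulo 4.\<close>
  have par: "even x' \<or> even y'"
  proof (rule ccontr)
    assume "\<not> ?thesis"
    hence "[x'\<^sup>2 = 1] (mod 4)" "[y'\<^sup>2 = 1] (mod 4)"
      by (auto elim!: oddE simp: cong_iff_dvd_diff power2_eq_square algebra_simps)
    hence "[z'\<^sup>2 = 2] (mod 4)" using eq cong_add[of "x'\<^sup>2" 1 4 "y'\<^sup>2" 1] by simp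
    moreover have "[z'\<^sup>2 = 0] (mod 4) \<or> [z'\<^sup>2 = 1] (mod 4)"
      by (cases "even z'") (auto elim!: evenE oddE simp: cong_iff_dvd_diff power2_eq_square algebra_simps)
    ultimately show False by (auto simp: cong_def)
  qed
  then obtain h where h: "x' * y' = 2 * h" by (metis dvd_mult dvd_mult2 dvdE)
  have gh: "g\<^sup>2 * h = n * m\<^sup>2"
  proof -
    have "2 * (g\<^sup>2 * h) = g\<^sup>2 * (x' * y')" using h by simp
    also have "\<dots> = 2 * (n * m\<^sup>2)" using area(1) unfolding xy by (simp add: power2_eq_square algebra_simps)
    finally show ?thesis by simp
  qed
  hence "g dvd m" using square_dvd_squarefree_mult_square[OF n(1)] area(2)
    by (metis dvd_triv_left less_irrefl)
  then obtain m' where m: "m = g * m'" by blast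
  have m': "m' > 0" "m' \<le> m" using m g area(2) by (auto simp: zero_less_mult_iff)
  have "g\<^sup>2 * h = g\<^sup>2 * (n * m'\<^sup>2)" using gh unfolding m by (simp add: power_mult_distrib algebra_simps)
  hence "h = n * m'\<^sup>2" using g by simp
  hence prod: "x' * y' = 2 * n * m'\<^sup>2" using h by simp
  have "\<exists>a b. primitive_triangle n m' a b"
  proof (cases "even y'")
    case True
    thus ?thesis using primitive_triangle_of_coprime_legs[OF pos z' eq xy(3) _ prod] by blast
  next
    case False
    hence "even x'" using par by blast
    moreover have "y'\<^sup>2 + x'\<^sup>2 = z'\<^sup>2" using eq by simp
    moreover have "coprime y' x'" using xy(3) by (simp add: coprime_commute)
    moreover have "y' * x' = 2 * n * m'\<^sup>2" using prod by (simp add: mult.commute)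
    ultimately show ?thesis
      using primitive_triangle_of_coprime_legs[of y' x' z' n m'] pos z' by blast
  qed
  thus ?thesis using m' by blast
qed

lemma primitive_triangle_of_congruent_number:
  assumes "congruent_number n" and n: "squarefree (int n)"
  shows "\<exists>m a b. 0 < m \<and> primitive_triangle (int n) m a b"
proof -
  obtain a b c :: rat where abc: "a > 0" "b > 0" "c > 0" "a\<^sup>2 + b\<^sup>2 = c\<^sup>2" "of_nat n = a * b / 2"
    and n0: "n > 0"
    using assms(1) unfolding congruent_number_def by blast
  have frac: "\<exists>D X. D > (0::int) \<and> x = of_int X / of_int D" for x :: rat
    by (metis quotient_of_denom_pos' quotient_of_div surjective_pairing)
  obtain A D1 where A: "D1 > (0::int)" "a = of_int A / of_int D1" using frac by blast
  obtain B D2 where B: "D2 > (0::int)" "b = of_int B / of_int D2" using frac by blast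
  obtain C D3 where C: "D3 > (0::int)" "c = of_int C / of_int D3" using frac by blast
  define D where "D = D1 * D2 * D3"
  have D: "D > 0" using A B C by (simp add: D_def)
  define X Y Z where "X = A * D2 * D3" and "Y = B * D1 * D3" and "Z = C * D1 * D2"
  have X: "of_int X = a * of_int D" and Y: "of_int Y = b * of_int D" and Z: "of_int Z = c * of_int D"
    using A B C by (simp_all add: X_def Y_def Z_def D_def)
  have "(of_int X :: rat) > 0" "(of_int Y :: rat) > 0" "(of_int Z :: rat) > 0"
    unfolding X Y Z using abc D by simp_all
  hence pos: "X > 0" "Y > 0" "Z > 0" by simp_all
  have "(of_int (X\<^sup>2 + Y\<^sup>2) :: rat) = of_int (Z\<^sup>2)"
    using abc(4) by (simp add: X Y Z power_mult_distrib flip: distrib_right)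
  hence XYZ: "X\<^sup>2 + Y\<^sup>2 = Z\<^sup>2" by (simp only: of_int_eq_iff)
  have "a * b = 2 * of_nat n" using abc(5) by simp
  hence "(of_int (X * Y) :: rat) = of_int (2 * int n * D\<^sup>2)"
    by (simp add: X Y power2_eq_square mult_ac)
  hence "X * Y = 2 * int n * D\<^sup>2" by (simp only: of_int_eq_iff)
  thus ?thesis using primitive_triangle_of_legs[OF n _ pos XYZ _ D] n0 by auto
qed

text \<open>The numbers a, b, a + b, a - b are pairwise coprime because a and b are coprime of
  opposite parity. Splitting n first between \<open>a * b\<close> and
  \<open>(a + b) * (a - b)\<close>, then within each product, makes each of the four a divisor of n
  times a square.\<close>

lemma primitive_triangle_factors:
  fixes n m a b :: int
  assumes n: "squarefree n" "n > 0" and m: "m > 0" and tri: "primitive_triangle n m a b"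
  obtains \<alpha> \<beta> \<gamma> \<delta> r s u v where "\<alpha> > 0" "\<beta> > 0" "\<gamma> > 0" "\<delta> > 0" "r > 0" "s > 0" "u > 0" "v > 0"
    "n = \<alpha> * \<beta> * (\<gamma> * \<delta>)" "m = r * s * (u * v)"
    "\<alpha> * r\<^sup>2 + \<beta> * s\<^sup>2 = \<gamma> * u\<^sup>2" "\<alpha> * r\<^sup>2 - \<beta> * s\<^sup>2 = \<delta> * v\<^sup>2"
    "coprime (\<alpha> * r) (\<beta> * s)" "odd (\<gamma> * u)"
proof -
  have ab: "0 < b" "b < a" "coprime a b" "odd (a + b)" "a * b * ((a + b) * (a - b)) = n * m\<^sup>2"
    using tri by (auto simp: primitive_triangle_def)
  have c1: "coprime a (a + b)" "coprime b (a + b)" "coprime a (a - b)" "coprime b (a - b)"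
  proof -
    show "coprime a (a + b)"
    proof (rule coprimeI)
      fix d assume d: "d dvd a" "d dvd a + b"
      have "d dvd a" "d dvd b" using d dvd_diff[of d "a + b" a] by auto
      thus "is_unit d" using ab(3) coprime_common_divisor by blast
    qed
    show "coprime b (a + b)"
    proof (rule coprimeI)
      fix d assume d: "d dvd b" "d dvd a + b"
      have "d dvd a" "d dvd b" using d dvd_diff[of d "a + b" b] by auto
      thus "is_unit d" using ab(3) coprime_common_divisor by blast
    qed
    show "coprime a (a - b)"
    proof (rule coprimeI)
      fix d assume d: "d dvd a" "d dvd a - b"
      have "d dvd a" "d dvd b" using d dvd_diff[of d a "a - b"] by auto
      thus "is_unit d" using ab(3) coprime_common_divisor by blast
    qed
    show "coprime b (a - b)"
    proof (rule coprimeI)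
      fix d assume d: "d dvd b" "d dvd a - b"
      have "d dvd a" "d dvd b" using d dvd_add[of d "a - b" b] by auto
      thus "is_unit d" using ab(3) coprime_common_divisor by blast
    qed
  qed
  have c2: "coprime (a + b) (a - b)"
  proof (rule coprimeI)
    fix d assume d: "d dvd a + b" "d dvd a - b"
    hence "d dvd (a + b) + (a - b)" "d dvd (a + b) - (a - b)" by (blast intro: dvd_add dvd_diff)+
    hence d2: "d dvd 2 * a" "d dvd 2 * b" by (simp_all add: algebra_simps)
    have "odd d" using d(1) ab(4) dvd_trans by blast
    hence "coprime d 2" by simp
    hence "d dvd a" "d dvd b" using d2 by (simp_all add: coprime_dvd_mult_right_iff)
    thus "is_unit d" using ab(3) coprime_common_divisor by blast
  qed
  have c3: "coprime (a * b) ((a + b) * (a - b))" using c1 by simp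
  have pos: "a > 0" "a * b > 0" "a + b > 0" "a - b > 0" "(a + b) * (a - b) > 0" using ab by auto
  then obtain nu nv m1 m2 where 1: "nu > 0" "nv > 0" "m1 > 0" "m2 > 0" "n = nu * nv"
    "a * b = nu * m1\<^sup>2" "(a + b) * (a - b) = nv * m2\<^sup>2" "m = m1 * m2"
    using squarefree_coprime_split[OF n c3 pos(2,5) m ab(5)] by blast
  have sq: "squarefree nu" "squarefree nv"
    using n(1) 1(5) squarefree_mono[of nu n] squarefree_mono[of nv n] by auto
  obtain \<alpha> \<beta> r s where 2: "\<alpha> > 0" "\<beta> > 0" "r > 0" "s > 0" "nu = \<alpha> * \<beta>"
    "a = \<alpha> * r\<^sup>2" "b = \<beta> * s\<^sup>2" "m1 = r * s"
    using squarefree_coprime_split[OF sq(1) 1(1) ab(3) pos(1) ab(1) 1(3,6)] by blast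
  obtain \<gamma> \<delta> u v where 3: "\<gamma> > 0" "\<delta> > 0" "u > 0" "v > 0" "nv = \<gamma> * \<delta>"
    "a + b = \<gamma> * u\<^sup>2" "a - b = \<delta> * v\<^sup>2" "m2 = u * v"
    using squarefree_coprime_split[OF sq(2) 1(2) c2 pos(3,4) 1(4,7)] by blast
  show thesis
  proof (rule that[OF 2(1,2) 3(1,2) 2(3,4) 3(3,4)])
    show "coprime (\<alpha> * r) (\<beta> * s)" using ab(3) unfolding 2(6,7) by simp
    show "odd (\<gamma> * u)" using ab(4) unfolding 3(6) by simp
    show "n = \<alpha> * \<beta> * (\<gamma> * \<delta>)" using 1(5) 2(5) 3(5) by simp
    show "m = r * s * (u * v)" using 1(8) 2(8) 3(8) by simp
    show "\<alpha> * r\<^sup>2 + \<beta> * s\<^sup>2 = \<gamma> * u\<^sup>2" "\<alpha> * r\<^sup>2 - \<beta> * s\<^sup>2 = \<delta> * v\<^sup>2"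
      unfolding 2(6,7)[symmetric] 3(6,7)[symmetric] by (rule refl)+
  qed
qed

text \<open>The squares v^2, r^2, u^2 are in arithmetic progression with difference n s^2;
  equivalently, u + v and u - v are the legs of a right triangle with hypotenuse 2 r and area n s^2.
  The new size is at most s, which is smaller than the old one because u > v \<ge> 1 gives u v \<ge>
  2.\<close>

lemma trivial_class_descent:
  fixes n r s u v :: int
  assumes n: "squarefree n" "n > 0" and pos: "r > 0" "s > 0" "u > 0" "v > 0"
    and eq: "r\<^sup>2 + n * s\<^sup>2 = u\<^sup>2" "r\<^sup>2 - n * s\<^sup>2 = v\<^sup>2"
  shows "\<exists>m a b. 0 < m \<and> m < r * s * (u * v) \<and> primitive_triangle n m a b"
proof -
  have "n * s\<^sup>2 > 0" using n pos by simp
  hence "v\<^sup>2 < u\<^sup>2" using eq by linarith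
  hence vu: "v < u" using pos by (simp add: power2_less_imp_less)
  have "(u + v)\<^sup>2 + (u - v)\<^sup>2 = 2 * (u\<^sup>2 + v\<^sup>2)" by (simp add: power2_eq_square algebra_simps)
  also have "\<dots> = (2 * r)\<^sup>2" unfolding eq[symmetric] by (simp add: power_mult_distrib)
  finally have hyp: "(u + v)\<^sup>2 + (u - v)\<^sup>2 = (2 * r)\<^sup>2" .
  have "(u + v) * (u - v) = u\<^sup>2 - v\<^sup>2" by (simp add: power2_eq_square algebra_simps)
  also have "\<dots> = 2 * n * s\<^sup>2" unfolding eq[symmetric] by simp
  finally have area: "(u + v) * (u - v) = 2 * n * s\<^sup>2" .
  obtain m a b where m: "0 < m" "m \<le> s" "primitive_triangle n m a b"
    using primitive_triangle_of_legs[OF n _ _ _ hyp area pos(2)] pos vu by auto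
  have "2 \<le> u * v"
    using vu pos mult_mono[of 2 u 1 v] by simp
  hence "2 \<le> r * (u * v)" using pos mult_mono[of 1 r 2 "u * v"] by simp
  hence "s * 2 \<le> s * (r * (u * v))" using pos by (intro mult_left_mono) auto
  hence "s < r * s * (u * v)" using pos(2) by (simp add: algebra_simps)
  thus ?thesis using m by (meson le_less_trans)
qed

section \<open>Isotropy of ternary quadratic forms\<close>

lemma dvd_and_between_minus_one_and_two:
  fixes N v :: int
  assumes "N > 0" "N dvd v" "- N \<le> v" "v \<le> 2 * N"
  shows "v = - N \<or> v = 0 \<or> v = N \<or> v = 2 * N"
proof -
  obtain k where k: "v = N * k" using assms(2) by blast
  have "- 1 \<le> k" using assms(1,3) unfolding k
    by (metis mult.commute mult_le_cancel_right_pos mult_minus1_right)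
  moreover have "k \<le> 2" using assms(1,4) unfolding k
    by (metis mult.commute mult_le_cancel_left_pos)
  ultimately have "k = -1 \<or> k = 0 \<or> k = 1 \<or> k = 2" by auto
  thus ?thesis using k by auto
qed

lemma floor_sqrt_exists:
  fixes x :: int
  assumes "x \<ge> 0"
  obtains k where "k \<ge> 0" "k\<^sup>2 \<le> x" "x < (k + 1)\<^sup>2"
proof
  let ?k = "\<lfloor>sqrt (real_of_int x)\<rfloor>"
  show k0: "?k \<ge> 0" using assms by simp
  have "(real_of_int ?k)\<^sup>2 \<le> (sqrt (real_of_int x))\<^sup>2"
    using k0 by (intro power_mono) auto
  hence "real_of_int (?k\<^sup>2) \<le> real_of_int x" using assms by simp
  thus "?k\<^sup>2 \<le> x" by (simp only: of_int_le_iff)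
  have "(sqrt (real_of_int x))\<^sup>2 < (real_of_int ?k + 1)\<^sup>2"
    using assms by (intro power_strict_mono) auto
  hence "real_of_int x < real_of_int ((?k + 1)\<^sup>2)" using assms by simp
  thus "x < (?k + 1)\<^sup>2" by (simp only: of_int_less_iff)
qed

lemma abs_diff_square_le:
  fixes k a b x :: int
  assumes "a \<in> {0..k}" "b \<in> {0..k}" "k\<^sup>2 \<le> x"
  shows "(a - b)\<^sup>2 \<le> x"
proof -
  have "\<bar>a - b\<bar> \<le> k" using assms by auto
  hence "(a - b)\<^sup>2 \<le> k\<^sup>2" by (metis abs_ge_zero power2_abs power_mono)
  thus ?thesis using assms(3) by simp
qed

text \<open>Minkowski's method for the form \<open>d x\<^sup>2 + e y\<^sup>2 - Z z\<^sup>2\<close>: the three congruences define a lattice of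
  index \<open>d e Z\<close> on which the form is divisible by \<open>d e Z\<close>, and a small lattice vector gives one of
  the values \<open>0\<close> and \<open>d e Z\<close>. The second value is transformed into the first by
  \<open>(d x\<^sup>2 + e y\<^sup>2)(z\<^sup>2 + d e) = d (x z - e y)\<^sup>2 + e (y z + d x)\<^sup>2\<close>.\<close>

lemma ternary_form_isotropic:
  fixes d e Z b c1 c2 :: int
  assumes pos: "d > 0" "e > 0" "Z > 0" and cop: "coprime d e" "coprime d Z" "coprime e Z"
    and sqf: "squarefree (d * e)" "d * e > 1"
    and c1: "[c1\<^sup>2 = e * Z] (mod d)" and c2: "[c2\<^sup>2 = d * Z] (mod e)" and b: "[b\<^sup>2 = - (d * e)] (mod Z)"
  obtains x y z where "z > 0" "d * x\<^sup>2 + e * y\<^sup>2 = Z * z\<^sup>2" "[d * x = b * y] (mod Z)"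
proof -
  obtain k1 where k1: "k1 \<ge> 0" "k1\<^sup>2 \<le> e * Z" "e * Z < (k1 + 1)\<^sup>2"
    using floor_sqrt_exists[of "e * Z"] pos by auto
  obtain k2 where k2: "k2 \<ge> 0" "k2\<^sup>2 \<le> d * Z" "d * Z < (k2 + 1)\<^sup>2"
    using floor_sqrt_exists[of "d * Z"] pos by auto
  obtain k3 where k3: "k3 \<ge> 0" "k3\<^sup>2 \<le> d * e" "d * e < (k3 + 1)\<^sup>2"
    using floor_sqrt_exists[of "d * e"] pos by auto
  define N where "N = d * e * Z"
  have N: "N > 0" using pos by (simp add: N_def)
  define S where "S = {0..k1} \<times> {0..k2} \<times> {0..k3}"
  define T where "T = {0..<d} \<times> {0..<e} \<times> {0..<Z}"
  define f where "f = (\<lambda>(x, y, z). ((e * y - c1 * z) mod d, (d * x - c2 * z) mod e, (d * x - b * y) mod Z))"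
  \<comment> \<open>The box has sides about sqrt(e Z), sqrt(d Z), sqrt(d e), so it has more than
    \<open>N\<close> = d e Z points while \<open>f\<close> takes at most \<open>N\<close> values.
    The same sides bound each of the three terms of the form by \<open>N\<close>.\<close>
  have "N\<^sup>2 = (e * Z) * ((d * Z) * (d * e))" by (simp add: N_def power2_eq_square mult_ac)
  also have "\<dots> < (k1 + 1)\<^sup>2 * ((k2 + 1)\<^sup>2 * (k3 + 1)\<^sup>2)"
    using k1 k2 k3 pos by (intro mult_strict_mono) auto
  finally have "N\<^sup>2 < ((k1 + 1) * ((k2 + 1) * (k3 + 1)))\<^sup>2" by (simp add: power_mult_distrib)
  hence "N < (k1 + 1) * ((k2 + 1) * (k3 + 1))"
    by (rule power2_less_imp_less) (use k1 k2 k3 in auto)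
  moreover have "int (card S) = (k1 + 1) * ((k2 + 1) * (k3 + 1))"
    using k1 k2 k3 by (simp add: S_def card_cartesian_product)
  moreover have "int (card T) = N"
    using pos by (simp add: T_def N_def card_cartesian_product)
  ultimately have "card T < card S" by linarith
  moreover have "f ` S \<subseteq> T" unfolding f_def T_def using pos by auto
  moreover have "finite T" by (simp add: T_def)
  ultimately have "\<not> inj_on f S" using card_inj_on_le[of f S T] by auto
  then obtain p1 p2 where p: "p1 \<in> S" "p2 \<in> S" "p1 \<noteq> p2" "f p1 = f p2"
    unfolding inj_on_def by blast
  obtain x1 y1 z1 where p1: "p1 = (x1, y1, z1)" by (cases p1) auto
  obtain x2 y2 z2 where p2: "p2 = (x2, y2, z2)" by (cases p2) auto
  define x y z where "x = x1 - x2" and "y = y1 - y2" and "z = z1 - z2"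
  have nz: "x \<noteq> 0 \<or> y \<noteq> 0 \<or> z \<noteq> 0" using p(3) by (auto simp: p1 p2 x_def y_def z_def)
  have bd: "x\<^sup>2 \<le> e * Z" "y\<^sup>2 \<le> d * Z" "z\<^sup>2 \<le> d * e"
    unfolding x_def y_def z_def using p(1,2) k1 k2 k3
    by (auto simp: p1 p2 S_def intro!: abs_diff_square_le)
  have "[e * y1 - c1 * z1 = e * y2 - c1 * z2] (mod d)" "[d * x1 - c2 * z1 = d * x2 - c2 * z2] (mod e)"
    "[d * x1 - b * y1 = d * x2 - b * y2] (mod Z)"
    using p(4) by (auto simp: f_def p1 p2 cong_def)
  hence d1: "d dvd e * y - c1 * z" and d2: "e dvd d * x - c2 * z" and d3: "Z dvd d * x - b * y"
    by (simp_all add: cong_iff_dvd_diff x_def y_def z_def algebra_simps)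
  define v where "v = d * x\<^sup>2 + e * y\<^sup>2 - Z * z\<^sup>2"
  have "d dvd v"
  proof -
    have "d dvd (e * y - c1 * z) * (e * y + c1 * z) + (c1\<^sup>2 - e * Z) * z\<^sup>2"
      using d1 c1 by (intro dvd_add dvd_mult2) (auto simp: cong_iff_dvd_diff)
    also have "\<dots> = e * (e * y\<^sup>2 - Z * z\<^sup>2)" by (simp add: power2_eq_square algebra_simps)
    finally have "d dvd e * y\<^sup>2 - Z * z\<^sup>2" using cop by (simp add: coprime_dvd_mult_right_iff)
    hence "d dvd d * x\<^sup>2 + (e * y\<^sup>2 - Z * z\<^sup>2)" by (intro dvd_add) auto
    thus ?thesis by (simp add: v_def algebra_simps)
  qed
  moreover have "e dvd v"
  proof -
    have "e dvd (d * x - c2 * z) * (d * x + c2 * z) + (c2\<^sup>2 - d * Z) * z\<^sup>2"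
      using d2 c2 by (intro dvd_add dvd_mult2) (auto simp: cong_iff_dvd_diff)
    also have "\<dots> = d * (d * x\<^sup>2 - Z * z\<^sup>2)" by (simp add: power2_eq_square algebra_simps)
    finally have "e dvd d * x\<^sup>2 - Z * z\<^sup>2"
      using cop by (simp add: coprime_dvd_mult_right_iff coprime_commute)
    hence "e dvd e * y\<^sup>2 + (d * x\<^sup>2 - Z * z\<^sup>2)" by (intro dvd_add) auto
    thus ?thesis by (simp add: v_def algebra_simps)
  qed
  moreover have "Z dvd v"
  proof -
    have "Z dvd (d * x - b * y) * (d * x + b * y) + (b\<^sup>2 - - (d * e)) * y\<^sup>2"
      using d3 b by (intro dvd_add dvd_mult2) (auto simp: cong_iff_dvd_diff)
    also have "\<dots> = d * (d * x\<^sup>2 + e * y\<^sup>2)" by (simp add: power2_eq_square algebra_simps)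
    finally have "Z dvd d * x\<^sup>2 + e * y\<^sup>2"
      using cop by (simp add: coprime_dvd_mult_right_iff coprime_commute)
    thus ?thesis by (simp add: v_def)
  qed
  ultimately have "N dvd v"
    unfolding N_def using cop by (intro divides_mult) auto
  have bds: "d * x\<^sup>2 \<le> N" "e * y\<^sup>2 \<le> N" "Z * z\<^sup>2 \<le> N"
    using bd pos mult_left_mono[of "x\<^sup>2" "e * Z" d] mult_left_mono[of "y\<^sup>2" "d * Z" e]
      mult_left_mono[of "z\<^sup>2" "d * e" Z] by (simp_all add: N_def mult_ac)
  have nonneg: "d * x\<^sup>2 \<ge> 0" "e * y\<^sup>2 \<ge> 0" "Z * z\<^sup>2 \<ge> 0" using pos by simp_all
  have nonsquare: "w\<^sup>2 \<noteq> d * e" for w :: int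
  proof
    assume w: "w\<^sup>2 = d * e"
    hence "w\<^sup>2 = 1" using squarefree_square_eq_1[OF sqf(1), of w] by simp
    thus False using w sqf(2) by simp
  qed
  \<comment> \<open>At both extreme values d e would be a square, namely of z for -N and of x y / Z
    for 2 N.\<close>
  have "v \<noteq> - N"
  proof
    assume "v = - N"
    hence "d * x\<^sup>2 = 0" "e * y\<^sup>2 = 0" "Z * z\<^sup>2 = N" using bds nonneg unfolding v_def by linarith+
    hence "Z * z\<^sup>2 = Z * (d * e)" by (simp add: N_def mult_ac)
    thus False using nonsquare[of z] pos by simp
  qed
  moreover have "v \<noteq> 2 * N"
  proof
    assume "v = 2 * N"
    hence eq: "d * x\<^sup>2 = N" "e * y\<^sup>2 = N" using bds nonneg unfolding v_def by linarith+
    have x2: "x\<^sup>2 = e * Z" and y2: "y\<^sup>2 = d * Z" using eq pos by (simp_all add: N_def mult_ac)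
    have "Z\<^sup>2 dvd (x * y)\<^sup>2" unfolding power_mult_distrib x2 y2 by (simp add: power2_eq_square)
    hence "Z dvd x * y" by simp
    then obtain w where w: "x * y = Z * w" by blast
    have "Z\<^sup>2 * w\<^sup>2 = x\<^sup>2 * y\<^sup>2" unfolding power_mult_distrib[symmetric] w by simp
    also have "\<dots> = Z\<^sup>2 * (d * e)" unfolding x2 y2 by (simp add: power2_eq_square mult_ac)
    finally have "w\<^sup>2 = d * e" using pos by simp
    thus False using nonsquare by blast
  qed
  moreover have "- N \<le> v" "v \<le> 2 * N" using bds nonneg by (simp_all add: v_def)
  ultimately consider "v = 0" | "v = N"
    using dvd_and_between_minus_one_and_two[OF N \<open>N dvd v\<close>] by blast
  thus thesis
  proof cases
    case 1
    have z: "z \<noteq> 0"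
    proof
      assume "z = 0"
      hence "d * x\<^sup>2 + e * y\<^sup>2 = 0" using 1 unfolding v_def by simp
      hence "d * x\<^sup>2 = 0" "e * y\<^sup>2 = 0" using nonneg by linarith+
      thus False using nz \<open>z = 0\<close> pos by simp
    qed
    show thesis
      by (rule that[of "\<bar>z\<bar>" x y])
        (use 1 z d3 in \<open>auto simp: v_def cong_iff_dvd_diff\<close>)
  next
    case 2
    define w where "w = z\<^sup>2 + d * e"
    have eq: "d * x\<^sup>2 + e * y\<^sup>2 = Z * w" using 2 by (simp add: v_def N_def w_def algebra_simps)
    have "d * (x * z - e * y)\<^sup>2 + e * (y * z + d * x)\<^sup>2 = (d * x\<^sup>2 + e * y\<^sup>2) * w"
      by (simp add: w_def power2_eq_square algebra_simps)
    also have "\<dots> = Z * w\<^sup>2" unfolding eq by (simp add: power2_eq_square)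
    finally have "d * (x * z - e * y)\<^sup>2 + e * (y * z + d * x)\<^sup>2 = Z * w\<^sup>2" .
    moreover have "w > 0" unfolding w_def using pos by (simp add: add_nonneg_pos)
    \<comment> \<open>The congruence modulo Z must survive the change of variables: it later places
      the resulting element in the ideal of norm Z attached to the root b, and not in another ideal
      of the same norm.\<close>
    moreover have "[d * (x * z - e * y) = b * (y * z + d * x)] (mod Z)"
    proof -
      have "Z dvd (d * x - b * y) * (z - b) - (b\<^sup>2 - - (d * e)) * y"
        by (intro dvd_diff dvd_mult2 d3 b[unfolded cong_iff_dvd_diff])
      thus ?thesis by (simp add: cong_iff_dvd_diff power2_eq_square algebra_simps)
    qed
    ultimately show thesis using that by blast
  qed
qed

text \<open>Thue's pigeonhole argument: a short vector gives a multiple x^2 + y^2 of P with 0 < x^2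
  + y^2 \<le> 2 P, and the value 2 P would need x^2 = y^2 = P, which is not a square.\<close>

lemma sum_two_squares_of_square_root_minus_one:
  fixes P c :: int
  assumes "P > 1" "[c\<^sup>2 = - 1] (mod P)" and sqf: "squarefree P"
  obtains x y where "x\<^sup>2 + y\<^sup>2 = P"
proof -
  obtain k where k: "k \<ge> 0" "k\<^sup>2 \<le> P" "P < (k + 1)\<^sup>2"
    using floor_sqrt_exists[of P] assms by auto
  define f where "f = (\<lambda>(x, y). (x - c * y) mod P)"
  let ?S = "{0..k} \<times> {0..k}"
  have "int (card ?S) = (k + 1)\<^sup>2"
    using k by (simp add: card_cartesian_product power2_eq_square)
  moreover have "int (card {0..<P}) = P" using assms(1) by simp
  ultimately have "card {0..<P} < card ?S" using k(3) by linarith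
  moreover have "f ` ?S \<subseteq> {0..<P}" unfolding f_def using assms by auto
  ultimately have "\<not> inj_on f ?S" using card_inj_on_le[of f ?S "{0..<P}"] by fastforce
  then obtain p1 p2 where p: "p1 \<in> ?S" "p2 \<in> ?S" "p1 \<noteq> p2" "f p1 = f p2"
    unfolding inj_on_def by blast
  obtain x1 y1 where p1: "p1 = (x1, y1)" by (cases p1)
  obtain x2 y2 where p2: "p2 = (x2, y2)" by (cases p2)
  define x y where "x = x1 - x2" and "y = y1 - y2"
  have nz: "x\<^sup>2 + y\<^sup>2 > 0"
    using p(3) by (auto simp: p1 p2 x_def y_def sum_power2_gt_zero_iff)
  have bd: "x\<^sup>2 \<le> P" "y\<^sup>2 \<le> P"
    unfolding x_def y_def using p(1,2) k by (auto simp: p1 p2 intro!: abs_diff_square_le)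
  have nonsquare: "w\<^sup>2 \<noteq> P" for w :: int
  proof
    assume w: "w\<^sup>2 = P"
    hence "w\<^sup>2 = 1" using squarefree_square_eq_1[OF sqf, of w] by simp
    thus False using w assms(1) by simp
  qed
  have "[x1 - c * y1 = x2 - c * y2] (mod P)"
    using p(4) by (simp add: f_def p1 p2 cong_def)
  hence d: "P dvd x - c * y" by (simp add: cong_iff_dvd_diff x_def y_def algebra_simps)
  have "P dvd (x - c * y) * (x + c * y) + (c\<^sup>2 - (-1)) * y\<^sup>2"
    using d assms(2) by (intro dvd_add dvd_mult2) (auto simp: cong_iff_dvd_diff)
  hence "P dvd x\<^sup>2 + y\<^sup>2" by (simp add: power2_eq_square algebra_simps)
  moreover have "- P \<le> x\<^sup>2 + y\<^sup>2" "x\<^sup>2 + y\<^sup>2 \<le> 2 * P" using nz assms(1) bd by linarith+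
  ultimately have "x\<^sup>2 + y\<^sup>2 = P"
    using dvd_and_between_minus_one_and_two[of P "x\<^sup>2 + y\<^sup>2"] nz assms(1) bd nonsquare[of x] nonsquare[of y]
    by auto
  thus thesis using that by blast
qed

section \<open>Local conditions\<close>

lemma square_mod_8:
  fixes x :: int
  shows "odd x \<Longrightarrow> x\<^sup>2 mod 8 = 1" "even x \<Longrightarrow> x\<^sup>2 mod 8 = 0 \<or> x\<^sup>2 mod 8 = 4"
    "x\<^sup>2 mod 8 = 4 \<Longrightarrow> \<exists>y. odd y \<and> x = 2 * y"
proof -
  have "x mod 8 \<in> {0, 1, 2, 3, 4, 5, 6, 7}" unfolding insert_iff empty_iff by presburger
  moreover have sq: "x\<^sup>2 mod 8 = (x mod 8)\<^sup>2 mod 8" by (simp add: power_mod)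
  ultimately have *: "x mod 8 \<in> {1, 3, 5, 7} \<and> x\<^sup>2 mod 8 = 1 \<or> x mod 8 \<in> {2, 6} \<and> x\<^sup>2 mod 8 = 4 \<or>
      x mod 8 \<in> {0, 4} \<and> x\<^sup>2 mod 8 = 0"
    unfolding sq by (elim insertE) simp_all
  show "odd x \<Longrightarrow> x\<^sup>2 mod 8 = 1" using * unfolding insert_iff empty_iff by presburger
  show "even x \<Longrightarrow> x\<^sup>2 mod 8 = 0 \<or> x\<^sup>2 mod 8 = 4"
    using * unfolding insert_iff empty_iff by presburger
  assume "x\<^sup>2 mod 8 = 4"
  hence "x mod 8 = 2 \<or> x mod 8 = 6" using * by auto
  thus "\<exists>y. odd y \<and> x = 2 * y" by presburger
qed

lemma square_mod_8_cases: "x\<^sup>2 mod 8 = 0 \<or> x\<^sup>2 mod 8 = 4 \<or> x\<^sup>2 mod 8 = 1" for x :: int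
  using square_mod_8[of x] by blast

lemma eq_prod_prime_divisors:
  fixes r :: "'a \<Rightarrow> int"
  assumes "finite I" "\<And>i. i \<in> I \<Longrightarrow> prime (r i)" "inj_on r I" "x > 0" "x dvd (\<Prod>i\<in>I. r i)"
  shows "x = (\<Prod>i | i \<in> I \<and> r i dvd x. r i)"
  using assms
proof (induction I arbitrary: x rule: finite_induct)
  case empty
  thus ?case by (simp add: zdvd1_eq)
next
  case (insert k I)
  have pk: "prime (r k)" using insert by simp
  have diff: "r i \<noteq> r k" if "i \<in> I" for i using insert that by (auto simp: inj_on_def)
  show ?case
  proof (cases "r k dvd x")
    case True
    then obtain y where y: "x = r k * y" by blast
    have k0: "r k > 0" using pk by (simp add: prime_gt_0_int)
    have "y > 0" using y insert.prems(3) k0 by (simp add: zero_less_mult_iff)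
    moreover have "y dvd (\<Prod>i\<in>I. r i)" using insert.prems(4) insert.hyps k0 unfolding y by simp
    ultimately have "y = (\<Prod>i | i \<in> I \<and> r i dvd y. r i)" using insert by simp
    also have "{i. i \<in> I \<and> r i dvd y} = {i. i \<in> I \<and> r i dvd x}"
    proof (intro Collect_cong conj_cong refl iffI)
      fix i assume i: "i \<in> I"
      show "r i dvd y \<Longrightarrow> r i dvd x" using y by simp
      assume "r i dvd x"
      hence "r i dvd r k \<or> r i dvd y" using i insert.prems(1) unfolding y by (simp add: prime_dvd_mult_iff)
      moreover have "\<not> r i dvd r k" using primes_dvd_imp_eq[of "r i" "r k"] insert.prems(1) i diff by auto
      ultimately show "r i dvd y" by blast
    qed
    finally have "x = r k * (\<Prod>i | i \<in> I \<and> r i dvd x. r i)" using y by simp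
    also have "\<dots> = (\<Prod>i\<in>insert k {i. i \<in> I \<and> r i dvd x}. r i)"
      using insert.hyps by (intro prod.insert[symmetric]) auto
    also have "insert k {i. i \<in> I \<and> r i dvd x} = {i. i \<in> insert k I \<and> r i dvd x}" using True by auto
    finally show ?thesis .
  next
    case False
    hence "coprime x (r k)" using pk by (metis coprime_commute prime_imp_coprime)
    moreover have "x dvd r k * (\<Prod>i\<in>I. r i)" using insert.prems(4) insert.hyps by simp
    ultimately have "x dvd (\<Prod>i\<in>I. r i)" by (simp add: coprime_dvd_mult_right_iff)
    hence "x = (\<Prod>i | i \<in> I \<and> r i dvd x. r i)" using insert by simp
    also have "{i. i \<in> I \<and> r i dvd x} = {i. i \<in> insert k I \<and> r i dvd x}" using False by auto
    finally show ?thesis .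
  qed
qed

lemma Legendre_eq_if_square_multiples_cong:
  assumes "prime l" "l > (2::nat)" "[a * x\<^sup>2 = b * y\<^sup>2] (mod int l)" "\<not> int l dvd x" "\<not> int l dvd y"
  shows "Legendre a (int l) = Legendre b (int l)"
  using Legendre_cong[OF assms(3)] Legendre_mult_square[OF assms(1,2)] assms(4,5) by simp

text \<open>Coprimality of the first two terms makes an odd prime l divide at most one of the four
  terms. If l divides one coefficient, the equations modulo l compare the others up to squares of
  units. The factor 2 comes from the sum 2 \<alpha> r^2 = \<gamma> u^2 + \<delta> v^2.\<close>

lemma local_conditions:
  fixes \<alpha> \<beta> \<gamma> \<delta> r s u v :: int and l :: nat
  assumes eq: "\<alpha> * r\<^sup>2 + \<beta> * s\<^sup>2 = \<gamma> * u\<^sup>2" "\<alpha> * r\<^sup>2 - \<beta> * s\<^sup>2 = \<delta> * v\<^sup>2"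
    and cop: "coprime (\<alpha> * r) (\<beta> * s)" and l: "prime l" "l > 2"
  shows "int l dvd \<alpha> \<Longrightarrow> \<not> int l dvd \<beta> \<and> \<not> int l dvd \<gamma> \<and> \<not> int l dvd \<delta> \<and>
      Legendre \<beta> l = Legendre \<gamma> l \<and> Legendre (- \<beta>) l = Legendre \<delta> l"
    and "int l dvd \<beta> \<Longrightarrow> \<not> int l dvd \<alpha> \<and> \<not> int l dvd \<gamma> \<and> \<not> int l dvd \<delta> \<and>
      Legendre \<alpha> l = Legendre \<gamma> l \<and> Legendre \<alpha> l = Legendre \<delta> l"
    and "int l dvd \<gamma> \<Longrightarrow> \<not> int l dvd \<alpha> \<and> \<not> int l dvd \<beta> \<and> \<not> int l dvd \<delta> \<and>
      Legendre \<alpha> l = Legendre (- \<beta>) l \<and> Legendre (2 * \<alpha>) l = Legendre \<delta> l"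
    and "int l dvd \<delta> \<Longrightarrow> \<not> int l dvd \<alpha> \<and> \<not> int l dvd \<beta> \<and> \<not> int l dvd \<gamma> \<and>
      Legendre \<alpha> l = Legendre \<beta> l \<and> Legendre (2 * \<alpha>) l = Legendre \<gamma> l"
proof -
  let ?l = "int l"
  have pl: "prime ?l" using l by simp
  have l2: "\<not> ?l dvd 2" using l(2) zdvd_imp_le by fastforce
  have excl: "\<not> (?l dvd \<alpha> * r \<and> ?l dvd \<beta> * s)"
    using cop pl coprime_common_divisor not_prime_unit by blast
  have mult: "?l dvd x * y\<^sup>2 \<longleftrightarrow> ?l dvd x * y" for x y
    using pl by (auto simp: prime_dvd_mult_iff prime_dvd_power_iff)
  have sum1: "?l dvd \<alpha> * r\<^sup>2 \<Longrightarrow> ?l dvd \<beta> * s\<^sup>2 \<longleftrightarrow> ?l dvd \<gamma> * u\<^sup>2"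
    unfolding eq(1)[symmetric] by (simp add: dvd_add_right_iff)
  have sum2: "?l dvd \<beta> * s\<^sup>2 \<Longrightarrow> ?l dvd \<alpha> * r\<^sup>2 \<longleftrightarrow> ?l dvd \<gamma> * u\<^sup>2"
    unfolding eq(1)[symmetric] by (simp add: dvd_add_left_iff)
  have dif1: "?l dvd \<alpha> * r\<^sup>2 \<Longrightarrow> ?l dvd \<beta> * s\<^sup>2 \<longleftrightarrow> ?l dvd \<delta> * v\<^sup>2"
    unfolding eq(2)[symmetric] using dvd_diff_right_iff by blast
  have dif2: "?l dvd \<beta> * s\<^sup>2 \<Longrightarrow> ?l dvd \<alpha> * r\<^sup>2 \<longleftrightarrow> ?l dvd \<delta> * v\<^sup>2"
    unfolding eq(2)[symmetric] by (simp add: dvd_diff_left_iff)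
  have gd: "\<not> (?l dvd \<gamma> * u\<^sup>2 \<and> ?l dvd \<delta> * v\<^sup>2)"
  proof
    assume h: "?l dvd \<gamma> * u\<^sup>2 \<and> ?l dvd \<delta> * v\<^sup>2"
    have "?l dvd \<gamma> * u\<^sup>2 + \<delta> * v\<^sup>2" "?l dvd \<gamma> * u\<^sup>2 - \<delta> * v\<^sup>2" using h by (blast intro: dvd_add dvd_diff)+
    hence "?l dvd 2 * (\<alpha> * r\<^sup>2)" "?l dvd 2 * (\<beta> * s\<^sup>2)" unfolding eq[symmetric] by (simp_all add: algebra_simps)
    hence "?l dvd \<alpha> * r\<^sup>2" "?l dvd \<beta> * s\<^sup>2" using pl l2 prime_dvd_mult_iff by blast+
    thus False using excl mult by blast
  qed
  have nd: "\<not> ?l dvd x" "\<not> ?l dvd y" if "\<not> ?l dvd x * y\<^sup>2" for x y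
    using that by (auto simp: power2_eq_square)
  note Leq = Legendre_eq_if_square_multiples_cong[OF l]
  show "?l dvd \<alpha> \<Longrightarrow> \<not> ?l dvd \<beta> \<and> \<not> ?l dvd \<gamma> \<and> \<not> ?l dvd \<delta> \<and>
      Legendre \<beta> l = Legendre \<gamma> l \<and> Legendre (- \<beta>) l = Legendre \<delta> l"
  proof -
    assume h: "?l dvd \<alpha>"
    hence a: "?l dvd \<alpha> * r\<^sup>2" by simp
    hence b: "\<not> ?l dvd \<beta> * s\<^sup>2" using excl mult by blast
    hence c: "\<not> ?l dvd \<gamma> * u\<^sup>2" "\<not> ?l dvd \<delta> * v\<^sup>2" using sum1 dif1 a by blast+
    have "[\<beta> * s\<^sup>2 = \<gamma> * u\<^sup>2] (mod ?l)" "[- \<beta> * s\<^sup>2 = \<delta> * v\<^sup>2] (mod ?l)"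
      unfolding eq[symmetric] cong_iff_dvd_diff using a by simp_all
    thus ?thesis using Leq nd[OF b] nd[OF c(1)] nd[OF c(2)] by blast
  qed
  show "?l dvd \<beta> \<Longrightarrow> \<not> ?l dvd \<alpha> \<and> \<not> ?l dvd \<gamma> \<and> \<not> ?l dvd \<delta> \<and>
      Legendre \<alpha> l = Legendre \<gamma> l \<and> Legendre \<alpha> l = Legendre \<delta> l"
  proof -
    assume h: "?l dvd \<beta>"
    hence b: "?l dvd \<beta> * s\<^sup>2" by simp
    hence a: "\<not> ?l dvd \<alpha> * r\<^sup>2" using excl mult by blast
    hence c: "\<not> ?l dvd \<gamma> * u\<^sup>2" "\<not> ?l dvd \<delta> * v\<^sup>2" using sum2 dif2 b by blast+
    have "[\<alpha> * r\<^sup>2 = \<gamma> * u\<^sup>2] (mod ?l)" "[\<alpha> * r\<^sup>2 = \<delta> * v\<^sup>2] (mod ?l)"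
      unfolding eq[symmetric] cong_iff_dvd_diff using b by simp_all
    thus ?thesis using Leq nd[OF a] nd[OF c(1)] nd[OF c(2)] by blast
  qed
  show "?l dvd \<gamma> \<Longrightarrow> \<not> ?l dvd \<alpha> \<and> \<not> ?l dvd \<beta> \<and> \<not> ?l dvd \<delta> \<and>
      Legendre \<alpha> l = Legendre (- \<beta>) l \<and> Legendre (2 * \<alpha>) l = Legendre \<delta> l"
  proof -
    assume h: "?l dvd \<gamma>"
    hence c: "?l dvd \<gamma> * u\<^sup>2" by simp
    hence d: "\<not> ?l dvd \<delta> * v\<^sup>2" using gd by blast
    have a: "\<not> ?l dvd \<alpha> * r\<^sup>2" using sum1 excl mult c by blast
    have b: "\<not> ?l dvd \<beta> * s\<^sup>2" using sum2 excl mult c by blast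
    have "?l dvd \<alpha> * r\<^sup>2 + \<beta> * s\<^sup>2" unfolding eq(1) by (rule c)
    hence "[\<alpha> * r\<^sup>2 = - \<beta> * s\<^sup>2] (mod ?l)" "[2 * \<alpha> * r\<^sup>2 = \<delta> * v\<^sup>2] (mod ?l)"
      unfolding eq(2)[symmetric] cong_iff_dvd_diff by (simp_all add: algebra_simps)
    thus ?thesis using Leq nd[OF a] nd[OF b] nd[OF d] by blast
  qed
  show "?l dvd \<delta> \<Longrightarrow> \<not> ?l dvd \<alpha> \<and> \<not> ?l dvd \<beta> \<and> \<not> ?l dvd \<gamma> \<and>
      Legendre \<alpha> l = Legendre \<beta> l \<and> Legendre (2 * \<alpha>) l = Legendre \<gamma> l"
  proof -
    assume h: "?l dvd \<delta>"
    hence d: "?l dvd \<delta> * v\<^sup>2" by simp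
    hence c: "\<not> ?l dvd \<gamma> * u\<^sup>2" using gd by blast
    have a: "\<not> ?l dvd \<alpha> * r\<^sup>2" using dif1 excl mult d by blast
    have b: "\<not> ?l dvd \<beta> * s\<^sup>2" using dif2 excl mult d by blast
    have "?l dvd \<alpha> * r\<^sup>2 - \<beta> * s\<^sup>2" unfolding eq(2) by (rule d)
    hence "[\<alpha> * r\<^sup>2 = \<beta> * s\<^sup>2] (mod ?l)" "[2 * \<alpha> * r\<^sup>2 = \<gamma> * u\<^sup>2] (mod ?l)"
      unfolding eq(1)[symmetric] cong_iff_dvd_diff by (simp_all add: algebra_simps)
    thus ?thesis using Leq nd[OF a] nd[OF b] nd[OF c] by blast
  qed
qed

lemma prod_signs_bit_sum:
  assumes "finite I" "\<And>i. i \<in> I \<Longrightarrow> f i = 1 \<or> f i = (-1::int)"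
  shows "(\<Prod>i\<in>I. f i) = (if (\<Sum>i\<in>I. if f i = -1 then 1 else 0 :: bit) = 0 then 1 else -1)"
  using assms
proof (induction I rule: finite_induct)
  case (insert x I)
  define b :: bit where "b = (\<Sum>i\<in>I. if f i = -1 then 1 else 0)"
  have "(\<Prod>i\<in>I. f i) = (if b = 0 then 1 else -1)" using insert by (simp add: b_def)
  moreover have "f x = 1 \<or> f x = -1" using insert.prems by simp
  moreover have "(\<Sum>i\<in>insert x I. if f i = -1 then 1 else 0 :: bit) = (if f x = -1 then 1 else 0) + b"
    using insert.hyps by (simp add: b_def)
  ultimately show ?case using insert.hyps by (cases b) auto
qed simp

section \<open>The primes p_i and q, and A_P acting on sets of indices\<close>

locale corank_one_primes =
  fixes t q :: nat and p :: "nat \<Rightarrow> nat"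
  assumes odd_t: "odd t" and prime_p: "\<And>i. i < t \<Longrightarrow> prime (p i)" and prime_q: "prime q"
    and inj_p: "inj_on p {..<t}" and p_neq_q: "\<And>i. i < t \<Longrightarrow> p i \<noteq> q"
    and p_mod: "\<And>i. i < t \<Longrightarrow> p i mod 8 = 5" and q_mod: "q mod 8 = 7"
    and rank: "vec_space.rank t (legendre_matrix t p) = t - 1"
    and Legendre_p_q: "\<And>i. i < t \<Longrightarrow> Legendre (int (p i)) (int q) = 1"
begin

definition P :: nat where "P = (\<Prod>i<t. p i)"

definition nn :: int where "nn = int P * int q"

lemma p_gt_2: "i < t \<Longrightarrow> p i > 2" using p_mod[of i] by presburger

lemma q_gt_2: "q > 2" using q_mod by presburger

lemma t_pos: "t > 0" using odd_t by (cases t) auto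

lemma p_mod_4: "i < t \<Longrightarrow> p i mod 4 = 1" using p_mod[of i] by presburger

lemma q_mod_4: "q mod 4 = 3" using q_mod by presburger

lemma Legendre_uminus_p: "i < t \<Longrightarrow> Legendre (- a) (int (p i)) = Legendre a (int (p i))"
  using Legendre_uminus[OF prime_p p_gt_2] p_mod_4 by simp

lemma Legendre_uminus_q: "Legendre (- a) (int q) = - Legendre a (int q)"
  using Legendre_uminus[OF prime_q q_gt_2] q_mod_4 by simp

lemma Legendre_2_p: "i < t \<Longrightarrow> Legendre 2 (int (p i)) = -1"
  using Legendre_2[OF prime_p p_gt_2] p_mod[of i] prime_odd_nat[OF prime_p p_gt_2] by (simp add: chi2_def)

lemma Legendre_q_p: "i < t \<Longrightarrow> Legendre (int q) (int (p i)) = 1"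
  using Legendre_reciprocal[OF prime_p p_gt_2 prime_q q_gt_2 p_neq_q p_mod_4] Legendre_p_q by simp

text \<open>As 5^2 = 1 modulo 8, the oddness of t leaves a single factor 5.\<close>

lemma P_mod_8: "P mod 8 = 5"
proof -
  have "k \<le> t \<Longrightarrow> (\<Prod>i<k. p i) mod 8 = (if even k then 1 else 5)" for k
  proof (induction k)
    case (Suc k)
    have "(\<Prod>i<Suc k. p i) mod 8 = ((\<Prod>i<k. p i) mod 8 * (p k mod 8)) mod 8" by (simp add: mod_mult_eq)
    thus ?case using Suc p_mod[of k] by simp
  qed simp
  thus ?thesis using odd_t by (simp add: P_def)
qed

lemma coprime_p: "i < t \<Longrightarrow> j < t \<Longrightarrow> i \<noteq> j \<Longrightarrow> coprime (int (p i)) (int (p j))"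
  using inj_p prime_p by (auto simp: inj_on_def intro!: primes_coprime)

lemma coprime_p_q: "i < t \<Longrightarrow> coprime (int (p i)) (int q)"
  using prime_p prime_q p_neq_q by (auto intro!: primes_coprime)

lemma int_P: "int P = (\<Prod>i<t. int (p i))" by (simp add: P_def)

lemma coprime_P_q: "coprime (int P) (int q)"
  unfolding int_P using coprime_p_q by (intro prod_coprime_left) auto

lemma squarefree_P: "squarefree (int P)"
  unfolding int_P using coprime_p prime_p
  by (intro squarefree_prod_coprime) (auto intro: squarefree_prime)

lemma squarefree_nn: "squarefree nn"
  unfolding nn_def using squarefree_P coprime_P_q prime_q
  by (intro squarefree_mult_coprime) (auto intro: squarefree_prime)

lemma P_gt_4: "P > 4"
  using P_mod_8 by presburger

lemma nn_pos: "nn > 0" using P_gt_4 q_gt_2 by (simp add: nn_def)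

lemma p_dvd_P: "i < t \<Longrightarrow> int (p i) dvd int P"
  unfolding int_P by (intro dvd_prodI) auto

text \<open>Additive form of the Legendre symbol. Multiples of p_i also get the value 0, so
  additivity needs the side conditions of \<open>qr_bit_mult\<close>.\<close>

definition qr_bit :: "nat \<Rightarrow> int \<Rightarrow> bit" where
  "qr_bit i x = (if Legendre x (int (p i)) = -1 then 1 else 0)"

lemma Legendre_pm: "\<not> int (p i) dvd x \<Longrightarrow> Legendre x (int (p i)) = 1 \<or> Legendre x (int (p i)) = -1"
  using Legendre_values[of x "int (p i)"] Legendre_eq_0_iff[of x "int (p i)"] by auto

lemma qr_bit_eq_iff:
  "\<not> int (p i) dvd x \<Longrightarrow> \<not> int (p i) dvd y \<Longrightarrow> qr_bit i x = qr_bit i y \<longleftrightarrow> Legendre x (int (p i)) = Legendre y (int (p i))"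
  using Legendre_pm[of i x] Legendre_pm[of i y] by (auto simp: qr_bit_def)

lemma qr_bit_mult:
  assumes "i < t" "\<not> int (p i) dvd x" "\<not> int (p i) dvd y"
  shows "qr_bit i (x * y) = qr_bit i x + qr_bit i y"
  using Legendre_pm[OF assms(2)] Legendre_pm[OF assms(3)] Legendre_mult[OF prime_p p_gt_2, OF assms(1) assms(1), of x y]
  by (auto simp: qr_bit_def)

abbreviation A :: "nat \<Rightarrow> nat \<Rightarrow> bit" where "A i j \<equiv> legendre_matrix t p $$ (i, j)"

lemma carrier_A: "legendre_matrix t p \<in> carrier_mat t t" by (simp add: legendre_matrix_def)

lemma A_offdiag: "i < t \<Longrightarrow> j < t \<Longrightarrow> i \<noteq> j \<Longrightarrow> A i j = qr_bit i (int (p j))"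
  by (simp add: legendre_matrix_def legendre_entry_def qr_bit_def)

lemma A_diag: "i < t \<Longrightarrow> A i i = (\<Sum>k\<in>{..<t} - {i}. A i k)"
proof -
  assume i: "i < t"
  have "A i i = (\<Sum>k\<in>{..<t} - {i}. legendre_entry p i k)" using i by (simp add: legendre_matrix_def)
  also have "\<dots> = (\<Sum>k\<in>{..<t} - {i}. A i k)"
    using i by (intro sum.cong refl) (auto simp: legendre_matrix_def)
  finally show ?thesis .
qed

lemma row_sum: "i < t \<Longrightarrow> (\<Sum>j<t. A i j) = 0"
proof -
  assume i: "i < t"
  have "(\<Sum>j<t. A i j) = A i i + (\<Sum>j\<in>{..<t} - {i}. A i j)" using i by (intro sum.remove) auto
  thus ?thesis unfolding A_diag[OF i, symmetric] by (simp only: bit_add_eq_0_iff)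
qed

lemma A_sym: "i < t \<Longrightarrow> j < t \<Longrightarrow> A i j = A j i"
proof (cases "i = j")
  case False
  assume ij: "i < t" "j < t"
  have "p i \<noteq> p j" using inj_p ij False by (auto simp: inj_on_def)
  hence "Legendre (int (p i)) (int (p j)) = Legendre (int (p j)) (int (p i))"
    using ij by (intro Legendre_reciprocal prime_p p_gt_2 p_mod_4)
  thus ?thesis using ij False by (simp add: A_offdiag qr_bit_def)
qed simp

lemma col_sum: "j < t \<Longrightarrow> (\<Sum>i<t. A i j) = 0"
proof -
  assume j: "j < t"
  have "(\<Sum>i<t. A i j) = (\<Sum>i<t. A j i)" using j by (intro sum.cong refl) (auto intro: A_sym)
  thus ?thesis using row_sum[OF j] by simp
qed

lemma not_dvd_prod_p:
  assumes "i < t" "S \<subseteq> {..<t}" "i \<notin> S"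
  shows "\<not> int (p i) dvd (\<Prod>j\<in>S. int (p j))"
proof
  assume h: "int (p i) dvd (\<Prod>j\<in>S. int (p j))"
  have "coprime (int (p i)) (\<Prod>j\<in>S. int (p j))"
  proof (rule prod_coprime_right)
    fix j assume "j \<in> S"
    thus "coprime (int (p i)) (int (p j))" using assms by (intro coprime_p) auto
  qed
  hence "is_unit (int (p i))" using h by (rule coprime_common_divisor[OF _ dvd_refl])
  thus False using prime_p[OF assms(1)] by simp
qed

text \<open>Away from the diagonal, adding columns is multiplying primes inside the residue symbol
  modulo p_i.\<close>

lemma A_sum_notin:
  assumes "i < t" "S \<subseteq> {..<t}" "i \<notin> S"
  shows "(\<Sum>j\<in>S. A i j) = qr_bit i (\<Prod>j\<in>S. int (p j))"
proof -
  have "finite S" using assms finite_subset by blast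
  thus ?thesis using assms(2,3)
  proof (induction S rule: finite_induct)
    case empty
    show ?case using Legendre_1[of "p i"] p_gt_2[OF assms(1)] by (simp add: qr_bit_def)
  next
    case (insert k S)
    have "\<not> int (p i) dvd int (p k)" "\<not> int (p i) dvd (\<Prod>j\<in>S. int (p j))"
      using not_dvd_prod_p[of i "{k}"] not_dvd_prod_p[of i S] insert.prems assms(1) by auto
    thus ?case using insert assms(1) A_offdiag[of i k] by (simp add: qr_bit_mult)
  qed
qed

text \<open>Zero row sums allow S to be replaced by its complement, which avoids the diagonal
  entry.\<close>

lemma A_sum_in:
  assumes "i < t" "S \<subseteq> {..<t}" "i \<in> S"
  shows "(\<Sum>j\<in>S. A i j) = qr_bit i (\<Prod>j\<in>{..<t} - S. int (p j))"
proof -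
  have "(\<Sum>j\<in>{..<t} - S. A i j) + (\<Sum>j\<in>S. A i j) = 0"
    using row_sum[OF assms(1)] sum.subset_diff[OF assms(2) finite_lessThan, of "A i"] by simp
  hence "(\<Sum>j\<in>{..<t} - S. A i j) = (\<Sum>j\<in>S. A i j)" by (simp only: bit_add_eq_0_iff)
  thus ?thesis using A_sum_notin[of i "{..<t} - S"] assms by simp
qed

definition pset :: "int \<Rightarrow> nat set" where "pset x = {i. i < t \<and> int (p i) dvd x}"

lemma pset_sub: "pset x \<subseteq> {..<t}" by (auto simp: pset_def)

lemma p_not_dvd_q: "i < t \<Longrightarrow> \<not> int (p i) dvd int q"
  using coprime_p_q coprime_common_divisor[of "int (p i)" "int q" "int (p i)"] prime_p by fastforce

lemma divisor_eq:
  assumes "x > 0" "x dvd nn"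
  shows "x = (\<Prod>i\<in>pset x. int (p i)) * (if int q dvd x then int q else 1)"
proof -
  have inj: "inj_on (\<lambda>i. int (p i)) {..<t}" using inj_p by (auto simp: inj_on_def)
  have *: "y = (\<Prod>i\<in>pset y. int (p i))" if "y > 0" "y dvd int P" for y
    using eq_prod_prime_divisors[OF finite_lessThan _ inj, of y] prime_p that
    by (simp add: int_P pset_def)
  show ?thesis
  proof (cases "int q dvd x")
    case True
    then obtain y where y: "x = int q * y" by blast
    have q0: "int q > 0" using q_gt_2 by simp
    have "y > 0" using y assms(1) q0 by (simp add: zero_less_mult_iff)
    moreover have "y dvd int P" using assms(2) q0 unfolding nn_def y by (simp add: mult.commute)
    ultimately have "y = (\<Prod>i\<in>pset y. int (p i))" by (rule *)
    moreover have "pset x = pset y"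
      unfolding pset_def y using p_not_dvd_q prime_p by (auto simp: prime_dvd_mult_iff)
    ultimately show ?thesis using True y by simp
  next
    case False
    hence "coprime x (int q)" using prime_q prime_imp_coprime[of "int q" x] by (simp add: coprime_commute)
    hence "x dvd int P" using assms(2) unfolding nn_def by (simp add: coprime_dvd_mult_left_iff)
    thus ?thesis using *[OF assms(1)] False by simp
  qed
qed

text \<open>A possible factor q of x is invisible here, since q is a residue modulo every
  p_i.\<close>

lemma qr_bit_divisor:
  assumes "x > 0" "x dvd nn" "i < t" "\<not> int (p i) dvd x"
  shows "qr_bit i x = (\<Sum>j\<in>pset x. A i j)"
proof -
  let ?D = "\<Prod>i\<in>pset x. int (p i)"
  have i: "i \<notin> pset x" using assms(4) by (simp add: pset_def)
  have lq: "qr_bit i (int q) = 0" using Legendre_q_p[OF assms(3)] by (simp add: qr_bit_def)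
  have "qr_bit i x = qr_bit i (?D * (if int q dvd x then int q else 1))" using divisor_eq[OF assms(1,2)] by simp
  also have "\<dots> = qr_bit i ?D"
    using qr_bit_mult[OF assms(3) not_dvd_prod_p[OF assms(3) pset_sub i] p_not_dvd_q[OF assms(3)]] lq by simp
  finally show ?thesis using A_sum_notin[OF assms(3) pset_sub i] by simp
qed

lemma Legendre_q_prod: "S \<subseteq> {..<t} \<Longrightarrow> Legendre (\<Prod>i\<in>S. int (p i)) (int q) = 1"
  using Legendre_p_q by (subst Legendre_prod[OF prime_q q_gt_2]) (auto intro: finite_subset intro!: prod.neutral)

lemma Legendre_q_divisor:
  assumes "x > 0" "x dvd nn" "\<not> int q dvd x"
  shows "Legendre x (int q) = 1"
  using divisor_eq[OF assms(1,2)] assms(3) Legendre_q_prod[OF pset_sub, of x] by simp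

text \<open>The prime divisors p_i of the four factors partition the indices. At every p_i the local
  conditions equate the symbols of two of the factors prime to it, so the columns of a and b
  together sum to zero in each row, and the kernel in corank one leaves a \<union> b empty or full.
  The parity of t excludes the first; in the second, a alone is again in the kernel.\<close>

lemma classification:
  assumes pos: "\<alpha> > 0" "\<beta> > 0" "\<gamma> > 0" "\<delta> > 0" and nn: "nn = \<alpha> * \<beta> * (\<gamma> * \<delta>)"
    and eq: "\<alpha> * r\<^sup>2 + \<beta> * s\<^sup>2 = \<gamma> * u\<^sup>2" "\<alpha> * r\<^sup>2 - \<beta> * s\<^sup>2 = \<delta> * v\<^sup>2"
    and cop: "coprime (\<alpha> * r) (\<beta> * s)"
  shows "(\<alpha> = 1 \<and> \<beta> = nn \<and> \<gamma> = 1 \<and> \<delta> = 1) \<or> (\<alpha> = 1 \<and> \<beta> = int P \<and> \<gamma> = 1 \<and> \<delta> = int q) \<or>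
    (\<alpha> = int P \<and> \<beta> = int q \<and> \<gamma> = 1 \<and> \<delta> = 1) \<or> (\<alpha> = int P \<and> \<beta> = 1 \<and> \<gamma> = 1 \<and> \<delta> = int q)"
proof -
  have dvd: "\<alpha> dvd nn" "\<beta> dvd nn" "\<gamma> dvd nn" "\<delta> dvd nn" unfolding nn by simp_all
  note loc = local_conditions[OF eq cop]
  note locq = loc[OF prime_q q_gt_2]
  note Lq = Legendre_q_divisor
  \<comment> \<open>Divisors of n prime to q are residues modulo q while -1 is not. So q divides
    neither \<alpha> nor \<gamma>, whose local conditions contain a sign.\<close>
  have qa: "\<not> int q dvd \<alpha>"
  proof
    assume "int q dvd \<alpha>"
    hence h: "\<not> int q dvd \<beta>" "\<not> int q dvd \<delta>" "Legendre (- \<beta>) (int q) = Legendre \<delta> (int q)" using locq(1) by auto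
    show False using h(3) Lq[OF pos(2) dvd(2) h(1)] Lq[OF pos(4) dvd(4) h(2)] unfolding Legendre_uminus_q by simp
  qed
  have qc: "\<not> int q dvd \<gamma>"
  proof
    assume "int q dvd \<gamma>"
    hence h: "\<not> int q dvd \<alpha>" "\<not> int q dvd \<beta>" "Legendre \<alpha> (int q) = Legendre (- \<beta>) (int q)" using locq(3) by auto
    show False using h(3) Lq[OF pos(1) dvd(1) h(1)] Lq[OF pos(2) dvd(2) h(2)] unfolding Legendre_uminus_q by simp
  qed
  have qbd: "int q dvd \<beta> \<longleftrightarrow> \<not> int q dvd \<delta>"
  proof -
    have "prime (int q)" using prime_q by simp
    moreover have "int q dvd \<alpha> * \<beta> * (\<gamma> * \<delta>)" unfolding nn[symmetric] nn_def by simp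
    ultimately have "int q dvd \<beta> \<or> int q dvd \<delta>" using qa qc by (auto simp: prime_dvd_mult_iff)
    thus ?thesis using locq(2) by blast
  qed
  define a b c d where "a = pset \<alpha>" and "b = pset \<beta>" and "c = pset \<gamma>" and "d = pset \<delta>"
  have sub: "a \<subseteq> {..<t}" "b \<subseteq> {..<t}" "c \<subseteq> {..<t}" "d \<subseteq> {..<t}"
    by (simp_all add: a_def b_def c_def d_def pset_sub)
  have fin: "finite a" "finite b" "finite c" "finite d" using sub finite_subset by blast+
  have mem: "i \<in> a \<longleftrightarrow> i < t \<and> int (p i) dvd \<alpha>" "i \<in> b \<longleftrightarrow> i < t \<and> int (p i) dvd \<beta>"
    "i \<in> c \<longleftrightarrow> i < t \<and> int (p i) dvd \<gamma>" "i \<in> d \<longleftrightarrow> i < t \<and> int (p i) dvd \<delta>" for i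
    by (auto simp: a_def b_def c_def d_def pset_def)
  have cover: "i \<in> a \<or> i \<in> b \<or> i \<in> c \<or> i \<in> d" if i: "i < t" for i
  proof -
    have "prime (int (p i))" using prime_p[OF i] by simp
    moreover have "int (p i) dvd \<alpha> * \<beta> * (\<gamma> * \<delta>)"
      unfolding nn[symmetric] nn_def using p_dvd_P[OF i] by simp
    ultimately show ?thesis using i by (auto simp: mem prime_dvd_mult_iff)
  qed
  have locp: "i \<in> a \<Longrightarrow> i \<notin> b \<and> i \<notin> c \<and> i \<notin> d \<and> qr_bit i \<beta> = qr_bit i \<gamma> \<and> qr_bit i \<beta> = qr_bit i \<delta>"
    "i \<in> b \<Longrightarrow> i \<notin> a \<and> i \<notin> c \<and> i \<notin> d \<and> qr_bit i \<alpha> = qr_bit i \<gamma> \<and> qr_bit i \<alpha> = qr_bit i \<delta>"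
    "i \<in> c \<Longrightarrow> i \<notin> a \<and> i \<notin> b \<and> i \<notin> d \<and> qr_bit i \<alpha> = qr_bit i \<beta> \<and> qr_bit i (2 * \<alpha>) = qr_bit i \<delta>"
    "i \<in> d \<Longrightarrow> i \<notin> a \<and> i \<notin> b \<and> i \<notin> c \<and> qr_bit i \<alpha> = qr_bit i \<beta> \<and> qr_bit i (2 * \<alpha>) = qr_bit i \<gamma>" for i
    using loc(1)[OF prime_p[of i] p_gt_2[of i]] Legendre_uminus_p[of i]
    subgoal unfolding mem qr_bit_def by simp
    using loc(2)[OF prime_p[of i] p_gt_2[of i]]
    subgoal unfolding mem qr_bit_def by simp
    using loc(3)[OF prime_p[of i] p_gt_2[of i]] Legendre_uminus_p[of i]
    subgoal unfolding mem qr_bit_def by simp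
    using loc(4)[OF prime_p[of i] p_gt_2[of i]]
    subgoal unfolding mem qr_bit_def by simp
    done
  have sum_eq: "(\<Sum>j\<in>a. A i j) = qr_bit i \<alpha>" if "i < t" "i \<notin> a" for i
    using qr_bit_divisor[OF pos(1) dvd(1)] that by (simp add: a_def mem(1)[unfolded a_def])
  have sum_eq_b: "(\<Sum>j\<in>b. A i j) = qr_bit i \<beta>" if "i < t" "i \<notin> b" for i
    using qr_bit_divisor[OF pos(2) dvd(2)] that by (simp add: b_def mem(2)[unfolded b_def])
  have sum_eq_c: "(\<Sum>j\<in>c. A i j) = qr_bit i \<gamma>" if "i < t" "i \<notin> c" for i
    using qr_bit_divisor[OF pos(3) dvd(3)] that by (simp add: c_def mem(3)[unfolded c_def])
  have sum_eq_d: "(\<Sum>j\<in>d. A i j) = qr_bit i \<delta>" if "i < t" "i \<notin> d" for i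
    using qr_bit_divisor[OF pos(4) dvd(4)] that by (simp add: d_def mem(4)[unfolded d_def])
  have bit2: "x + x = 0" for x :: bit by (simp only: bit_add_eq_0_iff)
  have disj: "a \<inter> b = {}" "c \<inter> d = {}" "(a \<union> b) \<inter> (c \<union> d) = {}" using locp by blast+
  have un: "(a \<union> b) \<union> (c \<union> d) = {..<t}" using cover sub by blast
  have row: "(\<Sum>j\<in>a. A i j) + (\<Sum>j\<in>b. A i j) = (\<Sum>j\<in>c. A i j) + (\<Sum>j\<in>d. A i j)" if "i < t" for i
  proof -
    have "(\<Sum>j\<in>(a \<union> b) \<union> (c \<union> d). A i j) = 0" unfolding un by (rule row_sum[OF that])
    hence "((\<Sum>j\<in>a. A i j) + (\<Sum>j\<in>b. A i j)) + ((\<Sum>j\<in>c. A i j) + (\<Sum>j\<in>d. A i j)) = 0"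
      using disj fin by (simp add: sum.union_disjoint)
    thus ?thesis by (simp only: bit_add_eq_0_iff)
  qed
  \<comment> \<open>For i outside a and b the symbols of \<alpha> and \<beta> agree and cancel; for
    i inside, the zero row sum moves the question to \<gamma> and \<delta>.\<close>
  have "(\<Sum>j\<in>a \<union> b. A i j) = 0" if i: "i < t" for i
  proof -
    have ab: "(\<Sum>j\<in>a \<union> b. A i j) = (\<Sum>j\<in>a. A i j) + (\<Sum>j\<in>b. A i j)"
      using disj(1) fin by (simp add: sum.union_disjoint)
    consider "i \<in> a \<or> i \<in> b" | "i \<in> c \<or> i \<in> d" using cover[OF i] by blast
    thus ?thesis
    proof cases
      case 1
      hence "i \<notin> c" "i \<notin> d" "qr_bit i \<gamma> = qr_bit i \<delta>" using locp(1,2)[of i] by auto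
      thus ?thesis unfolding ab row[OF i] using sum_eq_c[OF i] sum_eq_d[OF i] bit2 by presburger
    next
      case 2
      hence "i \<notin> a" "i \<notin> b" "qr_bit i \<alpha> = qr_bit i \<beta>" using locp(3,4)[of i] by auto
      thus ?thesis unfolding ab using sum_eq[OF i] sum_eq_b[OF i] bit2 by presburger
    qed
  qed
  moreover have "a \<union> b \<subseteq> {..<t}" using sub by blast
  ultimately consider "a \<union> b = {}" | "a \<union> b = {..<t}"
    using kernel_of_corank_one[OF rank carrier_A t_pos row_sum] by blast
  thus ?thesis
  proof cases
    case 1
    hence ab: "a = {}" "b = {}" by auto
    have "\<alpha> = 1" using divisor_eq[OF pos(1) dvd(1)] qa ab by (simp add: a_def)
    have "(\<Sum>j\<in>c. A i j) = 1" if i: "i < t" for i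
    proof -
      \<comment> \<open>Here (2/p_i) = -1 enters, through p_i = 5 modulo 8.\<close>
      have lb2: "qr_bit i (2 * \<alpha>) = 1" unfolding \<open>\<alpha> = 1\<close> using Legendre_2_p[OF i] by (simp add: qr_bit_def)
      consider "i \<in> c" | "i \<in> d" using cover[OF i] ab by blast
      thus ?thesis
      proof cases
        case 1
        hence h: "i \<notin> d" "qr_bit i \<delta> = 1" using locp(3)[of i] lb2 by auto
        have "(\<Sum>j\<in>c. A i j) + (\<Sum>j\<in>d. A i j) = 0" using row[OF i] ab by simp
        hence "(\<Sum>j\<in>c. A i j) = (\<Sum>j\<in>d. A i j)" by (simp only: bit_add_eq_0_iff)
        thus ?thesis using sum_eq_d[OF i h(1)] h(2) by simp
      next
        case 2
        hence h: "i \<notin> c" "qr_bit i \<gamma> = 1" using locp(4)[of i] lb2 by auto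
        thus ?thesis using sum_eq_c[OF i h(1)] by simp
      qed
    qed
    \<comment> \<open>The total over all rows is t, which is 1 in F_2, whereas each column sums to
      zero.\<close>
    hence "(\<Sum>i<t. \<Sum>j\<in>c. A i j) = of_nat t" by simp
    moreover have "(\<Sum>i<t. \<Sum>j\<in>c. A i j) = (\<Sum>j\<in>c. \<Sum>i<t. A i j)" by (rule sum.swap)
    moreover have "\<dots> = 0" using sub(3) col_sum by (intro sum.neutral) auto
    moreover have "of_nat t = (1 :: bit)" using odd_t by (auto elim!: oddE)
    ultimately have "(1 :: bit) = 0" by (metis)
    thus ?thesis by simp
  next
    case 2
    hence cd: "c = {}" "d = {}" using disj(3) sub by auto
    \<comment> \<open>With \<gamma> = 1 the local conditions make \<beta> a residue at the p_i
      dividing \<alpha>, and \<alpha> a residue at those dividing \<beta>.\<close>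
    have "(\<Sum>j\<in>a. A i j) = 0" if i: "i < t" for i
    proof -
      have one: "qr_bit i \<gamma> = 0" "\<gamma> = 1"
      proof -
        show "\<gamma> = 1" using divisor_eq[OF pos(3) dvd(3)] qc cd by (simp add: c_def)
        thus "qr_bit i \<gamma> = 0" using Legendre_1[of "p i"] p_gt_2[OF i] by (simp add: qr_bit_def)
      qed
      consider "i \<in> a" | "i \<in> b" using 2 i by blast
      thus ?thesis
      proof cases
        case 1
        hence h: "i \<notin> b" "qr_bit i \<beta> = 0" using locp(1)[of i] one by auto
        have "(\<Sum>j\<in>a. A i j) + (\<Sum>j\<in>b. A i j) = 0" using row[OF i] cd by simp
        hence "(\<Sum>j\<in>a. A i j) = (\<Sum>j\<in>b. A i j)" by (simp only: bit_add_eq_0_iff)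
        thus ?thesis using sum_eq_b[OF i h(1)] h(2) by simp
      next
        case 2
        hence h: "i \<notin> a" "qr_bit i \<alpha> = 0" using locp(2)[of i] one by auto
        thus ?thesis using sum_eq[OF i h(1)] by simp
      qed
    qed
    hence a: "a = {} \<or> a = {..<t}"
      using kernel_of_corank_one[OF rank carrier_A t_pos row_sum sub(1)] by blast
    have \<gamma>: "\<gamma> = 1" using divisor_eq[OF pos(3) dvd(3)] qc cd by (simp add: c_def)
    have \<delta>: "\<delta> = (if int q dvd \<delta> then int q else 1)" using divisor_eq[OF pos(4) dvd(4)] cd by (simp add: d_def)
    have \<alpha>: "\<alpha> = (\<Prod>i\<in>a. int (p i))" using divisor_eq[OF pos(1) dvd(1)] qa by (simp add: a_def)
    have \<beta>: "\<beta> = (\<Prod>i\<in>b. int (p i)) * (if int q dvd \<beta> then int q else 1)"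
      using divisor_eq[OF pos(2) dvd(2)] by (simp add: b_def)
    have nP: "nn = int P * int q" by (simp add: nn_def)
    from a show ?thesis
    proof
      assume a: "a = {}"
      hence b: "b = {..<t}" using 2 by auto
      have "\<alpha> = 1" using \<alpha> a by simp
      moreover have "\<beta> = int P * (if int q dvd \<beta> then int q else 1)" using \<beta> unfolding b int_P .
      ultimately show ?thesis using \<gamma> \<delta> qbd nP by (cases "int q dvd \<beta>") auto
    next
      assume a: "a = {..<t}"
      hence b: "b = {}" using disj(1) sub by auto
      have "\<alpha> = int P" using \<alpha> unfolding a int_P .
      moreover have "\<beta> = (if int q dvd \<beta> then int q else 1)" using \<beta> unfolding b by simp
      ultimately show ?thesis using \<gamma> \<delta> qbd by (cases "int q dvd \<beta>") auto
    qed
  qed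
qed

end

section \<open>Solutions in the principal genus\<close>

lemma square_root_mod_mult:
  fixes m1 m2 x :: int
  assumes "coprime m1 m2" "\<exists>c. [c\<^sup>2 = x] (mod m1)" "\<exists>c. [c\<^sup>2 = x] (mod m2)"
  shows "\<exists>c. [c\<^sup>2 = x] (mod m1 * m2)"
proof -
  obtain c1 c2 where c: "[c1\<^sup>2 = x] (mod m1)" "[c2\<^sup>2 = x] (mod m2)" using assms by blast
  obtain c where c': "[c = c1] (mod m1)" "[c = c2] (mod m2)"
    using binary_chinese_remainder_int[OF assms(1)] by blast
  have "[c\<^sup>2 = x] (mod m1)" "[c\<^sup>2 = x] (mod m2)"
    using cong_trans[OF cong_pow[OF c'(1)] c(1)] cong_trans[OF cong_pow[OF c'(2)] c(2)] by blast+
  thus ?thesis using assms(1) by (intro exI[of _ c] coprime_cong_mult)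
qed

lemma prime_dvd_coprime_square_sum:
  fixes l :: nat and a b c :: int
  assumes "prime l" "coprime a b" "int l dvd c" "c = a + b"
  shows "\<not> int l dvd a" "\<not> int l dvd b"
proof -
  have pl: "\<not> is_unit (int l)" using assms(1) by auto
  have "int l dvd a \<longleftrightarrow> int l dvd b" using assms(3) unfolding assms(4)
    using dvd_add_left_iff dvd_add_right_iff by blast
  thus "\<not> int l dvd a" "\<not> int l dvd b" using coprime_common_divisor[OF assms(2), of "int l"] pl by blast+
qed

lemma factors_of_twice_prime:
  fixes a b q :: int
  assumes "prime q" "a * b = 2 * q" "a > 0" "b > 0"
  shows "(a = 1 \<and> b = 2 * q) \<or> (a = 2 \<and> b = q) \<or> (a = q \<and> b = 2) \<or> (a = 2 * q \<and> b = 1)"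
proof -
  have q0: "q > 0" using assms(1) by (simp add: prime_gt_0_int)
  have two: "(x = 1 \<and> y = 2) \<or> (x = 2 \<and> y = 1)" if "x * y = (2::int)" "x > 0" for x y
  proof -
    have "x dvd 2" using that(1) by (metis dvd_triv_left)
    hence "x \<le> 2" by (rule zdvd_imp_le) simp
    hence "x = 1 \<or> x = 2" using that(2) by auto
    thus ?thesis using that(1) by auto
  qed
  have "q dvd a * b" unfolding assms(2) by simp
  hence "q dvd a \<or> q dvd b" using assms(1) by (simp add: prime_dvd_mult_iff)
  thus ?thesis
  proof
    assume "q dvd a"
    then obtain k where k: "a = q * k" by blast
    have "k * b = 2" using assms(2) q0 unfolding k by simp
    moreover have "k > 0" using assms(3) q0 unfolding k by (simp add: zero_less_mult_iff)
    ultimately show ?thesis using two[of k b] k by auto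
  next
    assume "q dvd b"
    then obtain k where k: "b = q * k" by blast
    have "k * a = 2" using assms(2) q0 unfolding k by (simp add: mult.commute)
    moreover have "k > 0" using assms(4) q0 unfolding k by (simp add: zero_less_mult_iff)
    ultimately show ?thesis using two[of k a] k by auto
  qed
qed

context corank_one_primes
begin

section \<open>The Jacobi symbol modulo P\<close>

definition Jacobi_P :: "int \<Rightarrow> int" where "Jacobi_P x = (\<Prod>i<t. Legendre x (int (p i)))"

lemma Jacobi_P_mult: "Jacobi_P (x * y) = Jacobi_P x * Jacobi_P y"
  unfolding Jacobi_P_def prod.distrib[symmetric]
  using Legendre_mult[OF prime_p p_gt_2] by (intro prod.cong) auto

lemma Jacobi_P_1: "Jacobi_P 1 = 1"
  unfolding Jacobi_P_def
proof (intro prod.neutral ballI)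
  fix i assume "i \<in> {..<t}"
  thus "Legendre 1 (int (p i)) = 1" using Legendre_1[of "p i"] p_gt_2[of i] by simp
qed

lemma Jacobi_P_abs: "Jacobi_P \<bar>x\<bar> = Jacobi_P x"
  unfolding Jacobi_P_def using Legendre_uminus_p by (intro prod.cong) (auto simp: abs_if)

lemma Jacobi_P_cong: "[x = y] (mod int P) \<Longrightarrow> Jacobi_P x = Jacobi_P y"
  unfolding Jacobi_P_def using p_dvd_P by (intro prod.cong refl Legendre_cong) (auto intro: cong_dvd_modulus)

lemma Jacobi_P_prime:
  assumes "prime l" "l > 2" "\<not> int l dvd int P"
  shows "Jacobi_P (int l) = Legendre (int P) (int l)"
proof -
  have "Jacobi_P (int l) = (\<Prod>i<t. Legendre (int (p i)) (int l))"
    unfolding Jacobi_P_def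
  proof (intro prod.cong refl)
    fix i assume "i \<in> {..<t}"
    hence i: "i < t" by simp
    have "p i \<noteq> l" using assms(3) p_dvd_P[OF i] by auto
    thus "Legendre (int l) (int (p i)) = Legendre (int (p i)) (int l)"
      using Legendre_reciprocal[OF prime_p[OF i] p_gt_2[OF i] assms(1,2) _ p_mod_4[OF i]] by simp
  qed
  also have "\<dots> = Legendre (int P) (int l)"
    unfolding int_P by (rule Legendre_prod[OF assms(1,2) finite_lessThan, symmetric])
  finally show ?thesis .
qed

lemma Jacobi_P_eq_multiplicative:
  fixes m :: nat and g :: "nat \<Rightarrow> int"
  assumes "m > 0" "g 1 = 1" "\<And>a b. g (a * b) = g a * g b"
    "\<And>l. prime l \<Longrightarrow> l dvd m \<Longrightarrow> Jacobi_P (int l) = g l"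
  shows "Jacobi_P (int m) = g m"
  using multiplicative_eqI[of "\<lambda>x. Jacobi_P (int x)" g m] assms Jacobi_P_1 Jacobi_P_mult by simp

lemma odd_prime_dvd: "prime l \<Longrightarrow> l dvd m \<Longrightarrow> odd m \<Longrightarrow> l > (2::nat)"
  using prime_ge_2_nat[of l] by (metis dvd_trans le_neq_implies_less)

text \<open>Reciprocity with p_i = 1 modulo 4 turns (l/P) into (P/l), so it is enough that P is a
  residue modulo each prime divisor of x.\<close>

lemma Jacobi_P_eq_1:
  fixes x :: int
  assumes "odd x" "\<And>l. prime l \<Longrightarrow> l > 2 \<Longrightarrow> int l dvd x \<Longrightarrow> \<not> int l dvd int P \<and> Legendre (int P) (int l) = 1"
  shows "Jacobi_P x = 1"
proof -
  have "x \<noteq> 0" using assms(1) by auto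
  have "Jacobi_P (int (nat \<bar>x\<bar>)) = (\<lambda>_. 1) (nat \<bar>x\<bar>)"
  proof (rule Jacobi_P_eq_multiplicative)
    fix l assume l: "prime l" "l dvd nat \<bar>x\<bar>"
    have "l > 2" using l assms(1) by (intro odd_prime_dvd[OF l]) (simp add: even_nat_iff)
    moreover have "int l dvd x" using l(2) by (metis dvd_abs_iff int_dvd_int_iff nat_0_le abs_ge_zero)
    ultimately show "Jacobi_P (int l) = 1" using assms(2) l(1) Jacobi_P_prime by simp
  qed (use \<open>x \<noteq> 0\<close> in auto)
  thus ?thesis by (simp add: Jacobi_P_abs)
qed

lemma Legendre_P_eq_1:
  assumes l: "prime l" "l > 2" and c: "[int P * x\<^sup>2 = y\<^sup>2] (mod int l)"
    and nd: "\<not> int l dvd int P" "\<not> int l dvd x"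
  shows "Legendre (int P) (int l) = 1"
proof -
  have "\<not> int l dvd y"
  proof
    assume "int l dvd y"
    hence "int l dvd y\<^sup>2" by (simp add: power2_eq_square)
    hence "int l dvd int P * x\<^sup>2" using c cong_dvd_iff by blast
    thus False using nd l(1) by (simp add: prime_dvd_mult_iff prime_dvd_power_iff)
  qed
  thus ?thesis
    using Legendre_eq_if_square_multiples_cong[OF l, of "int P" x 1 y] c nd Legendre_1[of l] l(2) by simp
qed

text \<open>The factor 4 is the one in the norm of (P w + y \<omega>)/2, which is P Z^2. Coprimality
  will make this element primitive, and the Jacobi symbol is the one genus condition that ramified
  ideals cannot correct.\<close>

definition principal_genus_solution :: "int \<Rightarrow> int \<Rightarrow> int \<Rightarrow> bool" where
  "principal_genus_solution Z w y \<longleftrightarrow> Z > 0 \<and> odd Z \<and> coprime (int P * w) Z \<and>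
     int P * w\<^sup>2 + int q * y\<^sup>2 = 4 * Z\<^sup>2 \<and> Jacobi_P Z = 1"

lemma odd_P: "odd (int P)" and P_mod_8_int: "int P mod 8 = 5"
  and odd_q: "odd (int q)" and q_mod_8_int: "int q mod 8 = 7"
proof -
  show "int P mod 8 = 5" using P_mod_8 by presburger
  thus "odd (int P)" by presburger
  show "int q mod 8 = 7" using q_mod by presburger
  thus "odd (int q)" by presburger
qed

lemma P_square_mod_8: "(int P * x\<^sup>2) mod 8 = (5 * (x\<^sup>2 mod 8)) mod 8"
  and q_square_mod_8: "(int q * x\<^sup>2) mod 8 = (7 * (x\<^sup>2 mod 8)) mod 8"
  using mod_mult_eq[of "int P" 8 "x\<^sup>2"] mod_mult_eq[of "int q" 8 "x\<^sup>2"] P_mod_8_int q_mod_8_int by simp_all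

section \<open>Solutions from the three remaining quadruples\<close>

text \<open>Modulo 8 the two equations force r = 2 Z with Z odd. The second equation is then the
  desired one, and the first shows that P is a residue modulo every prime divisor of Z.\<close>

lemma solution_case_1:
  fixes r s u v :: int
  assumes pos: "r > 0" and eq: "r\<^sup>2 + int P * s\<^sup>2 = u\<^sup>2" "r\<^sup>2 - int P * s\<^sup>2 = int q * v\<^sup>2"
    and cop: "coprime r (int P * s)" and odd: "odd u"
  shows "\<exists>Z w y. principal_genus_solution Z w y"
proof -
  have u8: "u\<^sup>2 mod 8 = 1" using square_mod_8(1)[OF odd] .
  have e1: "(r\<^sup>2 mod 8 + (int P * s\<^sup>2) mod 8) mod 8 = 1" using u8 unfolding eq(1)[symmetric] by (simp add: mod_add_eq)
  have e2: "(r\<^sup>2 mod 8 - (int P * s\<^sup>2) mod 8) mod 8 = (7 * (v\<^sup>2 mod 8)) mod 8"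
    using q_square_mod_8[of v] unfolding eq(2)[symmetric] by (simp add: mod_diff_eq)
  note v8 = square_mod_8_cases[of v]
  note s8 = square_mod_8_cases[of s]
  note r8 = square_mod_8_cases[of r]
  have "r\<^sup>2 mod 8 = 4" using e1 e2 v8 s8 r8 unfolding P_square_mod_8 by (elim disjE) simp_all
  then obtain Z where Z: "odd Z" "r = 2 * Z" using square_mod_8(3) by blast
  have Z0: "Z > 0" using pos Z by simp
  have copZ: "coprime (int P * s) Z" using cop unfolding Z(2) by (simp add: coprime_commute)
  have "Jacobi_P Z = 1"
  proof (rule Jacobi_P_eq_1[OF Z(1)])
    fix l :: nat assume l: "prime l" "l > 2" "int l dvd Z"
    have nd: "\<not> int l dvd int P * s"
      using coprime_common_divisor[OF copZ _ l(3)] l(1) by auto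
    hence nd': "\<not> int l dvd int P" "\<not> int l dvd s" by (auto intro: dvd_mult dvd_mult2)
    have "int l dvd r\<^sup>2" using l(3) unfolding Z(2) by (simp add: power2_eq_square)
    hence c: "[int P * s\<^sup>2 = u\<^sup>2] (mod int l)" unfolding eq(1)[symmetric] by (simp add: cong_iff_dvd_diff)
    show "\<not> int l dvd int P \<and> Legendre (int P) (int l) = 1"
      using Legendre_P_eq_1[OF l(1,2) c nd'] nd'(1) by blast
  qed
  moreover have "int P * s\<^sup>2 + int q * v\<^sup>2 = 4 * Z\<^sup>2"
    unfolding eq(2)[symmetric] Z(2) by (simp add: power_mult_distrib)
  ultimately show ?thesis unfolding principal_genus_solution_def using Z0 Z(1) copZ by blast
qed

text \<open>Here \<open>u = a + b\<close> with \<open>a b = 2 q (s/2)\<^sup>2\<close> and \<open>a, b\<close> coprime, hence \<open>u = x\<^sup>2 + 2 q y\<^sup>2\<close> or \<open>u = 2 x\<^sup>2 + q y\<^sup>2\<close>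
  with \<open>x, y\<close> odd, and \<open>u \<equiv> \<plusminus>1\<close> modulo \<open>8\<close>.\<close>

lemma solution_case_2:
  fixes r s u v :: int
  assumes pos: "r > 0" "s > 0" "u > 0" "v > 0"
    and eq: "int P * r\<^sup>2 + int q * s\<^sup>2 = u\<^sup>2" "int P * r\<^sup>2 - int q * s\<^sup>2 = v\<^sup>2"
    and cop: "coprime (int P * r) (int q * s)" and odd: "odd u"
  shows "\<exists>Z w y. principal_genus_solution Z w y"
proof -
  have u8: "u\<^sup>2 mod 8 = 1" using square_mod_8(1)[OF odd] .
  have e1: "((int P * r\<^sup>2) mod 8 + (int q * s\<^sup>2) mod 8) mod 8 = 1"
    using u8 unfolding eq(1)[symmetric] by (simp add: mod_add_eq)
  note s8 = square_mod_8_cases[of s]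
  note r8 = square_mod_8_cases[of r]
  \<comment> \<open>P r^2 + q s^2 = 1 modulo 8 leaves only s = 2 s' with s' odd.\<close>
  have "s\<^sup>2 mod 8 = 4" using e1 s8 r8 unfolding P_square_mod_8 q_square_mod_8 by (elim disjE) simp_all
  then obtain s' where s': "odd s'" "s = 2 * s'" using square_mod_8(3) by blast
  have s'0: "s' > 0" using pos s' by simp
  have coppq: "coprime (int P * r\<^sup>2) (int q * s\<^sup>2)" using cop by simp
  have "v\<^sup>2 = u\<^sup>2 - 2 * (int q * s\<^sup>2)" using eq by linarith
  hence "odd (v\<^sup>2)" using odd by simp
  hence oddv: "odd v" by simp
  have "int q * s\<^sup>2 > 0" using pos q_gt_2 by simp
  hence "v\<^sup>2 < u\<^sup>2" using eq by linarith
  hence vu: "v < u" using pos by (simp add: power2_less_imp_less)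
  obtain a where a: "u + v = 2 * a" using odd oddv by (metis dvdE odd_even_add)
  obtain b where b: "u - v = 2 * b" using odd oddv by (metis dvdE even_diff odd_even_add)
  have uv: "u = a + b" "v = a - b" using a b by linarith+
  have ab0: "a > 0" "b > 0" using a b vu pos by linarith+
  have ab: "a * b = 2 * int q * s'\<^sup>2"
  proof -
    have "4 * (a * b) = u\<^sup>2 - v\<^sup>2" unfolding uv by (simp add: power2_eq_square algebra_simps)
    also have "\<dots> = 2 * (int q * s\<^sup>2)" unfolding eq[symmetric] by simp
    also have "\<dots> = 4 * (2 * int q * s'\<^sup>2)" unfolding s'(2) by (simp add: power_mult_distrib)
    finally show ?thesis by simp
  qed
  have abr: "a\<^sup>2 + b\<^sup>2 = int P * r\<^sup>2"
  proof -
    have "2 * (a\<^sup>2 + b\<^sup>2) = u\<^sup>2 + v\<^sup>2" unfolding uv by (simp add: power2_eq_square algebra_simps)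
    also have "\<dots> = 2 * (int P * r\<^sup>2)" unfolding eq[symmetric] by simp
    finally show ?thesis by simp
  qed
  have copab: "coprime a b"
  proof (rule coprimeI)
    fix c assume c: "c dvd a" "c dvd b"
    have "c dvd a\<^sup>2 + b\<^sup>2" using c by (simp add: power2_eq_square)
    moreover have "c dvd 2 * (a * b)" using c by simp
    moreover have "2 * (a * b) = int q * s\<^sup>2" unfolding ab s'(2) by (simp add: power_mult_distrib)
    ultimately show "is_unit c" unfolding abr using coppq coprime_common_divisor by metis
  qed
  have primeq: "prime (int q)" using prime_q by simp
  have sqf: "squarefree (2 * int q)"
    using primeq odd_q by (intro squarefree_mult_coprime) (auto intro: squarefree_prime)
  have q20: "2 * int q > 0" using q_gt_2 by simp
  obtain a' b' x y where h: "a' > 0" "b' > 0" "x > 0" "y > 0" "2 * int q = a' * b'"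
    "a = a' * x\<^sup>2" "b = b' * y\<^sup>2" "s' = x * y"
    using squarefree_coprime_split[OF sqf q20 copab ab0 s'0 ab] by blast
  have xy: "odd x" "odd y" using s'(1) unfolding h(8) by auto
  have xy8: "x\<^sup>2 mod 8 = 1" "y\<^sup>2 mod 8 = 1" using xy square_mod_8(1) by blast+
  have fac: "(a' = 1 \<and> b' = 2 * int q) \<or> (a' = 2 \<and> b' = int q) \<or> (a' = int q \<and> b' = 2) \<or> (a' = 2 * int q \<and> b' = 1)"
    using factors_of_twice_prime[OF primeq h(5)[symmetric] h(1,2)] .
  have u_mod: "u mod 8 = (a' + b') mod 8"
  proof -
    have "(a' * x\<^sup>2) mod 8 = a' mod 8" "(b' * y\<^sup>2) mod 8 = b' mod 8"
      using xy8 mod_mult_right_eq[of a' "x\<^sup>2" 8] mod_mult_right_eq[of b' "y\<^sup>2" 8] by simp_all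
    thus ?thesis unfolding uv(1) h(6,7) by (metis mod_add_eq)
  qed
  have "u mod 8 = 1 \<or> u mod 8 = 7"
    using fac q_mod_8_int unfolding u_mod by (elim disjE conjE) (simp_all, presburger+)
  hence chi: "chi2 (nat u) = 1"
  proof -
    assume h: "u mod 8 = 1 \<or> u mod 8 = 7"
    have "int (nat u mod 8) = u mod 8" using pos by (simp add: zmod_int)
    hence "nat u mod 8 = 1 \<or> nat u mod 8 = 7" using h by linarith
    moreover have "odd (nat u)" using odd pos by (simp add: even_nat_iff)
    ultimately show ?thesis by (simp add: chi2_def)
  qed
  have nd: "\<not> int l dvd int P * r\<^sup>2" if "prime l" "int l dvd u" for l
    using prime_dvd_coprime_square_sum(1)[OF that(1) coppq _ eq(1)[symmetric]] that(2)
    by (simp add: power2_eq_square)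
  \<comment> \<open>For a prime l dividing u, 2 P r^2 = u^2 + v^2 is v^2 modulo l, so (2 P / l) = 1
    and (P/l) = (2/l).\<close>
  have "Jacobi_P (int (nat u)) = chi2 (nat u)"
  proof (rule Jacobi_P_eq_multiplicative)
    show "nat u > 0" using pos by simp
    show "chi2 1 = 1" by (simp add: chi2_def)
    show "chi2 (a * b) = chi2 a * chi2 b" for a b by (rule chi2_mult)
    fix l assume l: "prime l" "l dvd nat u"
    have l2: "l > 2" using odd pos by (intro odd_prime_dvd[OF l]) (simp add: even_nat_iff)
    have lu: "int l dvd u" using l(2) pos by (simp add: int_dvd_int_iff[symmetric])
    have nP: "\<not> int l dvd int P" "\<not> int l dvd r" using nd[OF l(1) lu] by (auto simp: power2_eq_square)
    have "2 * (int P * r\<^sup>2) = u\<^sup>2 + v\<^sup>2" unfolding eq[symmetric] by simp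
    hence "int P * 2 * r\<^sup>2 - v\<^sup>2 = u\<^sup>2" by simp
    hence c: "[(int P * 2) * r\<^sup>2 = 1 * v\<^sup>2] (mod int l)"
      unfolding cong_iff_dvd_diff using lu by (simp add: power2_eq_square)
    have nv: "\<not> int l dvd v"
    proof
      assume "int l dvd v"
      hence "int l dvd v\<^sup>2 + u\<^sup>2" using lu by (simp add: power2_eq_square)
      also have "v\<^sup>2 + u\<^sup>2 = 2 * (int P * r\<^sup>2)" unfolding eq[symmetric] by simp
      finally have "int l dvd 2 \<or> int l dvd int P * r\<^sup>2" using l(1) by (simp add: prime_dvd_mult_iff)
      moreover have "\<not> int l dvd 2" using l2 zdvd_imp_le by fastforce
      ultimately show False using nd[OF l(1) lu] by blast
    qed
    have "Legendre (int P * 2) (int l) = 1"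
      using Legendre_eq_if_square_multiples_cong[OF l(1) l2 c nP(2) nv] Legendre_1[of l] l2 by simp
    hence "Legendre (int P) (int l) * chi2 l = 1"
      unfolding Legendre_mult[OF l(1) l2] Legendre_2[OF l(1) l2] .
    hence "Legendre (int P) (int l) = chi2 l" using zmult_eq_1_iff by auto
    thus "Jacobi_P (int l) = chi2 l" using Jacobi_P_prime[OF l(1) l2 nP(1)] by simp
  qed
  hence "Jacobi_P u = 1" using chi pos by simp
  moreover have "coprime (int P * (2 * r)) u"
  proof -
    have "coprime (int P * r) u"
    proof (rule coprimeI)
      fix c assume c: "c dvd int P * r" "c dvd u"
      have "c dvd (int P * r) * r" "c dvd u * u" using c by simp_all
      hence "c dvd u\<^sup>2 - int P * r\<^sup>2" by (simp add: power2_eq_square mult.assoc)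
      also have "u\<^sup>2 - int P * r\<^sup>2 = int q * s\<^sup>2" unfolding eq(1)[symmetric] by simp
      finally have "c dvd int q * s\<^sup>2" .
      moreover have "c dvd int P * r\<^sup>2" using c(1) by (simp add: power2_eq_square mult.assoc[symmetric])
      ultimately show "is_unit c" using coppq coprime_common_divisor by blast
    qed
    thus ?thesis using odd by simp
  qed
  \<comment> \<open>Here Z is u itself, which is odd, so r and s are doubled to produce the factor
    4.\<close>
  moreover have "int P * (2 * r)\<^sup>2 + int q * (2 * s)\<^sup>2 = 4 * u\<^sup>2"
    unfolding eq(1)[symmetric] by (simp add: power_mult_distrib)
  ultimately show ?thesis unfolding principal_genus_solution_def using pos(3) odd by blast
qed

text \<open>As p_i = 1 modulo 4, -1 is a residue modulo every p_i, hence modulo P.\<close>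

lemma sum_two_squares_P: "\<exists>a b. odd a \<and> even b \<and> a\<^sup>2 + b\<^sup>2 = int P"
proof -
  have "\<exists>c. [c\<^sup>2 = -1] (mod int P)"
    unfolding int_P
  proof (rule square_root_mod_prod)
    fix i assume "i \<in> {..<t}"
    hence i: "i < t" by simp
    have "Legendre (-1) (int (p i)) = 1"
      using Legendre_uminus_p[OF i, of 1] Legendre_1[of "p i"] p_gt_2[OF i] by simp
    thus "\<exists>c. [c\<^sup>2 = -1] (mod int (p i))" unfolding Legendre_1_iff by blast
  qed (use coprime_p in auto)
  then obtain c where "[c\<^sup>2 = -1] (mod int P)" by blast
  then obtain x y where xy: "x\<^sup>2 + y\<^sup>2 = int P"
    using sum_two_squares_of_square_root_minus_one[of "int P" c] P_gt_4 squarefree_P by auto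
  have "odd (x\<^sup>2 + y\<^sup>2)" unfolding xy by (rule odd_P)
  hence "odd x \<and> even y \<or> odd y \<and> even x" by auto
  thus ?thesis using xy by (metis add.commute)
qed

text \<open>Multiplying \<open>s + r \<surd>P\<close>, of norm \<open>- q v\<^sup>2\<close>, by \<open>a + \<surd>P\<close>, of norm \<open>- b\<^sup>2\<close>, solves \<open>Z\<^sup>2 - P X\<^sup>2 = q Y\<^sup>2\<close>.\<close>

lemma solution_case_3:
  fixes r s u v :: int
  assumes pos: "v > 0" and eq: "int P * r\<^sup>2 + s\<^sup>2 = u\<^sup>2" "int P * r\<^sup>2 - s\<^sup>2 = int q * v\<^sup>2"
    and cop: "coprime (int P * r) s" and odd: "odd u"
  shows "\<exists>Z w y. principal_genus_solution Z w y"
proof -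
  have u8: "u\<^sup>2 mod 8 = 1" using square_mod_8(1)[OF odd] .
  have e1: "((int P * r\<^sup>2) mod 8 + s\<^sup>2 mod 8) mod 8 = 1"
    using u8 unfolding eq(1)[symmetric] by (simp add: mod_add_eq)
  have e2: "((int P * r\<^sup>2) mod 8 - s\<^sup>2 mod 8) mod 8 = (7 * (v\<^sup>2 mod 8)) mod 8"
    using q_square_mod_8[of v] unfolding eq(2)[symmetric] by (simp add: mod_diff_eq)
  note v8 = square_mod_8_cases[of v]
  note s8 = square_mod_8_cases[of s]
  note r8 = square_mod_8_cases[of r]
  have "r\<^sup>2 mod 8 = 0 \<and> s\<^sup>2 mod 8 = 1" using e1 e2 v8 s8 r8 unfolding P_square_mod_8 by (elim disjE) simp_all
  hence par: "even r" "odd s" using square_mod_8[of r] square_mod_8[of s] by auto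
  have cop': "coprime (int P) s" "coprime r s" using cop by simp_all
  obtain a b where ab: "odd a" "even b" "a\<^sup>2 + b\<^sup>2 = int P" using sum_two_squares_P by blast
  have copab: "coprime a b"
  proof -
    have "(gcd a b)\<^sup>2 dvd a\<^sup>2 + b\<^sup>2" by simp
    hence "is_unit (gcd a b)" unfolding ab(3) using squarefree_P squarefreeD by blast
    thus ?thesis by (simp add: coprime_iff_gcd_eq_1)
  qed
  have copaP: "coprime a (int P)"
  proof (rule coprimeI)
    fix c assume c: "c dvd a" "c dvd int P"
    have "c dvd a\<^sup>2 + b\<^sup>2" using c(2) unfolding ab(3) .
    hence "c dvd b\<^sup>2" using c(1) by (simp add: dvd_add_right_iff power2_eq_square)
    moreover have "coprime a (b\<^sup>2)" using copab by simp
    ultimately show "is_unit c" using c(1) coprime_common_divisor by blast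
  qed
  have b0: "b \<noteq> 0"
  proof
    assume "b = 0"
    hence "a\<^sup>2 dvd int P" using ab(3) by simp
    hence "is_unit a" using squarefree_P squarefreeD by blast
    hence "is_unit (int P)" using copaP ab(3) \<open>b = 0\<close> by (metis add.right_neutral is_unit_power_iff power_zero_numeral)
    thus False using P_gt_4 by auto
  qed
  define Z X Y where "Z = s * a + int P * r" and "X = s + r * a" and "Y = v * b"
  have conic: "Z\<^sup>2 = int P * X\<^sup>2 + int q * Y\<^sup>2"
  proof -
    have "Z\<^sup>2 - int P * X\<^sup>2 = (int P - a\<^sup>2) * (int P * r\<^sup>2 - s\<^sup>2)"
      unfolding Z_def X_def by (simp add: power2_eq_square algebra_simps)
    also have "int P - a\<^sup>2 = b\<^sup>2" unfolding ab(3)[symmetric] by simp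
    also have "b\<^sup>2 * (int P * r\<^sup>2 - s\<^sup>2) = int q * Y\<^sup>2"
      unfolding eq(2) Y_def by (simp add: power_mult_distrib)
    finally show ?thesis by simp
  qed
  have oddZ: "odd Z" unfolding Z_def using par ab(1) by simp
  \<comment> \<open>The solution is made primitive by cancelling g; its square divides q Y^2 and q
    is square-free, so g divides \<open>Y\<close>.\<close>
  define g where "g = gcd Z X"
  have g: "g > 0" using oddZ by (auto simp: g_def)
  obtain Z1 X1 where ZX: "Z = Z1 * g" "X = X1 * g" "coprime Z1 X1"
    unfolding g_def using gcd_coprime_exists[of Z X] g by (auto simp: g_def)
  have Y0: "Y \<noteq> 0" using pos b0 by (simp add: Y_def)
  have "int q * Y\<^sup>2 = g\<^sup>2 * (Z1\<^sup>2 - int P * X1\<^sup>2)"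
    using conic unfolding ZX(1,2) by (simp add: power_mult_distrib algebra_simps)
  hence gY: "g\<^sup>2 dvd int q * Y\<^sup>2" by simp
  have "squarefree (int q)" using prime_q by (intro squarefree_prime) simp
  hence "g dvd Y" using gY Y0 by (rule square_dvd_squarefree_mult_square)
  then obtain Y1 where Y1: "Y = Y1 * g" by (metis dvd_def mult.commute)
  have conic1: "Z1\<^sup>2 = int P * X1\<^sup>2 + int q * Y1\<^sup>2"
  proof -
    have "g\<^sup>2 * Z1\<^sup>2 = g\<^sup>2 * (int P * X1\<^sup>2 + int q * Y1\<^sup>2)"
      using conic unfolding ZX(1,2) Y1 by (simp add: power_mult_distrib algebra_simps)
    thus ?thesis using g by simp
  qed
  have odd1: "odd Z1" "odd g" using oddZ unfolding ZX(1) by simp_all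
  have copZP: "coprime Z (int P)"
  proof (rule coprimeI)
    fix c assume c: "c dvd Z" "c dvd int P"
    have "c dvd s * a" using c unfolding Z_def by (metis dvd_add_left_iff dvd_mult2)
    moreover have "coprime (s * a) (int P)" using cop'(1) copaP by (simp add: coprime_commute)
    ultimately show "is_unit c" using c(2) coprime_common_divisor by blast
  qed
  have ndP: "\<not> int l dvd int P" if "prime l" "int l dvd x" "coprime x (int P)" for l x
    using coprime_common_divisor[OF that(3,2)] that(1) by auto
  have JPs: "Jacobi_P s = 1"
  proof (rule Jacobi_P_eq_1[OF par(2)])
    fix l :: nat assume l: "prime l" "l > 2" "int l dvd s"
    have nP: "\<not> int l dvd int P" using ndP[OF l(1,3)] cop'(1) by (simp add: coprime_commute)
    have nr: "\<not> int l dvd r" using coprime_common_divisor[OF cop'(2) _ l(3)] l(1) by auto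
    have "int l dvd s\<^sup>2" using l(3) by (simp add: power2_eq_square)
    hence c: "[int P * r\<^sup>2 = u\<^sup>2] (mod int l)" unfolding eq(1)[symmetric] by (simp add: cong_iff_dvd_diff)
    show "\<not> int l dvd int P \<and> Legendre (int P) (int l) = 1"
      using Legendre_P_eq_1[OF l(1,2) c nP nr] nP by blast
  qed
  have JPa: "Jacobi_P a = 1"
  proof (rule Jacobi_P_eq_1[OF ab(1)])
    fix l :: nat assume l: "prime l" "l > 2" "int l dvd a"
    have nP: "\<not> int l dvd int P" using ndP[OF l(1,3) copaP] .
    have "int l dvd a\<^sup>2" using l(3) by (simp add: power2_eq_square)
    hence c: "[int P * 1\<^sup>2 = b\<^sup>2] (mod int l)" unfolding ab(3)[symmetric] by (simp add: cong_iff_dvd_diff)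
    have "\<not> int l dvd 1" using l(1) by auto
    thus "\<not> int l dvd int P \<and> Legendre (int P) (int l) = 1"
      using Legendre_P_eq_1[OF l(1,2) c nP] nP by blast
  qed
  \<comment> \<open>A prime l dividing g divides r b^2 and s b^2, hence b because r and s are
    coprime; then P = a^2 + b^2 is a^2 modulo l.\<close>
  have JPg: "Jacobi_P g = 1"
  proof (rule Jacobi_P_eq_1[OF odd1(2)])
    fix l :: nat assume l: "prime l" "l > 2" "int l dvd g"
    have lZX: "int l dvd Z" "int l dvd X" using l(3) ZX by simp_all
    have nP: "\<not> int l dvd int P" using ndP[OF l(1) lZX(1) copZP] .
    have "int l dvd Z - a * X" "int l dvd a * Z - int P * X" using lZX by simp_all
    moreover have "Z - a * X = r * b\<^sup>2"
      unfolding Z_def X_def ab(3)[symmetric] by (simp add: power2_eq_square algebra_simps)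
    moreover have "a * Z - int P * X = - (s * b\<^sup>2)"
      unfolding Z_def X_def ab(3)[symmetric] by (simp add: power2_eq_square algebra_simps)
    ultimately have "int l dvd r * b\<^sup>2" "int l dvd s * b\<^sup>2" by simp_all
    hence "int l dvd r \<and> int l dvd s \<or> int l dvd b" using l(1) by (auto simp: prime_dvd_mult_iff prime_dvd_power_iff)
    moreover have "\<not> (int l dvd r \<and> int l dvd s)" using coprime_common_divisor[OF cop'(2), of "int l"] l(1) by auto
    ultimately have ldb: "int l dvd b" by blast
    have "int l dvd b\<^sup>2" using ldb by (simp add: power2_eq_square)
    hence c: "[int P * 1\<^sup>2 = a\<^sup>2] (mod int l)" unfolding ab(3)[symmetric] by (simp add: cong_iff_dvd_diff)
    have "\<not> int l dvd 1" using l(1) by auto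
    thus "\<not> int l dvd int P \<and> Legendre (int P) (int l) = 1"
      using Legendre_P_eq_1[OF l(1,2) c nP] nP by blast
  qed
  \<comment> \<open>The multiple of P in \<open>Z\<close> disappears, and both s and a have symbol
    1.\<close>
  have "Jacobi_P Z = Jacobi_P (s * a)" by (rule Jacobi_P_cong) (simp add: Z_def cong_iff_dvd_diff)
  hence "Jacobi_P Z = 1" unfolding Jacobi_P_mult JPs JPa by simp
  hence JPZ1: "Jacobi_P \<bar>Z1\<bar> = 1" unfolding Jacobi_P_abs using JPg unfolding ZX(1) Jacobi_P_mult by simp
  have "coprime (int P * (2 * X1)) \<bar>Z1\<bar>"
  proof -
    have "coprime Z1 (int P)" using copZP unfolding ZX(1) by simp
    thus ?thesis using ZX(3) odd1(1) by (simp add: coprime_commute)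
  qed
  moreover have "int P * (2 * X1)\<^sup>2 + int q * (2 * Y1)\<^sup>2 = 4 * \<bar>Z1\<bar>\<^sup>2"
    using conic1 by (simp add: power_mult_distrib)
  moreover have "\<bar>Z1\<bar> > 0" "odd \<bar>Z1\<bar>" using odd1(1) by auto
  ultimately show ?thesis unfolding principal_genus_solution_def using JPZ1 by blast
qed

lemma solution_exists:
  assumes "congruent_number (P * q)"
  shows "\<exists>Z w y. principal_genus_solution Z w y"
proof -
  have nn: "int (P * q) = nn" by (simp add: nn_def)
  define Q where "Q m \<longleftrightarrow> m > 0 \<and> (\<exists>a b. primitive_triangle nn (int m) a b)" for m
  obtain m0 a0 b0 where "0 < m0" "primitive_triangle nn m0 a0 b0"
    using primitive_triangle_of_congruent_number[OF assms] squarefree_nn unfolding nn by blast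
  hence "Q (nat m0)" unfolding Q_def by auto
  \<comment> \<open>For the least m the quadruple with \<beta> = n is impossible, since
    \<open>trivial_class_descent\<close> would yield a smaller triangle.\<close>
  define m where "m = (LEAST m. Q m)"
  have "Q m" unfolding m_def using \<open>Q (nat m0)\<close> by (rule LeastI)
  then obtain a b where m: "int m > 0" "primitive_triangle nn (int m) a b" unfolding Q_def by auto
  obtain \<alpha> \<beta> \<gamma> \<delta> r s u v where h: "\<alpha> > 0" "\<beta> > 0" "\<gamma> > 0" "\<delta> > 0" "r > 0" "s > 0" "u > 0" "v > 0"
    "nn = \<alpha> * \<beta> * (\<gamma> * \<delta>)" "int m = r * s * (u * v)"
    "\<alpha> * r\<^sup>2 + \<beta> * s\<^sup>2 = \<gamma> * u\<^sup>2" "\<alpha> * r\<^sup>2 - \<beta> * s\<^sup>2 = \<delta> * v\<^sup>2"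
    "coprime (\<alpha> * r) (\<beta> * s)" "odd (\<gamma> * u)"
    using primitive_triangle_factors[OF squarefree_nn nn_pos m] by blast
  from classification[OF h(1-4,9,11-13)] show ?thesis
  proof (elim disjE conjE)
    assume g: "\<alpha> = 1" "\<beta> = nn" "\<gamma> = 1" "\<delta> = 1"
    have eq: "r\<^sup>2 + nn * s\<^sup>2 = u\<^sup>2" "r\<^sup>2 - nn * s\<^sup>2 = v\<^sup>2" using h(11,12) unfolding g by simp_all
    obtain m' a b where m': "0 < m'" "m' < r * s * (u * v)" "primitive_triangle nn m' a b"
      using trivial_class_descent[OF squarefree_nn nn_pos h(5-8) eq] by blast
    have "Q (nat m')" unfolding Q_def using m' by auto
    moreover have "nat m' < m" using m'(1,2) unfolding h(10)[symmetric] by linarith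
    ultimately show ?thesis using not_less_Least[of "nat m'" Q] unfolding m_def by blast
  next
    assume g: "\<alpha> = 1" "\<beta> = int P" "\<gamma> = 1" "\<delta> = int q"
    show ?thesis by (rule solution_case_1[of r s u v]) (use h(5,11-14) g in simp_all)
  next
    assume g: "\<alpha> = int P" "\<beta> = int q" "\<gamma> = 1" "\<delta> = 1"
    show ?thesis by (rule solution_case_2[of r s u v]) (use h(5-8,11-14) g in simp_all)
  next
    assume g: "\<alpha> = int P" "\<beta> = 1" "\<gamma> = 1" "\<delta> = int q"
    show ?thesis by (rule solution_case_3[of v r s u]) (use h(8,11-14) g in simp_all)
  qed
qed

text \<open>With d the product of the p_j for j in S, these are the local conditions for d x^2 +
  (n/d) y^2 = Z z^2 at the primes of n. At the p_i they form a linear system with matrix A_P and the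
  symbols of Z on the right; it is solvable because these symbols multiply to (Z/P) = 1.\<close>

lemma genus_divisor:
  assumes sol: "principal_genus_solution Z w y"
  obtains S where "S \<subseteq> {..<t}"
    "\<And>i. i < t \<Longrightarrow> i \<notin> S \<Longrightarrow> Legendre ((\<Prod>j\<in>S. int (p j)) * Z) (int (p i)) = 1"
    "\<And>i. i \<in> S \<Longrightarrow> Legendre ((\<Prod>j\<in>{..<t} - S. int (p j)) * int q * Z) (int (p i)) = 1"
    "Legendre ((\<Prod>j\<in>S. int (p j)) * Z) (int q) = 1"
proof -
  have Z: "Z > 0" "odd Z" "coprime (int P * w) Z" "int P * w\<^sup>2 + int q * y\<^sup>2 = 4 * Z\<^sup>2" "Jacobi_P Z = 1"
    using sol by (auto simp: principal_genus_solution_def)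
  have ndZ: "\<not> int (p i) dvd Z" if i: "i < t" for i
  proof
    assume d: "int (p i) dvd Z"
    have "int (p i) dvd int P * w" using p_dvd_P[OF i] by simp
    hence "is_unit (int (p i))" using coprime_common_divisor[OF Z(3)] d by blast
    thus False using prime_p[OF i] by simp
  qed
  have "(\<Prod>i<t. Legendre Z (int (p i))) = (if (\<Sum>i<t. qr_bit i Z) = 0 then 1 else -1)"
    unfolding qr_bit_def using Legendre_pm[OF ndZ] by (intro prod_signs_bit_sum) auto
  hence "(\<Sum>i<t. qr_bit i Z) = 0" using Z(5) unfolding Jacobi_P_def by (auto split: if_splits)
  then obtain S where S: "S \<subseteq> {..<t}" "\<And>i. i < t \<Longrightarrow> (\<Sum>j\<in>S. A i j) = qr_bit i Z"
    using range_of_corank_one[OF rank carrier_A t_pos col_sum] by metis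
  have eq1: "Legendre (x * Z) (int (p i)) = 1" if "i < t" "\<not> int (p i) dvd x" "qr_bit i x = qr_bit i Z" for i x
  proof -
    have "Legendre x (int (p i)) = Legendre Z (int (p i))" using qr_bit_eq_iff that ndZ[OF that(1)] by blast
    thus ?thesis unfolding Legendre_mult[OF prime_p[OF that(1)] p_gt_2[OF that(1)]]
      using Legendre_pm[OF ndZ[OF that(1)]] by auto
  qed
  show thesis
  proof (rule that[OF S(1)])
    fix i assume i: "i < t" "i \<notin> S"
    show "Legendre ((\<Prod>j\<in>S. int (p j)) * Z) (int (p i)) = 1"
      using S(2)[OF i(1)] A_sum_notin[OF i(1) S(1) i(2)] by (intro eq1 i(1) not_dvd_prod_p S(1) i(2)) simp
  next
    fix i assume i: "i \<in> S"
    hence it: "i < t" using S(1) by auto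
    have nd: "\<not> int (p i) dvd (\<Prod>j\<in>{..<t} - S. int (p j))" using i it by (intro not_dvd_prod_p) auto
    have ndq: "\<not> int (p i) dvd int q" by (rule p_not_dvd_q[OF it])
    have "qr_bit i (int q) = 0" using Legendre_q_p[OF it] by (simp add: qr_bit_def)
    hence "qr_bit i ((\<Prod>j\<in>{..<t} - S. int (p j)) * int q) = qr_bit i Z"
      unfolding qr_bit_mult[OF it nd ndq] using S(2)[OF it] A_sum_in[OF it S(1) i] by simp
    moreover have "\<not> int (p i) dvd (\<Prod>j\<in>{..<t} - S. int (p j)) * int q"
      using nd ndq prime_p[OF it] by (simp add: prime_dvd_mult_iff)
    ultimately show "Legendre ((\<Prod>j\<in>{..<t} - S. int (p j)) * int q * Z) (int (p i)) = 1" by (intro eq1 it)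
  next
    \<comment> \<open>For a prime l dividing Z, P w^2 = - q y^2 modulo l, so (P/l) = (-q/l) = (l/q).
      Multiplying over l carries (Z/P) = 1 to (Z/q) = 1.\<close>
    have "Jacobi_P (int (nat Z)) = Legendre (int (nat Z)) (int q)"
    proof (rule Jacobi_P_eq_multiplicative)
      show "nat Z > 0" using Z(1) by simp
      show "Legendre (int 1) (int q) = 1" using Legendre_1[of q] q_gt_2 by simp
      show "Legendre (int (a * b)) (int q) = Legendre (int a) (int q) * Legendre (int b) (int q)" for a b
        using Legendre_mult[OF prime_q q_gt_2] by simp
      fix l assume l: "prime l" "l dvd nat Z"
      have l2: "l > 2" using Z(1,2) by (intro odd_prime_dvd[OF l]) (simp add: even_nat_iff)
      have lZ: "int l dvd Z" using l(2) Z(1) by (simp add: int_dvd_int_iff[symmetric])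
      have "\<not> int l dvd int P * w" using coprime_common_divisor[OF Z(3) _ lZ] l(1) by auto
      hence nd: "\<not> int l dvd int P" "\<not> int l dvd w" by auto
      have "int l dvd 4 * Z\<^sup>2" using lZ by (simp add: power2_eq_square)
      hence c: "[int P * w\<^sup>2 = - int q * y\<^sup>2] (mod int l)"
        unfolding Z(4)[symmetric] by (simp add: cong_iff_dvd_diff)
      have "\<not> int l dvd int P * w\<^sup>2" using nd l(1) by (simp add: prime_dvd_mult_iff prime_dvd_power_iff)
      hence "\<not> int l dvd - int q * y\<^sup>2" using c cong_dvd_iff by blast
      hence nq: "\<not> int l dvd int q" "\<not> int l dvd y" by (auto simp: power2_eq_square)
      have "Jacobi_P (int l) = Legendre (int P) (int l)" by (rule Jacobi_P_prime[OF l(1) l2 nd(1)])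
      also have "\<dots> = Legendre (- int q) (int l)"
        by (rule Legendre_eq_if_square_multiples_cong[OF l(1) l2 c nd(2) nq(2)])
      also have "\<dots> = Legendre (int l) (int q)"
        using nq(1) by (intro Legendre_reciprocal_3[symmetric] prime_q q_gt_2 l(1) l2 q_mod_4) auto
      finally show "Jacobi_P (int l) = Legendre (int l) (int q)" .
    qed
    hence "Legendre Z (int q) = 1" using Z(1,5) by simp
    thus "Legendre ((\<Prod>j\<in>S. int (p j)) * Z) (int q) = 1"
      unfolding Legendre_mult[OF prime_q q_gt_2] Legendre_q_prod[OF S(1)] by simp
  qed
qed

end

section \<open>The ring of integers\<close>

locale imag_quadratic =
  fixes n :: nat
  assumes sqf: "squarefree n" and mod4: "n mod 4 = 3"
begin

definition \<omega> :: complex where "\<omega> = \<i> * complex_of_real (sqrt (real n))"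

text \<open>The denominator 2 is due to n = 3 modulo 4; the integral elements will be those with
  coordinates of equal parity.\<close>

definition elem :: "int \<Rightarrow> int \<Rightarrow> complex" where
  "elem x y = (of_int x + of_int y * \<omega>) / 2"

abbreviation O\<^sub>K :: "complex ring" where "O\<^sub>K \<equiv> ring_of_integers n"

abbreviation integers :: "complex set" (\<open>\<O>\<close>) where "\<O> \<equiv> carrier O\<^sub>K"

lemma n_pos: "n > 0" using mod4 by (cases n) auto

lemma omega_square: "\<omega> * \<omega> = - of_nat n"
proof -
  have "complex_of_real (sqrt (real n)) * complex_of_real (sqrt (real n)) = of_nat n"
    by (simp flip: of_real_mult)
  thus ?thesis unfolding \<omega>_def by (simp add: mult_ac)
qed

lemma cnj_omega [simp]: "cnj \<omega> = - \<omega>" by (simp add: \<omega>_def)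

lemma Re_omega [simp]: "Re \<omega> = 0" and Im_omega: "Im \<omega> = sqrt (real n)"
  by (simp_all add: \<omega>_def)

lemma Im_omega_pos: "Im \<omega> > 0" using n_pos by (simp add: Im_omega)

lemma elem_eq_iff: "elem x y = elem x' y' \<longleftrightarrow> x = x' \<and> y = y'"
  using Im_omega_pos by (auto simp: elem_def complex_eq_iff)

lemma elem_add: "elem x y + elem x' y' = elem (x + x') (y + y')"
  by (simp add: elem_def field_simps)

lemma elem_uminus: "- elem x y = elem (- x) (- y)"
  by (simp add: elem_def field_simps)

lemma elem_cnj: "cnj (elem x y) = elem x (- y)"
  by (simp add: elem_def)

lemma elem_of_int: "elem (2 * x) 0 = of_int x"
  by (simp add: elem_def)

lemma elem_norm: "elem x y * cnj (elem x y) = of_int (x\<^sup>2 + int n * y\<^sup>2) / 4"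
proof -
  have "elem x y * cnj (elem x y) = ((of_int x)\<^sup>2 - (of_int y)\<^sup>2 * (\<omega> * \<omega>)) / 4"
    by (simp add: elem_def power2_eq_square field_simps)
  thus ?thesis by (simp add: omega_square mult.commute)
qed

lemma elem_trace: "elem x y + cnj (elem x y) = of_int x"
  by (simp add: elem_def field_simps)

lemma parity_norm: "even (x + y) \<longleftrightarrow> 4 dvd x\<^sup>2 + int n * y\<^sup>2"
proof -
  obtain k where k: "n = 4 * k + 3" using mod4 by (metis mod_mult_div_eq add.commute)
  have eq: "x\<^sup>2 + int n * y\<^sup>2 = (x + y) * (x - y) + 4 * ((int k + 1) * y\<^sup>2)"
    unfolding k by (simp add: power2_eq_square algebra_simps)
  have "4 dvd x\<^sup>2 + int n * y\<^sup>2 \<longleftrightarrow> 4 dvd (x + y) * (x - y)"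
    unfolding eq by (rule dvd_add_left_iff) simp
  also have "\<dots> \<longleftrightarrow> even (x + y)"
  proof
    assume "4 dvd (x + y) * (x - y)"
    hence "even ((x + y) * (x - y))" by (meson dvd_trans even_numeral)
    thus "even (x + y)" by simp
  next
    assume "even (x + y)"
    moreover from this have "even (x - y)" by simp
    ultimately have "2 * 2 dvd (x + y) * (x - y)" by (rule mult_dvd_mono)
    thus "4 dvd (x + y) * (x - y)" by simp
  qed
  finally show ?thesis by simp
qed

text \<open>If \<open>z\<close> is integral, all its powers lie in \<open>(1/D)(\<int> + \<int> \<omega>)\<close> for a fixed \<open>D\<close>, so the powers of
  the rational number \<open>z cnj z\<close> have the bounded denominator \<open>4 D\<^sup>2\<close>.\<close>

lemma powers_bounded_denominator:
  fixes z :: complex and m :: nat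
  assumes mod: "z ^ m \<in> {\<Sum>i<m. of_int (c i) * z ^ i |c. True}" and D: "\<And>i. i < m \<Longrightarrow> \<exists>x y. of_int D * z ^ i = elem x y"
  shows "\<exists>x y. of_int D * z ^ k = elem x y"
proof (induction k rule: less_induct)
  case (less k)
  show ?case
  proof (cases "k < m")
    case False
    obtain c where c: "z ^ m = (\<Sum>i<m. of_int (c i) * z ^ i)" using mod by auto
    have "\<exists>x y. of_int D * z ^ (i + (k - m)) = elem x y" if "i < m" for i
      using less[of "i + (k - m)"] that False by auto
    then obtain X Y where XY: "\<And>i. i < m \<Longrightarrow> of_int D * z ^ (i + (k - m)) = elem (X i) (Y i)" by metis
    have "of_int D * z ^ k = of_int D * (z ^ m * z ^ (k - m))"
      using False by (simp flip: power_add)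
    also have "\<dots> = (\<Sum>i<m. of_int (c i) * (of_int D * z ^ (i + (k - m))))"
      unfolding c sum_distrib_right sum_distrib_left by (intro sum.cong) (auto simp: power_add)
    also have "\<dots> = (\<Sum>i<m. elem (c i * X i) (c i * Y i))"
      by (intro sum.cong) (auto simp: XY elem_def field_simps)
    also have "\<dots> = elem (\<Sum>i<m. c i * X i) (\<Sum>i<m. c i * Y i)"
      by (induction m) (auto simp: elem_add elem_def[of 0 0])
    finally show ?thesis by blast
  qed (use D in auto)
qed

text \<open>Every power of the denominator of r divides D, while 2^|D| exceeds |D|.\<close>

lemma int_of_bounded_denominator:
  fixes r :: rat and D :: int
  assumes "D \<noteq> 0" and "\<And>k. of_int D * r ^ k \<in> \<int>"
  shows "r \<in> \<int>"
proof -
  obtain a b where ab: "r = of_int a / of_int b" "b > 0" "coprime a b"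
    by (metis quotient_of_coprime quotient_of_denom_pos quotient_of_div surjective_pairing)
  have dvd: "b ^ k dvd D" for k
  proof -
    obtain N where "of_int D * r ^ k = of_int N" using assms(2)[of k] by (auto elim: Ints_cases)
    hence "(of_int (D * a ^ k) :: rat) = of_int (N * b ^ k)"
      using ab(2) by (simp add: ab(1) field_simps)
    hence "D * a ^ k = N * b ^ k" by (simp only: of_int_eq_iff)
    hence "b ^ k dvd D * a ^ k" by simp
    moreover have "coprime (b ^ k) (a ^ k)" using ab(3) by (simp add: coprime_commute)
    ultimately show ?thesis by (simp add: coprime_dvd_mult_left_iff)
  qed
  have "b = 1"
  proof (rule ccontr)
    assume "b \<noteq> 1"
    hence "b \<ge> 2" using ab(2) by simp
    hence "2 ^ nat \<bar>D\<bar> \<le> b ^ nat \<bar>D\<bar>" by (intro power_mono) auto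
    also have "\<dots> \<le> \<bar>D\<bar>" using dvd_imp_le_int[OF assms(1) dvd[of "nat \<bar>D\<bar>"]] ab(2) by simp
    finally have "(2::int) ^ nat \<bar>D\<bar> \<le> \<bar>D\<bar>" .
    moreover have "int (nat \<bar>D\<bar>) < 2 ^ nat \<bar>D\<bar>"
      using of_nat_less_two_power[where 'a=int] by blast
    ultimately show False by simp
  qed
  thus ?thesis using ab by simp
qed

lemma algebraic_int_bounded_denominator:
  assumes "algebraic_int z" and z: "z = of_rat a + of_rat b * \<omega>"
  obtains D where "D > 0" "\<And>k. \<exists>x y. of_int D * z ^ k = elem x y"
proof -
  obtain p :: "int poly" where p: "lead_coeff p = 1" "poly (map_poly of_int p) z = 0"
    using assms(1) by (auto simp: algebraic_int_altdef_ipoly)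
  define m where "m = degree p"
  obtain a1 a2 where a: "a2 > 0" "a = of_int a1 / of_int a2"
    by (metis quotient_of_denom_pos' quotient_of_div surjective_pairing)
  obtain b1 b2 where b: "b2 > 0" "b = of_int b1 / of_int b2"
    by (metis quotient_of_denom_pos' quotient_of_div surjective_pairing)
  define E where "E = a2 * b2"
  have E: "E > 0" using a b by (simp add: E_def)
  have "a * of_int a2 = of_int a1" "b * of_int b2 = of_int b1" using a b by simp_all
  hence "of_rat (a * of_int a2) = (of_rat (of_int a1) :: complex)"
    "of_rat (b * of_int b2) = (of_rat (of_int b1) :: complex)" by simp_all
  hence ab: "of_rat a * of_int a2 = (of_int a1 :: complex)" "of_rat b * of_int b2 = (of_int b1 :: complex)"
    by (simp_all add: of_rat_mult)
  have "of_int E * z = (of_rat a * of_int a2) * of_int b2 + of_int a2 * (of_rat b * of_int b2) * \<omega>"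
    unfolding z E_def by (simp add: algebra_simps)
  hence zE: "of_int E * z = of_int (a1 * b2) + of_int (a2 * b1) * \<omega>"
    unfolding ab by simp
  have lin: "\<exists>x y. (of_int E * z) ^ i = of_int x + of_int y * \<omega>" for i
  proof (induction i)
    case 0
    show ?case by (rule exI[of _ 1], rule exI[of _ 0]) simp
  next
    case (Suc i)
    then obtain x y where xy: "(of_int E * z) ^ i = of_int x + of_int y * \<omega>" by blast
    have "(of_int E * z) ^ Suc i = of_int (a1 * b2 * x) + of_int (a1 * b2 * y + a2 * b1 * x) * \<omega>
        + of_int (a2 * b1 * y) * (\<omega> * \<omega>)"
      by (simp only: power_Suc xy) (simp only: zE of_int_add of_int_mult, simp add: algebra_simps)
    also have "\<dots> = of_int (a1 * b2 * x - a2 * b1 * y * int n) + of_int (a1 * b2 * y + a2 * b1 * x) * \<omega>"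
      by (simp add: omega_square algebra_simps)
    finally show ?case by blast
  qed
  have "z ^ m \<in> {\<Sum>i<m. of_int (c i) * z ^ i |c. True}"
  proof -
    have "0 = (\<Sum>i\<le>m. of_int (coeff p i) * z ^ i)"
      using p(2) by (simp add: poly_altdef m_def coeff_map_poly degree_map_poly)
    also have "\<dots> = (\<Sum>i<m. of_int (coeff p i) * z ^ i) + z ^ m"
      using p(1) by (simp add: m_def lessThan_Suc_atMost[symmetric])
    finally have "z ^ m = (\<Sum>i<m. of_int (- coeff p i) * z ^ i)"
      by (simp add: sum_negf eq_neg_iff_add_eq_0 add.commute)
    thus ?thesis by (intro CollectI exI[of _ "\<lambda>i. - coeff p i"] conjI TrueI)
  qed
  \<comment> \<open>\<open>E\<close> clears the denominator of z, so \<open>E ^ m\<close> clears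
    those of all powers of z below m.\<close>
  moreover have "\<exists>x y. of_int (E ^ m) * z ^ i = elem x y" if "i < m" for i
  proof -
    obtain x y where xy: "(of_int E * z) ^ i = of_int x + of_int y * \<omega>" using lin by blast
    have "of_int (E ^ m) * z ^ i = of_int (E ^ (m - i)) * (of_int E * z) ^ i"
      using that by (simp add: power_mult_distrib flip: power_add mult.assoc)
    also have "\<dots> = elem (2 * E ^ (m - i) * x) (2 * E ^ (m - i) * y)"
      unfolding xy by (simp add: elem_def field_simps)
    finally show ?thesis by blast
  qed
  ultimately show thesis
    using that[of "E ^ m"] powers_bounded_denominator[of z m "E ^ m"] E by auto
qed

text \<open>Equal parity makes X^2 - x X + N a polynomial over the integers. Conversely, the norms
  of z and z + 1 are rational with powers of bounded denominator, hence integers; they give 2 a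
  integral, and then square-freeness of n gives 2 b integral.\<close>

lemma carrier_iff: "z \<in> \<O> \<longleftrightarrow> (\<exists>x y. even (x + y) \<and> z = elem x y)"
proof
  assume "\<exists>x y. even (x + y) \<and> z = elem x y"
  then obtain x y where xy: "even (x + y)" "z = elem x y" by blast
  obtain N where N: "x\<^sup>2 + int n * y\<^sup>2 = 4 * N" using xy(1) unfolding parity_norm by blast
  have norm: "of_int N = z * cnj z" unfolding xy(2) elem_norm N by simp
  have trace: "of_int x = z + cnj z" unfolding xy(2) elem_trace ..
  have "poly (map_poly of_int [:N, - x, 1:]) z = of_int N + z * (z - of_int x)"
    by (simp add: map_poly_pCons algebra_simps)
  also have "\<dots> = 0" unfolding norm trace by (simp add: algebra_simps)
  finally have "poly (map_poly of_int [:N, - x, 1:]) z = 0" .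
  hence "algebraic_int z"
    unfolding algebraic_int_altdef_ipoly by (intro exI[of _ "[:N, - x, 1:]"]) auto
  moreover have "z = of_rat (of_int x / 2) + of_rat (of_int y / 2) * \<omega>"
    unfolding xy(2) elem_def by (simp add: of_rat_divide field_simps)
  ultimately show "z \<in> \<O>"
    unfolding ring_of_integers_def imag_quadratic_field_def \<omega>_def by auto
next
  assume "z \<in> \<O>"
  then obtain a b where z: "z = of_rat a + of_rat b * \<omega>" and int: "algebraic_int z"
    unfolding ring_of_integers_def imag_quadratic_field_def \<omega>_def by auto
  obtain D where D: "D > 0" "\<And>k. \<exists>x y. of_int D * z ^ k = elem x y"
    using algebraic_int_bounded_denominator[OF int z] by blast
  \<comment> \<open>The norm of z + j; the trace is recovered as
    \<open>R 1 - R 0 - 1\<close>.\<close>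
  define R where "R j = (a + of_int j)\<^sup>2 + of_nat n * b\<^sup>2" for j :: int
  have R: "(z + of_int j) * cnj (z + of_int j) = of_rat (R j)" for j
  proof -
    have cr: "cnj (of_rat q) = of_rat q" for q
      by (induction q) (simp add: of_rat_rat)
    have "(z + of_int j) * cnj (z + of_int j) =
        (of_rat a + of_int j)\<^sup>2 - (of_rat b)\<^sup>2 * (\<omega> * \<omega>)"
      unfolding z by (simp add: cr power2_eq_square algebra_simps)
    thus ?thesis unfolding omega_square R_def
      by (simp add: of_rat_add of_rat_mult of_rat_power algebra_simps)
  qed
  have Rint: "R j \<in> \<int>" for j
  proof (rule int_of_bounded_denominator)
    show "4 * D\<^sup>2 \<noteq> 0" using D by simp
    fix k
    \<comment> \<open>By the binomial theorem, translation by an integer keeps the common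
      denominator \<open>D\<close>.\<close>
    have "\<forall>k. \<exists>x y. of_int D * (z + of_int j) ^ k = elem x y"
    proof
      fix k
      obtain X Y where XY: "\<And>i. of_int D * z ^ i = elem (X i) (Y i)" using D(2) by metis
      have "of_int D * (z + of_int j) ^ k = (\<Sum>i\<le>k. of_int (int (k choose i) * j ^ (k - i)) * (of_int D * z ^ i))"
        unfolding binomial_ring sum_distrib_left by (intro sum.cong) auto
      also have "\<dots> = elem (\<Sum>i\<le>k. int (k choose i) * j ^ (k - i) * X i) (\<Sum>i\<le>k. int (k choose i) * j ^ (k - i) * Y i)"
        unfolding XY by (simp add: elem_def sum_distrib_left sum_distrib_right sum.distrib add_divide_distrib
            sum_divide_distrib algebra_simps)
      finally show "\<exists>x y. of_int D * (z + of_int j) ^ k = elem x y" by blast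
    qed
    then obtain x y where xy: "of_int D * (z + of_int j) ^ k = elem x y" by blast
    have "of_int (x\<^sup>2 + int n * y\<^sup>2) = 4 * (elem x y * cnj (elem x y))"
      by (simp add: elem_norm)
    also have "\<dots> = 4 * (of_int D)\<^sup>2 * ((z + of_int j) * cnj (z + of_int j)) ^ k"
      unfolding xy[symmetric] by (simp add: power2_eq_square power_mult_distrib)
    also have "\<dots> = of_rat (of_int (4 * D\<^sup>2) * R j ^ k)"
      unfolding R by (simp add: of_rat_mult of_rat_power)
    finally have "of_int (x\<^sup>2 + int n * y\<^sup>2) = (of_rat (of_int (4 * D\<^sup>2) * R j ^ k) :: complex)" .
    hence "of_rat (of_int (4 * D\<^sup>2) * R j ^ k) = (of_rat (of_int (x\<^sup>2 + int n * y\<^sup>2)) :: complex)"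
      unfolding of_rat_of_int_eq by (rule sym)
    hence "of_int (4 * D\<^sup>2) * R j ^ k = of_int (x\<^sup>2 + int n * y\<^sup>2)"
      by (simp only: of_rat_eq_iff)
    thus "of_int (4 * D\<^sup>2) * R j ^ k \<in> \<int>" by (metis Ints_of_int)
  qed
  obtain N where N: "a\<^sup>2 + of_nat n * b\<^sup>2 = of_int N"
    using Rint[of 0] by (auto simp: R_def elim: Ints_cases)
  have "2 * a = R 1 - R 0 - 1" by (simp add: R_def power2_eq_square algebra_simps)
  hence "2 * a \<in> \<int>" using Rint by (metis Ints_1 Ints_diff)
  then obtain x where x: "2 * a = of_int x" by (auto elim: Ints_cases)
  have xa: "a = of_int x / 2" using x by simp
  obtain b1 b2 where b: "2 * b = of_int b1 / of_int b2" "b2 > 0" "coprime b1 b2"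
    by (metis quotient_of_coprime quotient_of_denom_pos quotient_of_div surjective_pairing)
  have nb: "of_nat n * (2 * b)\<^sup>2 = of_int (4 * N - x\<^sup>2)"
    using N unfolding xa by (simp add: power2_eq_square field_simps)
  have "(of_int (int n * b1\<^sup>2) :: rat) = of_int ((4 * N - x\<^sup>2) * b2\<^sup>2)"
    using nb b(2) unfolding b(1) by (simp add: power_divide field_simps)
  hence "int n * b1\<^sup>2 = (4 * N - x\<^sup>2) * b2\<^sup>2" by (simp only: of_int_eq_iff)
  hence "b2\<^sup>2 dvd int n * b1\<^sup>2" by simp
  moreover have "coprime (b2\<^sup>2) (b1\<^sup>2)" using b(3) by (simp add: coprime_commute)
  ultimately have "b2\<^sup>2 dvd int n" by (simp add: coprime_dvd_mult_left_iff)
  hence "b2 dvd 1" using sqf squarefree_int_iff squarefreeD by blast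
  hence "b2 = 1" using b(2) by simp
  hence y: "2 * b = of_int b1" using b by simp
  hence yb: "b = of_int b1 / 2" by simp
  have "(of_int (x\<^sup>2 + int n * b1\<^sup>2) :: rat) = of_int (4 * N)"
    using N unfolding xa yb by (simp add: power2_eq_square field_simps)
  hence "x\<^sup>2 + int n * b1\<^sup>2 = 4 * N" by (simp only: of_int_eq_iff)
  hence "even (x + b1)" unfolding parity_norm by simp
  moreover have "z = elem x b1" unfolding z xa yb elem_def by (simp add: of_rat_divide field_simps)
  ultimately show "\<exists>x y. even (x + y) \<and> z = elem x y" by blast
qed

lemma carrier_add: "a \<in> \<O> \<Longrightarrow> b \<in> \<O> \<Longrightarrow> a + b \<in> \<O>"
  unfolding carrier_iff
proof (elim exE conjE)
  fix x y x' y' assume h: "even (x + y)" "a = elem x y" "even (x' + y')" "b = elem x' y'"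
  have "even ((x + x') + (y + y'))" using h(1,3) by presburger
  thus "\<exists>x y. even (x + y) \<and> a + b = elem x y" unfolding h(2,4) elem_add by blast
qed

lemma carrier_uminus: "a \<in> \<O> \<Longrightarrow> - a \<in> \<O>"
  unfolding carrier_iff
proof (elim exE conjE)
  fix x y assume h: "even (x + y)" "a = elem x y"
  have "even (- x + - y)" using h(1) by presburger
  thus "\<exists>x y. even (x + y) \<and> - a = elem x y" unfolding h(2) elem_uminus by blast
qed

lemma carrier_cnj: "a \<in> \<O> \<Longrightarrow> cnj a \<in> \<O>"
  unfolding carrier_iff
proof (elim exE conjE)
  fix x y assume h: "even (x + y)" "a = elem x y"
  have "even (x + - y)" using h(1) by presburger
  thus "\<exists>x y. even (x + y) \<and> cnj a = elem x y" unfolding h(2) elem_cnj by blast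
qed

lemma carrier_mult: "a \<in> \<O> \<Longrightarrow> b \<in> \<O> \<Longrightarrow> a * b \<in> \<O>"
  unfolding carrier_iff
proof (elim exE conjE)
  fix x y x' y' assume h: "even (x + y)" "a = elem x y" "even (x' + y')" "b = elem x' y'"
  obtain i where i: "y = 2 * i - x" using h(1) by (metis dvd_def add_diff_cancel_left')
  obtain j where j: "y' = 2 * j - x'" using h(3) by (metis dvd_def add_diff_cancel_left')
  obtain k where k: "n = 4 * k + 3" using mod4 by (metis mod_mult_div_eq add.commute)
  have "\<exists>u v. x * x' - int n * y * y' = 2 * u \<and> x * y' + y * x' = 2 * v \<and> even (u + v)"
  proof -
    have "x * x' - y * y' = 2 * (x * j + x' * i - 2 * (i * j))"
      unfolding i j by (simp add: algebra_simps)
    moreover have "int n * y * y' = y * y' + 2 * ((2 * int k + 1) * y * y')"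
      unfolding k by (simp add: algebra_simps)
    ultimately have p: "x * x' - int n * y * y' = 2 * (x * j + x' * i - 2 * (i * j) - (2 * int k + 1) * y * y')"
      by (simp add: algebra_simps)
    have q: "x * y' + y * x' = 2 * (x * j + x' * i - x * x')"
      unfolding i j by (simp add: algebra_simps)
    have "even ((x * j + x' * i - 2 * (i * j) - (2 * int k + 1) * y * y') + (x * j + x' * i - x * x'))"
      unfolding i j by (simp add: algebra_simps)
    thus ?thesis using p q by blast
  qed
  then obtain u v where uv: "x * x' - int n * y * y' = 2 * u" "x * y' + y * x' = 2 * v" "even (u + v)" by blast
  have "4 * (a * b) = of_int (x * x') + of_int (x * y' + y * x') * \<omega> + of_int (y * y') * (\<omega> * \<omega>)"
    unfolding h(2,4) elem_def by (simp add: field_simps)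
  also have "\<dots> = of_int (x * x' - int n * y * y') + of_int (x * y' + y * x') * \<omega>"
    unfolding omega_square by (simp add: algebra_simps)
  also have "\<dots> = 4 * elem u v" unfolding uv elem_def by simp
  finally have "a * b = elem u v" by simp
  thus "\<exists>x y. even (x + y) \<and> a * b = elem x y" using uv(3) by blast
qed

lemma carrier_of_int: "of_int x \<in> \<O>"
  unfolding carrier_iff by (intro exI[of _ "2 * x"] exI[of _ 0]) (simp add: elem_of_int)

lemma carrier_omega: "\<omega> \<in> \<O>"
  unfolding carrier_iff by (intro exI[of _ 0] exI[of _ 2]) (simp add: elem_def)

lemma carrier_0: "0 \<in> \<O>" and carrier_1: "1 \<in> \<O>"
  using carrier_of_int[of 0] carrier_of_int[of 1] by simp_all

lemma cring_O: "cring O\<^sub>K"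
proof (rule cringI)
  show "abelian_group O\<^sub>K"
  proof (rule abelian_groupI)
    fix x assume "x \<in> \<O>"
    thus "\<exists>y\<in>\<O>. y \<oplus>\<^bsub>O\<^sub>K\<^esub> x = \<zero>\<^bsub>O\<^sub>K\<^esub>"
      by (intro bexI[of _ "- x"]) (auto simp: carrier_uminus ring_of_integers_def[of n, THEN arg_cong[of _ _ add]]
        ring_of_integers_def[of n, THEN arg_cong[of _ _ zero]])
  qed (auto simp: ring_of_integers_def[of n, THEN arg_cong[of _ _ add]]
        ring_of_integers_def[of n, THEN arg_cong[of _ _ zero]] carrier_add carrier_0)
  show "Group.comm_monoid O\<^sub>K"
    by (rule comm_monoidI) (auto simp: ring_of_integers_def[of n, THEN arg_cong[of _ _ monoid.mult]]
        ring_of_integers_def[of n, THEN arg_cong[of _ _ one]] carrier_mult carrier_1)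
qed (auto simp: ring_of_integers_def[of n, THEN arg_cong[of _ _ add]]
        ring_of_integers_def[of n, THEN arg_cong[of _ _ monoid.mult]] algebra_simps)

end

section \<open>Ideals\<close>

lemma int_subgroup_generator:
  fixes S :: "int set"
  assumes "\<And>a b. a \<in> S \<Longrightarrow> b \<in> S \<Longrightarrow> a - b \<in> S" "c \<in> S" "c > 0"
  obtains g where "g > 0" "g \<in> S" "\<And>k. k \<in> S \<Longrightarrow> g dvd k"
proof -
  define m where "m = (LEAST m. m > 0 \<and> int m \<in> S)"
  have ex: "nat c > 0 \<and> int (nat c) \<in> S" using assms by simp
  have m: "m > 0" "int m \<in> S"
    using LeastI[of "\<lambda>m. m > 0 \<and> int m \<in> S", OF ex] by (simp_all add: m_def)
  have 0: "0 \<in> S" using assms(1)[OF assms(2,2)] by simp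
  have uminus: "- a \<in> S" if "a \<in> S" for a using assms(1)[OF 0 that] by simp
  have plus: "a + b \<in> S" if "a \<in> S" "b \<in> S" for a b
    using assms(1)[OF that(1) uminus[OF that(2)]] by simp
  have nat_mult: "int j * a \<in> S" if "a \<in> S" for j a
    by (induction j) (auto simp: 0 distrib_right intro: plus that)
  have mult: "j * a \<in> S" if "a \<in> S" for j a
    using nat_mult[OF that, of "nat j"] uminus[OF nat_mult[OF that, of "nat (- j)"]]
    by (cases "j \<ge> 0") auto
  have "int m dvd k" if "k \<in> S" for k
  proof -
    have "k mod int m \<in> S"
      using assms(1)[OF that mult[OF m(2), of "k div int m"]] by (simp add: minus_div_mult_eq_mod)
    moreover have "0 \<le> k mod int m" "nat (k mod int m) < m" using m by (simp_all add: nat_less_iff)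
    ultimately have "\<not> 0 < k mod int m"
      using not_less_Least[of "nat (k mod int m)" "\<lambda>m. m > 0 \<and> int m \<in> S"]
      unfolding m_def[symmetric] by auto
    hence "k mod int m = 0" using \<open>0 \<le> k mod int m\<close> by linarith
    thus ?thesis by (simp add: dvd_eq_mod_eq_0)
  qed
  thus thesis using that[of "int m"] m by simp
qed

context imag_quadratic
begin

lemma ring_ops [simp]:
  "x \<otimes>\<^bsub>O\<^sub>K\<^esub> y = x * y" "x \<oplus>\<^bsub>O\<^sub>K\<^esub> y = x + y" "\<one>\<^bsub>O\<^sub>K\<^esub> = 1" "\<zero>\<^bsub>O\<^sub>K\<^esub> = 0"
  by (simp_all add: ring_of_integers_def)

lemma ring_O: "ring O\<^sub>K" using cring_O by (rule cring.axioms(1))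

lemma ideal_iff:
  "ideal I O\<^sub>K \<longleftrightarrow> I \<subseteq> \<O> \<and> 0 \<in> I \<and> (\<forall>x\<in>I. \<forall>y\<in>I. x + y \<in> I) \<and>
     (\<forall>a\<in>\<O>. \<forall>x\<in>I. a * x \<in> I)"
proof
  assume I: "ideal I O\<^sub>K"
  interpret I: ideal I O\<^sub>K by (rule I)
  show "I \<subseteq> \<O> \<and> 0 \<in> I \<and> (\<forall>x\<in>I. \<forall>y\<in>I. x + y \<in> I) \<and>
     (\<forall>a\<in>\<O>. \<forall>x\<in>I. a * x \<in> I)"
    using I.a_subset additive_subgroup.zero_closed[OF ideal.axioms(1)[OF I]]
      additive_subgroup.a_closed[OF ideal.axioms(1)[OF I]] I.I_l_closed by auto
next
  assume I: "I \<subseteq> \<O> \<and> 0 \<in> I \<and> (\<forall>x\<in>I. \<forall>y\<in>I. x + y \<in> I) \<and>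
     (\<forall>a\<in>\<O>. \<forall>x\<in>I. a * x \<in> I)"
  interpret cring O\<^sub>K by (rule cring_O)
  have minus: "\<ominus>\<^bsub>O\<^sub>K\<^esub> x = - x" if "x \<in> \<O>" for x
    using minus_equality[of "- x" x] that carrier_uminus by simp
  show "ideal I O\<^sub>K"
  proof (rule idealI[OF ring_O])
    show "subgroup I (add_monoid O\<^sub>K)"
    proof (rule group.subgroupI[OF a_group])
      fix x assume x: "x \<in> I"
      hence xc: "x \<in> \<O>" using I by blast
      have "- x \<in> I" using I x carrier_uminus[OF carrier_1] by force
      thus "inv\<^bsub>add_monoid O\<^sub>K\<^esub> x \<in> I" using minus[OF xc] by (simp add: a_inv_def)
    qed (use I in auto)
  next
    fix a x assume "a \<in> I" "x \<in> \<O>"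
    hence "x * a \<in> I" using I by blast
    thus "x \<otimes>\<^bsub>O\<^sub>K\<^esub> a \<in> I" "a \<otimes>\<^bsub>O\<^sub>K\<^esub> x \<in> I" by (simp_all add: mult.commute)
  qed
qed

lemma idealD:
  assumes "ideal I O\<^sub>K"
  shows "x \<in> I \<Longrightarrow> x \<in> \<O>" "0 \<in> I" "x \<in> I \<Longrightarrow> y \<in> I \<Longrightarrow> x + y \<in> I"
    "a \<in> \<O> \<Longrightarrow> x \<in> I \<Longrightarrow> a * x \<in> I" "a \<in> \<O> \<Longrightarrow> x \<in> I \<Longrightarrow> x * a \<in> I"
    "x \<in> I \<Longrightarrow> - x \<in> I" "x \<in> I \<Longrightarrow> y \<in> I \<Longrightarrow> x - y \<in> I"
proof -
  show *: "x \<in> I \<Longrightarrow> x \<in> \<O>" "0 \<in> I" "x \<in> I \<Longrightarrow> y \<in> I \<Longrightarrow> x + y \<in> I"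
    "a \<in> \<O> \<Longrightarrow> x \<in> I \<Longrightarrow> a * x \<in> I" for x y a
    using assms unfolding ideal_iff by blast+
  show "a \<in> \<O> \<Longrightarrow> x \<in> I \<Longrightarrow> x * a \<in> I" using *(4) by (simp add: mult.commute)
  show neg: "x \<in> I \<Longrightarrow> - x \<in> I" for x using *(4)[of "-1" x] carrier_uminus[OF carrier_1] by simp
  show "x \<in> I \<Longrightarrow> y \<in> I \<Longrightarrow> x - y \<in> I" using *(3)[of x "- y"] neg[of y] by simp
qed

section \<open>Products, multiples and conjugates of ideals\<close>

abbreviation ideal_mult :: "complex set \<Rightarrow> complex set \<Rightarrow> complex set" (infixl "\<star>" 70) where
  "I \<star> J \<equiv> ideal_prod O\<^sub>K I J"

abbreviation scale :: "complex \<Rightarrow> complex set \<Rightarrow> complex set" (infixr "\<diamondop>" 75) where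
  "a \<diamondop> I \<equiv> (\<lambda>x. a * x) ` I"

abbreviation principal :: "complex \<Rightarrow> complex set" where
  "principal a \<equiv> a \<diamondop> \<O>"

lemma mult_memI: "x \<in> I \<Longrightarrow> y \<in> J \<Longrightarrow> x * y \<in> I \<star> J"
  using ideal_prod.prod[of x I y J O\<^sub>K] by simp

lemma mult_subsetI:
  assumes "\<And>x y. x \<in> I \<Longrightarrow> y \<in> J \<Longrightarrow> x * y \<in> K" "\<And>x y. x \<in> K \<Longrightarrow> y \<in> K \<Longrightarrow> x + y \<in> K"
  shows "I \<star> J \<subseteq> K"
proof
  fix x assume "x \<in> I \<star> J"
  thus "x \<in> K" by induction (use assms in auto)
qed

lemma ideal_carrier: "ideal (\<O>) O\<^sub>K"
  unfolding ideal_iff using carrier_0 carrier_add carrier_mult by blast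

lemmas ideal_mult_ideal = ring.ideal_prod_is_ideal[OF ring_O]
lemmas ideal_mult_assoc = ring.ideal_prod_assoc[OF ring_O]
lemmas ideal_mult_commute = cring.ideal_prod_commute[OF cring_O]

lemma ideal_mult_one: "ideal I O\<^sub>K \<Longrightarrow> \<O> \<star> I = I"
  using ring.ideal_prod_one[OF ring_O, of I] ideal_mult_commute[OF ideal_carrier] by simp

lemma ideal_scale:
  assumes "ideal I O\<^sub>K" "a \<in> \<O>"
  shows "ideal (a \<diamondop> I) O\<^sub>K"
  unfolding ideal_iff
proof (intro conjI ballI)
  show "a \<diamondop> I \<subseteq> \<O>" using idealD(1)[OF assms(1)] assms(2) carrier_mult by auto
  show "0 \<in> a \<diamondop> I" using idealD(2)[OF assms(1)] by (intro image_eqI[of _ _ 0]) auto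
next
  fix x y assume "x \<in> a \<diamondop> I" "y \<in> a \<diamondop> I"
  then obtain u v where "u \<in> I" "v \<in> I" "x = a * u" "y = a * v" by blast
  thus "x + y \<in> a \<diamondop> I" using idealD(3)[OF assms(1)]
    by (intro image_eqI[of _ _ "u + v"]) (auto simp: distrib_left)
next
  fix b x assume "b \<in> \<O>" "x \<in> a \<diamondop> I"
  then obtain u where "u \<in> I" "x = a * u" "b \<in> \<O>" by blast
  thus "b * x \<in> a \<diamondop> I" using idealD(4)[OF assms(1)]
    by (intro image_eqI[of _ _ "b * u"]) (auto simp: mult_ac)
qed

lemma ideal_principal: "a \<in> \<O> \<Longrightarrow> ideal (principal a) O\<^sub>K"
  by (rule ideal_scale[OF ideal_carrier])

lemma scale_scale: "a \<diamondop> b \<diamondop> I = (a * b) \<diamondop> I"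
  by (auto simp: image_image mult.assoc)

lemma scale_commute: "a \<diamondop> b \<diamondop> I = b \<diamondop> a \<diamondop> I"
  unfolding scale_scale by (subst mult.commute) (rule refl)

lemma scale_cancel: "a \<noteq> 0 \<Longrightarrow> a \<diamondop> I = a \<diamondop> J \<longleftrightarrow> I = J"
  by (rule inj_image_eq_iff) (auto simp: inj_def)

lemma scale_mult: "(a \<diamondop> I) \<star> J = a \<diamondop> (I \<star> J)"
proof (rule equalityI)
  show "(a \<diamondop> I) \<star> J \<subseteq> a \<diamondop> (I \<star> J)"
  proof (rule mult_subsetI)
    fix x y assume "x \<in> a \<diamondop> I" "y \<in> J"
    thus "x * y \<in> a \<diamondop> (I \<star> J)" by (auto simp: mult.assoc intro: mult_memI)
  next
    fix x y assume "x \<in> a \<diamondop> (I \<star> J)" "y \<in> a \<diamondop> (I \<star> J)"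
    then obtain u v where "u \<in> I \<star> J" "v \<in> I \<star> J" "x = a * u" "y = a * v" by blast
    thus "x + y \<in> a \<diamondop> (I \<star> J)" using ideal_prod.sum[of u O\<^sub>K I J v]
      by (intro image_eqI[of _ _ "u + v"]) (auto simp: distrib_left)
  qed
  show "a \<diamondop> (I \<star> J) \<subseteq> (a \<diamondop> I) \<star> J"
  proof
    fix z assume "z \<in> a \<diamondop> (I \<star> J)"
    then obtain w where w: "w \<in> I \<star> J" "z = a * w" by blast
    have "a * w \<in> (a \<diamondop> I) \<star> J" using w(1)
    proof induction
      case (prod i j)
      thus ?case using mult_memI[OF imageI[OF prod(1), of "\<lambda>x. a * x"] prod(2)] by (simp add: mult.assoc)
    next
      case (sum s1 s2)
      thus ?case using ideal_prod.sum[of "a * s1" O\<^sub>K "a \<diamondop> I" J "a * s2"] by (simp add: distrib_left)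
    qed
    thus "z \<in> (a \<diamondop> I) \<star> J" using w by simp
  qed
qed

lemma principal_mult: "ideal I O\<^sub>K \<Longrightarrow> principal a \<star> I = a \<diamondop> I"
  by (simp add: scale_mult ideal_mult_one)

lemma mult_scale:
  assumes "ideal I O\<^sub>K" "ideal J O\<^sub>K" "a \<in> \<O>"
  shows "I \<star> (a \<diamondop> J) = a \<diamondop> (I \<star> J)"
  using assms by (simp add: ideal_mult_commute[OF assms(1) ideal_scale] scale_mult ideal_mult_commute)

lemma mem_principal_self: "a \<in> principal a"
  using carrier_1 by (intro image_eqI[of _ _ 1]) auto

lemma ideal_cnj:
  assumes "ideal I O\<^sub>K"
  shows "ideal (cnj ` I) O\<^sub>K"
  unfolding ideal_iff
proof (intro conjI ballI)
  show "cnj ` I \<subseteq> \<O>" using idealD(1)[OF assms] carrier_cnj by auto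
  show "0 \<in> cnj ` I" using idealD(2)[OF assms] by (intro image_eqI[of _ _ 0]) auto
next
  fix x y assume "x \<in> cnj ` I" "y \<in> cnj ` I"
  then obtain u v where "u \<in> I" "v \<in> I" "x = cnj u" "y = cnj v" by blast
  thus "x + y \<in> cnj ` I" using idealD(3)[OF assms] by (intro image_eqI[of _ _ "u + v"]) auto
next
  fix b x assume "b \<in> \<O>" "x \<in> cnj ` I"
  then obtain u where "u \<in> I" "x = cnj u" "b \<in> \<O>" by blast
  thus "b * x \<in> cnj ` I" using idealD(4)[OF assms, of "cnj b" u] carrier_cnj
    by (intro image_eqI[of _ _ "cnj b * u"]) auto
qed

section \<open>Traces, norms and square roots of ideals\<close>

lemma trace_int:
  assumes "w \<in> \<O>"
  obtains k where "w + cnj w = of_int k"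
  using assms elem_trace unfolding carrier_iff by blast

lemma norm_int:
  assumes "w \<in> \<O>"
  obtains k where "w * cnj w = of_int k" "k \<ge> 0" "w \<noteq> 0 \<Longrightarrow> k > 0"
proof -
  obtain x y where xy: "even (x + y)" "w = elem x y" using assms unfolding carrier_iff by blast
  obtain k where k: "x\<^sup>2 + int n * y\<^sup>2 = 4 * k" using xy(1) unfolding parity_norm by blast
  have norm: "w * cnj w = of_int k" unfolding xy(2) elem_norm k by simp
  have "x\<^sup>2 + int n * y\<^sup>2 \<ge> 0" by simp
  hence k0: "k \<ge> 0" unfolding k by simp
  moreover have "k > 0" if "w \<noteq> 0"
  proof -
    have "w * cnj w \<noteq> 0" using that by simp
    hence "k \<noteq> 0" unfolding norm by simp
    thus ?thesis using k0 by simp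
  qed
  ultimately show thesis using that norm by blast
qed

text \<open>The hypotheses say that w / N has integral trace and norm. In coordinates N^2 divides n
  y^2, and square-freeness of n lets N divide y.\<close>

lemma divide_by_int:
  assumes "w \<in> \<O>" "N \<noteq> 0" "w + cnj w = of_int a" "N dvd a" "w * cnj w = of_int b" "N\<^sup>2 dvd b"
  obtains w' where "w' \<in> \<O>" "w = of_int N * w'"
proof -
  obtain x y where xy: "even (x + y)" "w = elem x y" using assms(1) unfolding carrier_iff by blast
  have "(of_int x :: complex) = of_int a" using assms(3) unfolding xy(2) elem_trace .
  hence "N dvd x" using assms(4) by simp
  then obtain x' where x': "x = N * x'" by blast
  have "(of_int (x\<^sup>2 + int n * y\<^sup>2) :: complex) = 4 * of_int b"
    using assms(5) unfolding xy(2) elem_norm by simp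
  hence "(of_int (x\<^sup>2 + int n * y\<^sup>2) :: complex) = of_int (4 * b)" by simp
  hence b: "x\<^sup>2 + int n * y\<^sup>2 = 4 * b" by (simp only: of_int_eq_iff)
  obtain b' where b': "b = N\<^sup>2 * b'" using assms(6) by blast
  have "int n * y\<^sup>2 = N\<^sup>2 * (4 * b' - x'\<^sup>2)"
    using b unfolding x' b' by (simp add: power_mult_distrib algebra_simps)
  hence dvd: "N\<^sup>2 dvd int n * y\<^sup>2" by simp
  have "squarefree (int n)" using sqf by (simp add: squarefree_int_iff)
  hence "N dvd y" using square_dvd_squarefree_mult_square[OF _ dvd] by (cases "y = 0") auto
  then obtain y' where y': "y = N * y'" by blast
  have "N\<^sup>2 * (x'\<^sup>2 + int n * y'\<^sup>2) = N\<^sup>2 * (4 * b')"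
    using b unfolding x' b' y' by (simp add: power_mult_distrib algebra_simps)
  hence "x'\<^sup>2 + int n * y'\<^sup>2 = 4 * b'" using assms(2) by simp
  hence "even (x' + y')" unfolding parity_norm by simp
  hence "elem x' y' \<in> \<O>" unfolding carrier_iff by blast
  moreover have "w = of_int N * elem x' y'" unfolding xy(2) x' y' by (simp add: elem_def algebra_simps)
  ultimately show thesis using that by blast
qed

lemma of_int_mem_principal_iff:
  assumes "N \<noteq> 0"
  shows "of_int k \<in> principal (of_int N) \<longleftrightarrow> N dvd k"
proof
  assume "of_int k \<in> principal (of_int N)"
  then obtain w where w: "w \<in> \<O>" "of_int k = of_int N * w" by blast
  obtain x y where xy: "even (x + y)" "w = elem x y" using w(1) unfolding carrier_iff by blast
  have "elem (2 * k) 0 = elem (N * x) (N * y)"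
    using w(2) unfolding xy(2) elem_of_int by (simp add: elem_def algebra_simps)
  hence "2 * k = N * x" "y = 0" using assms by (auto simp: elem_eq_iff)
  moreover from this obtain x' where "x = 2 * x'" using xy(1) by auto
  ultimately have "k = N * x'" by simp
  thus "N dvd k" by simp
next
  assume "N dvd k"
  thus "of_int k \<in> principal (of_int N)" using carrier_of_int by (auto elim!: dvdE)
qed

text \<open>The least positive integer \<open>N\<close> in \<open>I cnj I\<close> divides all norms and traces of products \<open>x cnj z\<close>, so that
  \<open>x cnj z / N\<close> is integral.\<close>

lemma mult_cnj_principal:
  assumes I: "ideal I O\<^sub>K" "I \<noteq> {0}"
  obtains N where "N > 0" "I \<star> cnj ` I = principal (of_int N)"
proof -
  let ?J = "I \<star> cnj ` I"
  have J: "ideal ?J O\<^sub>K" by (rule ideal_mult_ideal[OF I(1) ideal_cnj[OF I(1)]])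
  define S where "S = {k. of_int k \<in> ?J}"
  obtain \<alpha> where \<alpha>: "\<alpha> \<in> I" "\<alpha> \<noteq> 0" using I idealD(2)[OF I(1)] by blast
  obtain c where c: "\<alpha> * cnj \<alpha> = of_int c" "c > 0"
    using norm_int[OF idealD(1)[OF I(1) \<alpha>(1)]] \<alpha>(2) by metis
  have "c \<in> S" unfolding S_def using mult_memI[OF \<alpha>(1) imageI[OF \<alpha>(1)], of cnj] c by simp
  moreover have "a - b \<in> S" if "a \<in> S" "b \<in> S" for a b
    using that idealD(7)[OF J] by (simp add: S_def)
  ultimately obtain N where N: "N > 0" "N \<in> S" "\<And>k. k \<in> S \<Longrightarrow> N dvd k"
    using int_subgroup_generator[of S c] c(2) by blast
  have "?J \<subseteq> principal (of_int N)"
  proof (rule mult_subsetI)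
    fix x y assume x: "x \<in> I" and y: "y \<in> cnj ` I"
    then obtain z where z: "z \<in> I" "y = cnj z" by blast
    have xyJ: "x * cnj z \<in> ?J" "z * cnj x \<in> ?J" using x z by (auto intro: mult_memI)
    obtain a where a: "x * cnj z + cnj (x * cnj z) = of_int a" using trace_int idealD(1)[OF J xyJ(1)] by blast
    have "x * cnj z + cnj (x * cnj z) \<in> ?J" using idealD(3)[OF J xyJ] by (simp add: mult.commute)
    hence "N dvd a" using N(3) a by (simp add: S_def)
    moreover obtain c1 where c1: "x * cnj x = of_int c1" using norm_int[OF idealD(1)[OF I(1) x]] by metis
    have "N dvd c1" using N(3) mult_memI[OF x imageI[OF x], of cnj] c1 by (simp add: S_def)
    moreover obtain c2 where c2: "z * cnj z = of_int c2" using norm_int[OF idealD(1)[OF I(1) z(1)]] by metis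
    have "N dvd c2" using N(3) mult_memI[OF z(1) imageI[OF z(1)], of cnj] c2 by (simp add: S_def)
    moreover have "x * cnj z * cnj (x * cnj z) = (x * cnj x) * (z * cnj z)" by simp
    hence "x * cnj z * cnj (x * cnj z) = of_int (c1 * c2)" unfolding c1 c2 by simp
    ultimately obtain w where "w \<in> \<O>" "x * cnj z = of_int N * w"
      using divide_by_int[OF idealD(1)[OF J xyJ(1)] _ a] N(1)
      by (metis less_irrefl mult_dvd_mono power2_eq_square)
    thus "x * y \<in> principal (of_int N)" using z by auto
  next
    fix x y assume "x \<in> principal (of_int N)" "y \<in> principal (of_int N)"
    thus "x + y \<in> principal (of_int N)" using idealD(3)[OF ideal_principal[OF carrier_of_int]] by blast
  qed
  moreover have "principal (of_int N) \<subseteq> ?J"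
    using N(2) idealD(5)[OF J] by (auto simp: S_def)
  ultimately show thesis using that N(1) by blast
qed

text \<open>The ideal \<open>J = \<alpha> cnj I / N\<close> satisfies \<open>I J = (\<alpha>)\<close> and has norm \<open>z\<^sup>2\<close>. If no integer divides \<open>J\<close>, then
  the ideal generated by \<open>z\<close> and the traces of \<open>J\<close> is trivial, hence \<open>M = J + (z)\<close> has the square \<open>J\<close>.\<close>

lemma square_root_of_primitive:
  assumes I: "ideal I O\<^sub>K" and N: "N > 0" "I \<star> cnj ` I = principal (of_int N)"
    and \<alpha>: "\<alpha> \<in> I" "\<alpha> * cnj \<alpha> = of_int (N * z\<^sup>2)" and z: "z > 0"
    and prim: "\<And>p \<beta>. prime p \<Longrightarrow> \<beta> \<in> I \<Longrightarrow> \<alpha> \<noteq> of_int p * \<beta>"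
  obtains M where "ideal M O\<^sub>K" "M \<star> M \<star> I = principal \<alpha>" "M \<star> cnj ` M = principal (of_int z)"
    "of_int z \<in> M" "\<And>\<beta> \<gamma>. \<beta> \<in> I \<Longrightarrow> of_int N * \<gamma> = \<alpha> * cnj \<beta> \<Longrightarrow> \<gamma> \<in> M"
proof -
  have \<alpha>c: "\<alpha> \<in> \<O>" using I \<alpha>(1) by (rule idealD(1))
  have \<alpha>0: "\<alpha> \<noteq> 0" using \<alpha>(2) N(1) z by auto
  have cI: "ideal (cnj ` I) O\<^sub>K" by (rule ideal_cnj[OF I])
  \<comment> \<open>The quotient by N written without fractions. Its elements are integral since
    \<alpha> cnj \<beta> lies in I cnj I = (N).\<close>
  define J where "J = {\<gamma>. of_int N * \<gamma> \<in> \<alpha> \<diamondop> cnj ` I}"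
  have NJ: "of_int N \<diamondop> J = \<alpha> \<diamondop> cnj ` I"
  proof (rule equalityI)
    show "\<alpha> \<diamondop> cnj ` I \<subseteq> of_int N \<diamondop> J"
    proof
      fix x assume x: "x \<in> \<alpha> \<diamondop> cnj ` I"
      thus "x \<in> of_int N \<diamondop> J" using N(1) by (intro image_eqI[of _ _ "x / of_int N"]) (auto simp: J_def)
    qed
  qed (auto simp: J_def)
  have J_sub: "J \<subseteq> \<O>"
  proof
    fix \<gamma> assume "\<gamma> \<in> J"
    then obtain \<beta> where \<beta>: "\<beta> \<in> I" "of_int N * \<gamma> = \<alpha> * cnj \<beta>" by (auto simp: J_def)
    have "\<alpha> * cnj \<beta> \<in> I \<star> cnj ` I" using \<alpha>(1) \<beta>(1) by (intro mult_memI) auto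
    then obtain w where "w \<in> \<O>" "\<alpha> * cnj \<beta> = of_int N * w" unfolding N(2) by blast
    hence "\<gamma> = w" using \<beta>(2) N(1) by simp
    thus "\<gamma> \<in> \<O>" using \<open>w \<in> \<O>\<close> by simp
  qed
  have \<alpha>I: "ideal (\<alpha> \<diamondop> cnj ` I) O\<^sub>K" by (rule ideal_scale[OF cI \<alpha>c])
  have J: "ideal J O\<^sub>K"
    unfolding ideal_iff
  proof (intro conjI ballI)
    show "0 \<in> J" using idealD(2)[OF \<alpha>I] by (simp add: J_def)
    show "x + y \<in> J" if "x \<in> J" "y \<in> J" for x y
      using idealD(3)[OF \<alpha>I] that by (simp add: J_def distrib_left)
    show "a * x \<in> J" if "a \<in> \<O>" "x \<in> J" for a x
      using idealD(4)[OF \<alpha>I, of a "of_int N * x"] that by (simp add: J_def mult_ac)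
  qed (rule J_sub)
  have cJ: "ideal (cnj ` J) O\<^sub>K" by (rule ideal_cnj[OF J])
  have N0: "(of_int N :: complex) \<noteq> 0" using N(1) by simp
  have JI: "J \<star> I = principal \<alpha>"
  proof -
    have "of_int N \<diamondop> (J \<star> I) = \<alpha> \<diamondop> (cnj ` I \<star> I)" unfolding scale_mult[symmetric] NJ ..
    also have "\<dots> = of_int N \<diamondop> principal \<alpha>"
      unfolding ideal_mult_commute[OF cI I] N(2) by (rule scale_commute)
    finally show ?thesis by (rule scale_cancel[OF N0, THEN iffD1])
  qed
  have JcJ: "J \<star> cnj ` J = principal (of_int (z\<^sup>2))"
  proof -
    have cNJ: "of_int N \<diamondop> cnj ` J = cnj \<alpha> \<diamondop> I"
    proof -
      have "of_int N \<diamondop> cnj ` J = cnj ` (of_int N \<diamondop> J)" by (simp add: image_image)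
      also have "\<dots> = cnj \<alpha> \<diamondop> I" unfolding NJ by (simp add: image_image)
      finally show ?thesis .
    qed
    have "of_int N \<diamondop> of_int N \<diamondop> (J \<star> cnj ` J) = of_int N \<diamondop> (J \<star> (of_int N \<diamondop> cnj ` J))"
      unfolding mult_scale[OF J cJ carrier_of_int] ..
    also have "\<dots> = (of_int N \<diamondop> J) \<star> (cnj \<alpha> \<diamondop> I)" unfolding cNJ scale_mult ..
    also have "\<dots> = \<alpha> \<diamondop> cnj \<alpha> \<diamondop> (cnj ` I \<star> I)"
      unfolding NJ scale_mult mult_scale[OF cI I carrier_cnj[OF \<alpha>c]] ..
    also have "\<dots> = of_int (N * z\<^sup>2) \<diamondop> of_int N \<diamondop> \<O>"
      unfolding ideal_mult_commute[OF cI I] N(2) \<alpha>(2)[symmetric] by (rule scale_scale)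
    also have "\<dots> = of_int N \<diamondop> of_int N \<diamondop> principal (of_int (z\<^sup>2))"
      unfolding scale_scale
      by (rule arg_cong[of _ _ "\<lambda>c. c \<diamondop> \<O>"]) (simp add: mult_ac)
    finally show ?thesis by (rule scale_cancel[OF N0, THEN iffD1, THEN scale_cancel[OF N0, THEN iffD1]])
  qed
  have dvd_norm: "z\<^sup>2 dvd k" if "\<gamma> \<in> J" "\<gamma> * cnj \<gamma> = of_int k" for \<gamma> k
  proof -
    have "of_int k \<in> J \<star> cnj ` J" unfolding that(2)[symmetric] using that(1) by (intro mult_memI) auto
    thus ?thesis unfolding JcJ using z by (subst (asm) of_int_mem_principal_iff) auto
  qed
  \<comment> \<open>The group of integers generated by z and the traces of \<open>J\<close>. Once
    its generator is known to be 1, it supplies the identity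
    \<open>1 = z u + \<beta> + cnj \<beta>\<close> with \<beta> in \<open>J\<close>, on which the
    rest depends.\<close>
  define S where "S = {k. \<exists>u \<gamma>. \<gamma> \<in> J \<and> of_int k = of_int (z * u) + (\<gamma> + cnj \<gamma>)}"
  have zS: "z \<in> S" unfolding S_def
    using idealD(2)[OF J] by (intro CollectI exI[of _ 1] exI[of _ 0]) simp
  have diffS: "a - b \<in> S" if ab: "a \<in> S" "b \<in> S" for a b
  proof -
    obtain u \<gamma> u' \<gamma>' where h: "\<gamma> \<in> J" "of_int a = of_int (z * u) + (\<gamma> + cnj \<gamma>)"
      "\<gamma>' \<in> J" "of_int b = of_int (z * u') + (\<gamma>' + cnj \<gamma>')" using ab unfolding S_def by blast
    have "\<gamma> - \<gamma>' \<in> J" using idealD(7)[OF J] h by blast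
    moreover have "of_int (a - b) = of_int (z * (u - u')) + ((\<gamma> - \<gamma>') + cnj (\<gamma> - \<gamma>'))"
      unfolding of_int_diff h(2,4) by (simp add: algebra_simps)
    ultimately show ?thesis unfolding S_def by blast
  qed
  obtain g where g: "g > 0" "g \<in> S" "\<And>k. k \<in> S \<Longrightarrow> g dvd k"
    using int_subgroup_generator[OF diffS zS z] by blast
  have "g = 1"
  proof (rule ccontr)
    assume "g \<noteq> 1"
    hence "\<not> is_unit g" using g(1) by simp
    then obtain p where p: "prime p" "p dvd g" using prime_divisor_exists[of g] g(1) by auto
    have p0: "p > 0" using p(1) by (simp add: prime_gt_0_int)
    have pz: "p dvd z" using g(3)[OF zS] p(2) by (rule dvd_trans[rotated])
    \<comment> \<open>The prime p divides z and all traces, and p^2 divides z^2, which divides all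
      norms. So p divides every element of \<open>J\<close>, and as \<open>J\<close> times I is
      (\<alpha>), this contradicts primitivity.\<close>
    have pJ: "\<exists>\<gamma>'\<in>\<O>. \<gamma> = of_int p * \<gamma>'" if "\<gamma> \<in> J" for \<gamma>
    proof -
      have gc: "\<gamma> \<in> \<O>" using that J_sub by blast
      obtain a where a: "\<gamma> + cnj \<gamma> = of_int a" using trace_int[OF gc] by blast
      have "a \<in> S" unfolding S_def using that a by (intro CollectI exI[of _ 0] exI[of _ \<gamma>]) simp
      hence pa: "p dvd a" using g(3) p(2) dvd_trans by blast
      obtain b where b: "\<gamma> * cnj \<gamma> = of_int b" using norm_int[OF gc] by metis
      have "p\<^sup>2 dvd z\<^sup>2" using pz by simp
      hence "p\<^sup>2 dvd b" using dvd_norm[OF that b] dvd_trans by blast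
      thus ?thesis using divide_by_int[OF gc _ a pa b] p0 by blast
    qed
    have "J \<star> I \<subseteq> of_int p \<diamondop> I"
    proof (rule mult_subsetI)
      fix x y assume "x \<in> J" "y \<in> I"
      then obtain x' where "x' \<in> \<O>" "x = of_int p * x'" using pJ by blast
      moreover from this have "x' * y \<in> I" using idealD(4)[OF I] \<open>y \<in> I\<close> by blast
      ultimately show "x * y \<in> of_int p \<diamondop> I" by (simp only: mult.assoc imageI)
    next
      fix x y assume "x \<in> of_int p \<diamondop> I" "y \<in> of_int p \<diamondop> I"
      thus "x + y \<in> of_int p \<diamondop> I" using idealD(3)[OF ideal_scale[OF I carrier_of_int]] by blast
    qed
    hence "\<alpha> \<in> of_int p \<diamondop> I" unfolding JI using mem_principal_self by blast
    thus False using prim[OF p(1)] by blast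
  qed
  then obtain u \<beta> where \<beta>: "\<beta> \<in> J" "1 = of_int (z * u) + (\<beta> + cnj \<beta>)"
    using g(2) unfolding S_def by auto
  define M where "M = {\<gamma> + of_int z * a |\<gamma> a. \<gamma> \<in> J \<and> a \<in> \<O>}"
  have MI: "\<gamma> + of_int z * a \<in> M" if "\<gamma> \<in> J" "a \<in> \<O>" for \<gamma> a
    unfolding M_def using that by blast
  have JM: "\<gamma> \<in> M" if "\<gamma> \<in> J" for \<gamma> using MI[OF that carrier_0] by simp
  have zM: "of_int z * a \<in> M" if "a \<in> \<O>" for a using MI[OF idealD(2)[OF J] that] by simp
  have M: "ideal M O\<^sub>K"
    unfolding ideal_iff
  proof (intro conjI ballI subsetI)
    fix x assume "x \<in> M"
    thus "x \<in> \<O>" unfolding M_def using J_sub carrier_of_int carrier_mult carrier_add by blast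
  next
    show "0 \<in> M" using JM[OF idealD(2)[OF J]] .
  next
    fix x y assume "x \<in> M" "y \<in> M"
    then obtain \<gamma> a \<gamma>' a' where h: "\<gamma> \<in> J" "a \<in> \<O>" "x = \<gamma> + of_int z * a"
      "\<gamma>' \<in> J" "a' \<in> \<O>" "y = \<gamma>' + of_int z * a'" unfolding M_def by blast
    have "(\<gamma> + \<gamma>') + of_int z * (a + a') \<in> M" using h idealD(3)[OF J] carrier_add MI by blast
    thus "x + y \<in> M" using h by (simp add: algebra_simps)
  next
    fix b x assume b: "b \<in> \<O>" and "x \<in> M"
    then obtain \<gamma> a where h: "\<gamma> \<in> J" "a \<in> \<O>" "x = \<gamma> + of_int z * a" unfolding M_def by blast
    have "b * \<gamma> + of_int z * (b * a) \<in> M" using h b idealD(4)[OF J] carrier_mult MI by blast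
    thus "b * x \<in> M" using h by (simp add: algebra_simps)
  qed
  have z1: "of_int z \<in> M" using zM[OF carrier_1] by simp
  have z2: "of_int (z\<^sup>2) \<in> J"
  proof -
    have "J \<star> cnj ` J \<subseteq> J"
      using idealD[OF J] idealD(1)[OF cJ] by (intro mult_subsetI) auto
    thus ?thesis unfolding JcJ using mem_principal_self by blast
  qed
  have MM: "M \<star> M = J"
  proof (rule equalityI)
    show "M \<star> M \<subseteq> J"
    proof (rule mult_subsetI)
      fix x y assume "x \<in> M" "y \<in> M"
      then obtain \<gamma> a \<gamma>' a' where h: "\<gamma> \<in> J" "a \<in> \<O>" "x = \<gamma> + of_int z * a"
        "\<gamma>' \<in> J" "a' \<in> \<O>" "y = \<gamma>' + of_int z * a'" unfolding M_def by blast
      have "x * y = y * \<gamma> + ((of_int z * a) * \<gamma>' + (a * a') * of_int (z\<^sup>2))"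
        unfolding h(3,6) by (simp add: power2_eq_square algebra_simps)
      moreover have "y \<in> \<O>" using \<open>y \<in> M\<close> idealD(1)[OF M] by blast
      ultimately show "x * y \<in> J"
        using idealD(4)[OF J _ h(1), of y] idealD(4)[OF J _ h(4), of "of_int z * a"]
          idealD(4)[OF J _ z2, of "a * a'"] h(2,5) idealD(3)[OF J] carrier_mult carrier_of_int by presburger
    qed (rule idealD(3)[OF J])
    show "J \<subseteq> M \<star> M"
    proof
      fix \<gamma> assume \<gamma>: "\<gamma> \<in> J"
      have MM: "ideal (M \<star> M) O\<^sub>K" by (rule ideal_mult_ideal[OF M M])
      have "\<gamma> * cnj \<beta> \<in> J \<star> cnj ` J" using \<gamma> \<beta>(1) by (intro mult_memI) auto
      then obtain w where w: "w \<in> \<O>" "\<gamma> * cnj \<beta> = of_int (z\<^sup>2) * w" unfolding JcJ by blast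
      \<comment> \<open>After multiplication by 1 = z u + \<beta> + cnj \<beta>, each term is an
        integral multiple of a product of two members of \<open>M\<close>, because \<gamma> cnj
        \<beta> is a multiple of z^2.\<close>
      have "\<gamma> = \<gamma> * (of_int (z * u) + (\<beta> + cnj \<beta>))" using \<beta>(2) by simp
      also have "\<dots> = (\<gamma> * of_int z) * of_int u + (\<gamma> * \<beta> + (of_int z * of_int z) * w)"
        using w(2) by (simp add: power2_eq_square algebra_simps)
      also have "\<dots> \<in> M \<star> M"
        by (intro idealD(3)[OF MM] idealD(5)[OF MM carrier_of_int] idealD(5)[OF MM w(1)]
            mult_memI JM[OF \<gamma>] JM[OF \<beta>(1)] z1)
      finally show "\<gamma> \<in> M \<star> M" .
    qed
  qed
  have cM: "ideal (cnj ` M) O\<^sub>K" by (rule ideal_cnj[OF M])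
  have "M \<star> cnj ` M = principal (of_int z)"
  proof (rule equalityI)
    have zP: "ideal (principal (of_int z)) O\<^sub>K" by (rule ideal_principal[OF carrier_of_int])
    show "M \<star> cnj ` M \<subseteq> principal (of_int z)"
    proof (rule mult_subsetI)
      fix x y assume x: "x \<in> M" and "y \<in> cnj ` M"
      then obtain y' where y': "y' \<in> M" "y = cnj y'" by blast
      obtain \<gamma> a \<gamma>' a' where h: "\<gamma> \<in> J" "a \<in> \<O>" "x = \<gamma> + of_int z * a"
        "\<gamma>' \<in> J" "a' \<in> \<O>" "y' = \<gamma>' + of_int z * a'" using x y'(1) unfolding M_def by blast
      have "\<gamma> * cnj \<gamma>' \<in> J \<star> cnj ` J" using h by (intro mult_memI) auto
      then obtain w where w: "w \<in> \<O>" "\<gamma> * cnj \<gamma>' = of_int (z\<^sup>2) * w" unfolding JcJ by blast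
      have yc: "y \<in> \<O>" using y' idealD(1)[OF M] carrier_cnj by blast
      have "x * y = \<gamma> * cnj \<gamma>' + of_int z * (\<gamma> * cnj a' + a * y)"
        unfolding y'(2) h(3,6) by (simp add: algebra_simps)
      also have "\<dots> = of_int z * (of_int z * w + (\<gamma> * cnj a' + a * y))"
        unfolding w(2) by (simp add: power2_eq_square algebra_simps)
      finally show "x * y \<in> principal (of_int z)"
        using w(1) yc h(2,5) subsetD[OF J_sub h(1)]
        by (simp only: imageI carrier_add carrier_mult carrier_of_int carrier_cnj)
    qed (rule idealD(3)[OF zP])
    show "principal (of_int z) \<subseteq> M \<star> cnj ` M"
    proof -
      have McM: "ideal (M \<star> cnj ` M) O\<^sub>K" by (rule ideal_mult_ideal[OF M cM])
      have zc: "of_int z \<in> cnj ` M" using z1 by (intro image_eqI[of _ _ "of_int z"]) auto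
      have "of_int z = of_int z * (of_int (z * u) + (\<beta> + cnj \<beta>))" using \<beta>(2) by simp
      also have "\<dots> = (of_int z * of_int z) * of_int u + (\<beta> * of_int z + of_int z * cnj \<beta>)"
        by (simp add: algebra_simps)
      also have "\<dots> \<in> M \<star> cnj ` M"
        by (intro idealD(3)[OF McM] idealD(5)[OF McM carrier_of_int] mult_memI imageI JM[OF \<beta>(1)] z1 zc)
      finally show ?thesis using idealD(5)[OF McM] by blast
    qed
  qed
  moreover have "M \<star> M \<star> I = principal \<alpha>" unfolding MM JI ..
  moreover have "\<gamma> \<in> M" if "\<beta> \<in> I" "of_int N * \<gamma> = \<alpha> * cnj \<beta>" for \<beta> \<gamma>
    using that by (intro JM) (auto simp: J_def)
  ultimately show thesis using that[OF M] z1 by blast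
qed

end

section \<open>Doubling a subgroup of a commutative group\<close>

text \<open>The coset of g is disjoint from K, and g^2 in K makes the union closed. Two such steps
  will multiply the order by 4.\<close>

lemma (in comm_group) subgroup_extend_by_square_root:
  assumes K: "subgroup K G" "finite K" and g: "g \<in> carrier G" "g \<notin> K" "g \<otimes> g \<in> K"
  shows "subgroup (K \<union> (\<lambda>k. g \<otimes> k) ` K) G \<and> finite (K \<union> (\<lambda>k. g \<otimes> k) ` K) \<and>
    card (K \<union> (\<lambda>k. g \<otimes> k) ` K) = 2 * card K"
proof (intro conjI)
  let ?L = "(\<lambda>k. g \<otimes> k) ` K"
  have Kc: "k \<in> carrier G" if "k \<in> K" for k using subgroup.mem_carrier[OF K(1) that] .
  note Km = subgroup.m_closed[OF K(1)] and Ki = subgroup.m_inv_closed[OF K(1)]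
  show "finite (K \<union> ?L)" using K(2) by simp
  have disj: "K \<inter> ?L = {}"
  proof (rule ccontr)
    assume "K \<inter> ?L \<noteq> {}"
    then obtain k where k: "k \<in> K" "g \<otimes> k \<in> K" by blast
    have "g \<otimes> k \<otimes> inv k \<in> K" using k Km Ki by blast
    thus False using g(1,2) Kc[OF k(1)] by (simp add: m_assoc)
  qed
  have "card ?L = card K"
    by (intro card_image inj_onI) (use g Kc in auto)
  thus "card (K \<union> ?L) = 2 * card K" using disj K(2) by (simp add: card_Un_disjoint)
  show "subgroup (K \<union> ?L) G"
  proof (rule subgroupI)
    show "K \<union> ?L \<subseteq> carrier G" using Kc g(1) by auto
    show "K \<union> ?L \<noteq> {}" using subgroup.one_closed[OF K(1)] by blast
  next
    fix a assume "a \<in> K \<union> ?L"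
    then consider "a \<in> K" | k where "k \<in> K" "a = g \<otimes> k" by blast
    thus "inv a \<in> K \<union> ?L"
    proof cases
      case 1
      thus ?thesis using Ki by blast
    next
      case 2
      \<comment> \<open>The inverse of g is g times the inverse of g^2, so it lies in the coset of
        g.\<close>
      have "inv a = g \<otimes> (inv (g \<otimes> g) \<otimes> inv k)"
        using 2 g(1) Kc[OF 2(1)] by (simp add: inv_mult_group m_assoc[symmetric]) (simp add: m_ac inv_solve_left')
      moreover have "inv (g \<otimes> g) \<otimes> inv k \<in> K" using Km Ki g(3) 2(1) by blast
      ultimately show ?thesis by blast
    qed
  next
    fix a b assume "a \<in> K \<union> ?L" "b \<in> K \<union> ?L"
    then consider "a \<in> K" "b \<in> K" | k where "k \<in> K" "a = g \<otimes> k" "b \<in> K"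
      | k where "k \<in> K" "b = g \<otimes> k" "a \<in> K"
      | k l where "k \<in> K" "a = g \<otimes> k" "l \<in> K" "b = g \<otimes> l" by blast
    thus "a \<otimes> b \<in> K \<union> ?L"
    proof cases
      case 1
      thus ?thesis using Km by blast
    next
      case (2 k)
      have "a \<otimes> b = g \<otimes> (k \<otimes> b)" using 2 g(1) Kc by (simp add: m_assoc)
      thus ?thesis using Km[OF 2(1,3)] by blast
    next
      case (3 k)
      have "a \<otimes> b = g \<otimes> (k \<otimes> a)" using 3 g(1) Kc by (simp add: m_ac)
      thus ?thesis using Km[OF 3(1,3)] by blast
    next
      case (4 k l)
      have "a \<otimes> b = (g \<otimes> g) \<otimes> (k \<otimes> l)" using 4 g(1) Kc by (simp add: m_ac)
      thus ?thesis using Km[OF g(3) Km[OF 4(1,3)]] by simp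
    qed
  qed
qed

context imag_quadratic
begin

text \<open>An explicit form of the principal genus theorem: an element of norm N z^2 in I makes the
  class of I the inverse of a square. Primitivity can be achieved because a rational prime dividing
  the element also divides z and can be cancelled from both.\<close>

lemma square_root_exists:
  assumes I: "ideal I O\<^sub>K" and N: "N > 0" "I \<star> cnj ` I = principal (of_int N)"
    and \<alpha>: "\<alpha> \<in> I" "\<alpha> * cnj \<alpha> = of_int (N * z\<^sup>2)" and z: "z > 0"
  obtains M \<beta> where "ideal M O\<^sub>K" "\<beta> \<in> \<O>" "\<beta> \<noteq> 0" "M \<star> M \<star> I = principal \<beta>"
proof -
  define Q where "Q k \<longleftrightarrow> k > 0 \<and> (\<exists>\<alpha>\<in>I. \<alpha> * cnj \<alpha> = of_int (N * (int k)\<^sup>2))" for k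
  \<comment> \<open>an element with the least value of \<open>z\<close> is primitive\<close>
  have "Q (nat z)" unfolding Q_def using \<alpha> z by (intro conjI bexI[of _ \<alpha>]) simp_all
  define m where "m = (LEAST k. Q k)"
  have "Q m" unfolding m_def using \<open>Q (nat z)\<close> by (rule LeastI)
  then obtain \<beta> where \<beta>: "m > 0" "\<beta> \<in> I" "\<beta> * cnj \<beta> = of_int (N * (int m)\<^sup>2)" unfolding Q_def by blast
  have prim: "\<beta> \<noteq> of_int p * \<gamma>" if p: "prime p" and \<gamma>: "\<gamma> \<in> I" for p \<gamma>
  proof
    assume eq: "\<beta> = of_int p * \<gamma>"
    have p1: "p > 1" using p by (rule prime_gt_1_int)
    obtain c where c: "\<gamma> * cnj \<gamma> = of_int c" using norm_int[OF idealD(1)[OF I \<gamma>]] by metis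
    have "of_int c \<in> principal (of_int N)"
      unfolding c[symmetric] N(2)[symmetric] using \<gamma> by (intro mult_memI) auto
    hence "N dvd c" using N(1) by (subst (asm) of_int_mem_principal_iff) auto
    then obtain c' where c': "c = N * c'" by blast
    have "of_int (N * (int m)\<^sup>2) = (of_int p * of_int p) * (\<gamma> * cnj \<gamma>)"
      unfolding \<beta>(3)[symmetric] eq by simp
    also have "\<dots> = of_int (N * (p\<^sup>2 * c'))" unfolding c c' by (simp add: power2_eq_square)
    finally have "N * (int m)\<^sup>2 = N * (p\<^sup>2 * c')" by (simp only: of_int_eq_iff)
    hence mc: "(int m)\<^sup>2 = p\<^sup>2 * c'" using N(1) by simp
    hence "p\<^sup>2 dvd (int m)\<^sup>2" by simp
    hence "p dvd int m" by simp
    then obtain k where k: "int m = p * k" by blast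
    have "0 < p * k" using \<beta>(1) k by simp
    hence k0: "k > 0" by (rule zero_less_mult_pos) (use p1 in simp)
    have "p\<^sup>2 * k\<^sup>2 = p\<^sup>2 * c'" using mc unfolding k power_mult_distrib .
    hence "c' = k\<^sup>2" using p1 by simp
    hence "\<gamma> * cnj \<gamma> = of_int (N * (int (nat k))\<^sup>2)" using c c' k0 by simp
    hence "Q (nat k)" unfolding Q_def using k0 \<gamma> by auto
    moreover have "nat k < m"
    proof -
      have "1 * k < p * k" using k0 p1 by (intro mult_strict_right_mono)
      thus ?thesis using k k0 by linarith
    qed
    ultimately show False unfolding m_def using not_less_Least by blast
  qed
  have "\<beta> \<noteq> 0" using \<beta>(1,3) N(1) by auto
  have m0: "int m > 0" using \<beta>(1) by simp
  obtain M where M: "ideal M O\<^sub>K" "M \<star> M \<star> I = principal \<beta>"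
    by (rule square_root_of_primitive[OF I N \<beta>(2,3) m0]) (erule (1) prim, rule that)
  show thesis by (rule that[OF M(1) idealD(1)[OF I \<beta>(2)] \<open>\<beta> \<noteq> 0\<close> M(2)])
qed

text \<open>For \<open>d\<close> dividing \<open>n\<close>, this is the product of the ramified prime ideals over \<open>d\<close>.\<close>

definition ramified :: "int \<Rightarrow> complex set" where
  "ramified d = {of_int d * a + \<omega> * b |a b. a \<in> \<O> \<and> b \<in> \<O>}"

lemma ramifiedI: "a \<in> \<O> \<Longrightarrow> b \<in> \<O> \<Longrightarrow> of_int d * a + \<omega> * b \<in> ramified d"
  unfolding ramified_def by blast

lemma ideal_ramified: "ideal (ramified d) O\<^sub>K"
  unfolding ideal_iff
proof (intro conjI ballI subsetI)
  fix x assume "x \<in> ramified d"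
  thus "x \<in> \<O>" unfolding ramified_def
    using carrier_add carrier_mult carrier_of_int carrier_omega by blast
next
  show "0 \<in> ramified d" using ramifiedI[OF carrier_0 carrier_0, of d] by simp
next
  fix x y assume "x \<in> ramified d" "y \<in> ramified d"
  then obtain a b a' b' where h: "a \<in> \<O>" "b \<in> \<O>" "x = of_int d * a + \<omega> * b"
    "a' \<in> \<O>" "b' \<in> \<O>" "y = of_int d * a' + \<omega> * b'" unfolding ramified_def by blast
  have "of_int d * (a + a') + \<omega> * (b + b') \<in> ramified d" using h carrier_add ramifiedI by blast
  thus "x + y \<in> ramified d" unfolding h(3,6) by (simp add: algebra_simps)
next
  fix c x assume c: "c \<in> \<O>" and "x \<in> ramified d"
  then obtain a b where h: "a \<in> \<O>" "b \<in> \<O>" "x = of_int d * a + \<omega> * b"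
    unfolding ramified_def by blast
  have "of_int d * (c * a) + \<omega> * (c * b) \<in> ramified d" using h c carrier_mult ramifiedI by blast
  thus "c * x \<in> ramified d" unfolding h(3) by (simp add: algebra_simps)
qed

lemma int_mem_ramified: "of_int d \<in> ramified d" and omega_mem_ramified: "\<omega> \<in> ramified d"
  using ramifiedI[OF carrier_1 carrier_0, of d] ramifiedI[OF carrier_0 carrier_1, of d] by simp_all

lemma ramified_1: "ramified 1 = \<O>"
  using idealD(1)[OF ideal_ramified] idealD(5)[OF ideal_ramified _ int_mem_ramified[of 1]] by auto

lemma cnj_ramified: "cnj ` ramified d = ramified d"
proof -
  have sub: "cnj ` ramified d \<subseteq> ramified d"
  proof
    fix x assume "x \<in> cnj ` ramified d"
    then obtain a b where h: "a \<in> \<O>" "b \<in> \<O>" "x = cnj (of_int d * a + \<omega> * b)"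
      unfolding ramified_def by blast
    have "of_int d * cnj a + \<omega> * (- cnj b) \<in> ramified d"
      using h carrier_cnj carrier_uminus ramifiedI by blast
    thus "x \<in> ramified d" unfolding h(3) by simp
  qed
  have "cnj ` (cnj ` ramified d) \<subseteq> cnj ` ramified d" using sub by (rule image_mono)
  thus ?thesis using sub by (auto simp: image_image)
qed

text \<open>The product is generated by d^2, d \<omega> and \<omega>^2 = - d e, all multiples of d;
  coprimality of d and e recovers d by Bezout.\<close>

lemma ramified_square:
  assumes d: "d * e = int n" "coprime d e"
  shows "ramified d \<star> ramified d = principal (of_int d)"
proof (rule equalityI)
  have P: "ideal (principal (of_int d)) O\<^sub>K" by (rule ideal_principal[OF carrier_of_int])
  show "ramified d \<star> ramified d \<subseteq> principal (of_int d)"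
  proof (rule mult_subsetI)
    fix x y assume "x \<in> ramified d" "y \<in> ramified d"
    then obtain a b a' b' where h: "a \<in> \<O>" "b \<in> \<O>" "x = of_int d * a + \<omega> * b"
      "a' \<in> \<O>" "b' \<in> \<O>" "y = of_int d * a' + \<omega> * b'" unfolding ramified_def by blast
    have "x * y = of_int d * (a * (of_int d * a') + \<omega> * (a * b' + b * a')) + (\<omega> * \<omega>) * (b * b')"
      unfolding h(3,6) by (simp add: algebra_simps)
    also have "\<omega> * \<omega> = of_int d * of_int (- e)"
      unfolding omega_square using arg_cong[OF d(1), of complex_of_int] by simp
    also have "of_int d * (a * (of_int d * a') + \<omega> * (a * b' + b * a')) + of_int d * of_int (- e) * (b * b') =
        of_int d * (a * (of_int d * a') + \<omega> * (a * b' + b * a') + of_int (- e) * (b * b'))"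
      by (simp only: distrib_left mult.assoc)
    finally show "x * y \<in> principal (of_int d)"
      using h(1,2,4,5) by (simp only: imageI carrier_add carrier_mult carrier_of_int carrier_omega)
  qed (rule idealD(3)[OF P])
  have RR: "ideal (ramified d \<star> ramified d) O\<^sub>K" by (rule ideal_mult_ideal[OF ideal_ramified ideal_ramified])
  obtain u v where uv: "u * d + v * e = 1" using d(2) bezout_int[of d e] by (auto simp: coprime_iff_gcd_eq_1)
  have "of_int d = of_int d * of_int (u * d + v * e)" unfolding uv by simp
  also have "\<dots> = (of_int d * of_int d) * of_int u + of_int (d * e) * of_int v" by (simp add: algebra_simps)
  also have "of_int (d * e) = (- (\<omega> * \<omega>))" unfolding d(1) omega_square by simp
  also have "(of_int d * of_int d) * of_int u + - (\<omega> * \<omega>) * of_int v =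
    (of_int d * of_int d) * of_int u + (\<omega> * \<omega>) * of_int (- v)" by simp
  also have "\<dots> \<in> ramified d \<star> ramified d"
    by (intro idealD(3)[OF RR] idealD(5)[OF RR carrier_of_int] mult_memI int_mem_ramified omega_mem_ramified)
  finally show "principal (of_int d) \<subseteq> ramified d \<star> ramified d" using idealD(5)[OF RR] by blast
qed

text \<open>Bezout for d and e recovers \<omega> from d \<omega> and e \<omega>.\<close>

lemma ramified_mult:
  assumes "coprime d e" "d * e dvd int n"
  shows "ramified d \<star> ramified e = ramified (d * e)"
proof (rule equalityI)
  show "ramified d \<star> ramified e \<subseteq> ramified (d * e)"
  proof (rule mult_subsetI)
    fix x y assume "x \<in> ramified d" "y \<in> ramified e"
    then obtain a b a' b' where h: "a \<in> \<O>" "b \<in> \<O>" "x = of_int d * a + \<omega> * b"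
      "a' \<in> \<O>" "b' \<in> \<O>" "y = of_int e * a' + \<omega> * b'" unfolding ramified_def by blast
    have "x * y = of_int (d * e) * (a * a') + \<omega> * (of_int d * (a * b') + b * y)"
      unfolding h(3,6) by (simp add: algebra_simps)
    moreover have "y \<in> \<O>" using \<open>y \<in> ramified e\<close> idealD(1)[OF ideal_ramified] by blast
    ultimately show "x * y \<in> ramified (d * e)"
      using h(1,2,4,5) by (simp only: ramifiedI carrier_add carrier_mult carrier_of_int)
  qed (rule idealD(3)[OF ideal_ramified])
  have RR: "ideal (ramified d \<star> ramified e) O\<^sub>K" by (rule ideal_mult_ideal[OF ideal_ramified ideal_ramified])
  have 1: "of_int (d * e) \<in> ramified d \<star> ramified e"
    using mult_memI[OF int_mem_ramified[of d] int_mem_ramified[of e]] by simp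
  obtain u v where uv: "u * d + v * e = 1" using assms(1) bezout_int[of d e] by (auto simp: coprime_iff_gcd_eq_1)
  have "\<omega> = \<omega> * of_int (u * d + v * e)" unfolding uv by simp
  also have "\<dots> = (of_int d * \<omega>) * of_int u + (\<omega> * of_int e) * of_int v" by (simp add: algebra_simps)
  also have "\<dots> \<in> ramified d \<star> ramified e"
    by (intro idealD(3)[OF RR] idealD(5)[OF RR carrier_of_int] mult_memI int_mem_ramified omega_mem_ramified)
  finally have 2: "\<omega> \<in> ramified d \<star> ramified e" .
  show "ramified (d * e) \<subseteq> ramified d \<star> ramified e"
  proof
    fix x assume "x \<in> ramified (d * e)"
    then obtain a b where h: "a \<in> \<O>" "b \<in> \<O>" "x = of_int (d * e) * a + \<omega> * b"
      unfolding ramified_def by blast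
    show "x \<in> ramified d \<star> ramified e"
      unfolding h(3) by (intro idealD(3)[OF RR] idealD(5)[OF RR h(1) 1] idealD(5)[OF RR h(2) 2])
  qed
qed

lemma squarefree_int: "squarefree (int n)"
  using sqf by (simp add: squarefree_int_iff)

lemma coprime_codivisors:
  assumes "d * e = int n"
  shows "coprime d e"
proof (rule coprimeI)
  fix c assume "c dvd d" "c dvd e"
  hence "c\<^sup>2 dvd int n" unfolding assms[symmetric] power2_eq_square by (rule mult_dvd_mono)
  thus "is_unit c" using squarefree_int squarefreeD by blast
qed

text \<open>A generator has norm d, that is x^2 + d e y^2 = 4 d in half-integer coordinates. With e
  > 4 this forces y = 0, so d is a square dividing the square-free n. The case e = 1 is a genuine
  exception: there the ideal is (\<omega>).\<close>

lemma ramified_principal_imp_1: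
  assumes d: "d * e = int n" "d > 0" "e > 4" and a: "a \<in> \<O>" "a \<noteq> 0"
    and eq: "a \<diamondop> ramified d = principal b"
  shows "d = 1"
proof -
  have cop: "coprime d e" by (rule coprime_codivisors[OF d(1)])
  have "b \<in> a \<diamondop> ramified d" unfolding eq by (rule mem_principal_self)
  then obtain \<gamma> where \<gamma>: "\<gamma> \<in> ramified d" "b = a * \<gamma>" by blast
  have \<gamma>c: "\<gamma> \<in> \<O>" using idealD(1)[OF ideal_ramified \<gamma>(1)] .
  have ram: "ramified d = principal \<gamma>"
    using eq unfolding \<gamma>(2) scale_scale[symmetric] by (rule scale_cancel[OF a(2), THEN iffD1])
  have "principal (of_int d) = principal (\<gamma> * \<gamma>)"
  proof -
    have "principal (of_int d) = principal \<gamma> \<star> principal \<gamma>"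
      unfolding ramified_square[OF d(1) cop, symmetric] ram ..
    also have "\<dots> = \<gamma> \<diamondop> principal \<gamma>" by (rule principal_mult[OF ideal_principal[OF \<gamma>c]])
    finally show ?thesis unfolding scale_scale .
  qed
  hence "of_int d \<in> principal (\<gamma> * \<gamma>)" "\<gamma> * \<gamma> \<in> principal (of_int d)"
    using mem_principal_self[of "of_int d"] mem_principal_self[of "\<gamma> * \<gamma>"] by blast+
  then obtain \<theta> \<eta> where \<theta>: "\<theta> \<in> \<O>" "of_int d = (\<gamma> * \<gamma>) * \<theta>"
    and \<eta>: "\<eta> \<in> \<O>" "\<gamma> * \<gamma> = of_int d * \<eta>" by blast
  have "of_int d = of_int d * (\<eta> * \<theta>)" using \<theta>(2) unfolding \<eta>(2) by (simp add: mult.assoc)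
  hence unit: "\<eta> * \<theta> = 1" using d(2) by simp
  \<comment> \<open>As \<eta> is a unit, its norm is 1, and so \<gamma> has norm d.\<close>
  obtain k where k: "\<eta> * cnj \<eta> = of_int k" "k \<ge> 0" using norm_int[OF \<eta>(1)] by metis
  obtain l where l: "\<theta> * cnj \<theta> = of_int l" using norm_int[OF \<theta>(1)] by metis
  have "of_int (k * l) = (\<eta> * \<theta>) * cnj (\<eta> * \<theta>)" unfolding of_int_mult k(1)[symmetric] l[symmetric] by simp
  hence "(of_int (k * l) :: complex) = of_int 1" unfolding unit by simp
  hence "k * l = 1" by (simp only: of_int_eq_iff)
  hence k1: "k = 1" using k(2) by (simp add: zmult_eq_1_iff)
  obtain c where c: "\<gamma> * cnj \<gamma> = of_int c" "c \<ge> 0" using norm_int[OF \<gamma>c] by metis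
  have "of_int (c\<^sup>2) = (\<gamma> * \<gamma>) * cnj (\<gamma> * \<gamma>)" unfolding power2_eq_square of_int_mult c(1)[symmetric] by simp
  also have "\<dots> = of_int d * of_int d * (\<eta> * cnj \<eta>)" unfolding \<eta>(2) by simp
  also have "\<dots> = of_int (d\<^sup>2)" unfolding k(1) k1 by (simp add: power2_eq_square)
  finally have "c\<^sup>2 = d\<^sup>2" by (simp only: of_int_eq_iff)
  hence cd: "c = d" using c(2) d(2) by (simp add: power2_eq_iff_nonneg)
  obtain x y where xy: "even (x + y)" "\<gamma> = elem x y" using \<gamma>c unfolding carrier_iff by blast
  have "(of_int (x\<^sup>2 + int n * y\<^sup>2) :: complex) = 4 * (\<gamma> * cnj \<gamma>)" unfolding xy(2) elem_norm by simp
  also have "\<dots> = of_int (4 * d)" unfolding c(1) cd by simp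
  finally have norm: "x\<^sup>2 + int n * y\<^sup>2 = 4 * d" by (simp only: of_int_eq_iff)
  have "y = 0"
  proof (rule ccontr)
    assume "y \<noteq> 0"
    hence "1 \<le> y\<^sup>2" by (metis zero_less_power2 int_one_le_iff_zero_less)
    hence "int n * 1 \<le> int n * y\<^sup>2" by (intro mult_left_mono) auto
    hence "d * e \<le> 4 * d" using norm zero_le_power2[of x] unfolding d(1) by linarith
    hence "e \<le> 4" using d(2) by (simp add: mult.commute[of 4])
    thus False using d(3) by simp
  qed
  then obtain x' where x': "x = 2 * x'" using xy(1) by auto
  have "x'\<^sup>2 = d" using norm unfolding x' \<open>y = 0\<close> by (simp add: power_mult_distrib)
  hence "x'\<^sup>2 dvd int n" using d(1) by (metis dvd_triv_left)
  hence "x'\<^sup>2 = 1" by (rule squarefree_square_eq_1[OF squarefree_int])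
  thus ?thesis using \<open>x'\<^sup>2 = d\<close> by simp
qed

end

section \<open>The ideal class group\<close>

context imag_quadratic
begin

lemma nonzero_ideals_iff: "I \<in> nonzero_ideals n \<longleftrightarrow> ideal I O\<^sub>K \<and> I \<noteq> {0}"
  by (simp add: nonzero_ideals_def)

lemma ideal_class_rel_iff:
  "(I, J) \<in> ideal_class_rel n \<longleftrightarrow> I \<in> nonzero_ideals n \<and> J \<in> nonzero_ideals n \<and>
     (\<exists>a \<in> \<O> - {0}. \<exists>b \<in> \<O> - {0}. a \<diamondop> I = b \<diamondop> J)"
  by (simp add: ideal_class_rel_def)

lemma nonzero_mult:
  assumes "I \<in> nonzero_ideals n" "J \<in> nonzero_ideals n"
  shows "I \<star> J \<in> nonzero_ideals n"
proof -
  have I: "ideal I O\<^sub>K" "I \<noteq> {0}" and J: "ideal J O\<^sub>K" "J \<noteq> {0}"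
    using assms by (auto simp: nonzero_ideals_iff)
  obtain x where x: "x \<in> I" "x \<noteq> 0" using I idealD(2)[OF I(1)] by blast
  obtain y where y: "y \<in> J" "y \<noteq> 0" using J idealD(2)[OF J(1)] by blast
  have "x * y \<in> I \<star> J" "x * y \<noteq> 0" using x y mult_memI by auto
  hence "I \<star> J \<noteq> {0}" by blast
  thus ?thesis using ideal_mult_ideal[OF I(1) J(1)] by (simp add: nonzero_ideals_iff)
qed

lemma nonzero_carrier: "\<O> \<in> nonzero_ideals n"
  using ideal_carrier carrier_1 by (auto simp: nonzero_ideals_iff)

lemma nonzero_principal: "a \<in> \<O> \<Longrightarrow> a \<noteq> 0 \<Longrightarrow> principal a \<in> nonzero_ideals n"
  using ideal_principal[of a] mem_principal_self[of a] by (auto simp: nonzero_ideals_iff)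

lemma nonzero_ramified: "ramified d \<in> nonzero_ideals n"
proof -
  have "\<omega> \<noteq> 0" using Im_omega_pos by auto
  thus ?thesis using ideal_ramified[of d] omega_mem_ramified[of d] by (auto simp: nonzero_ideals_iff)
qed

lemma equiv_ideal_class_rel: "equiv (nonzero_ideals n) (ideal_class_rel n)"
proof (rule equivI)
  show "ideal_class_rel n \<subseteq> nonzero_ideals n \<times> nonzero_ideals n"
    by (auto simp: ideal_class_rel_def)
  show "refl_on (nonzero_ideals n) (ideal_class_rel n)"
  proof (rule refl_onI)
    fix I assume "I \<in> nonzero_ideals n"
    thus "(I, I) \<in> ideal_class_rel n"
      unfolding ideal_class_rel_iff using carrier_1 by (intro conjI bexI[of _ 1] refl) auto
  qed
  show "sym (ideal_class_rel n)"
  proof (rule symI)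
    fix I J assume "(I, J) \<in> ideal_class_rel n"
    then obtain a b where h: "I \<in> nonzero_ideals n" "J \<in> nonzero_ideals n"
      "a \<in> \<O> - {0}" "b \<in> \<O> - {0}" "a \<diamondop> I = b \<diamondop> J"
      unfolding ideal_class_rel_iff by blast
    show "(J, I) \<in> ideal_class_rel n"
      unfolding ideal_class_rel_iff using h(1,2) h(5)[symmetric] by (intro conjI bexI[OF _ h(3)] bexI[OF _ h(4)])
  qed
  show "trans (ideal_class_rel n)"
  proof (rule transI)
    fix I J K assume "(I, J) \<in> ideal_class_rel n" "(J, K) \<in> ideal_class_rel n"
    from this(1) obtain a b where ab: "I \<in> nonzero_ideals n" "a \<in> \<O> - {0}" "b \<in> \<O> - {0}"
      "a \<diamondop> I = b \<diamondop> J" unfolding ideal_class_rel_iff by blast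
    obtain c d where cd: "K \<in> nonzero_ideals n" "c \<in> \<O> - {0}" "d \<in> \<O> - {0}"
      "c \<diamondop> J = d \<diamondop> K" using \<open>(J, K) \<in> ideal_class_rel n\<close> unfolding ideal_class_rel_iff by blast
    have "(c * a) \<diamondop> I = c \<diamondop> a \<diamondop> I" by (simp only: scale_scale)
    also have "\<dots> = b \<diamondop> c \<diamondop> J" unfolding ab(4) by (rule scale_commute)
    also have "\<dots> = (b * d) \<diamondop> K" unfolding cd(4) by (rule scale_scale)
    finally have "(c * a) \<diamondop> I = (b * d) \<diamondop> K" .
    moreover have "c * a \<in> \<O> - {0}" "b * d \<in> \<O> - {0}"
      using ab(2,3) cd(2,3) carrier_mult by auto
    ultimately show "(I, K) \<in> ideal_class_rel n" unfolding ideal_class_rel_iff using ab(1) cd(1) by blast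
  qed
qed

definition ideal_class :: "complex set \<Rightarrow> complex set set" where
  "ideal_class I = ideal_class_rel n `` {I}"

text \<open>Representatives are picked by \<open>SOME\<close>; \<open>ideal_class_mult\<close> shows
  that the product does not depend on the choice.\<close>

definition class_group :: "complex set set monoid" where
  "class_group = \<lparr>carrier = nonzero_ideals n // ideal_class_rel n,
     mult = (\<lambda>X Y. ideal_class ((SOME I. I \<in> X) \<star> (SOME J. J \<in> Y))),
     one = ideal_class (\<O>)\<rparr>"

abbreviation class_mult (infixl "\<odot>" 70) where "X \<odot> Y \<equiv> X \<otimes>\<^bsub>class_group\<^esub> Y"

abbreviation class_one ("\<one>\<^sub>C") where "\<one>\<^sub>C \<equiv> \<one>\<^bsub>class_group\<^esub>"

lemma ideal_class_eq_iff:
  assumes "I \<in> nonzero_ideals n" "J \<in> nonzero_ideals n"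
  shows "ideal_class I = ideal_class J \<longleftrightarrow>
    (\<exists>a \<in> \<O> - {0}. \<exists>b \<in> \<O> - {0}. a \<diamondop> I = b \<diamondop> J)"
  unfolding ideal_class_def using eq_equiv_class_iff[OF equiv_ideal_class_rel assms] assms
  by (simp add: ideal_class_rel_iff)

lemma ideal_class_carrier: "I \<in> nonzero_ideals n \<Longrightarrow> ideal_class I \<in> carrier class_group"
  by (simp add: class_group_def ideal_class_def quotientI)

lemma class_group_cases:
  assumes "X \<in> carrier class_group"
  obtains I where "I \<in> nonzero_ideals n" "X = ideal_class I"
  using assms by (auto simp: class_group_def ideal_class_def elim: quotientE)

lemma ideal_class_eqI:
  assumes "I \<in> nonzero_ideals n" "J \<in> nonzero_ideals n" "a \<in> \<O>" "b \<in> \<O>" "a \<noteq> 0" "b \<noteq> 0"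
    "a \<diamondop> I = b \<diamondop> J"
  shows "ideal_class I = ideal_class J"
  using assms unfolding ideal_class_eq_iff[OF assms(1,2)] by blast

lemma ideal_class_mult:
  assumes I: "I \<in> nonzero_ideals n" and J: "J \<in> nonzero_ideals n"
  shows "ideal_class I \<odot> ideal_class J = ideal_class (I \<star> J)"
proof -
  have some: "(SOME K. K \<in> ideal_class I') \<in> nonzero_ideals n \<and>
      ideal_class (SOME K. K \<in> ideal_class I') = ideal_class I'" if "I' \<in> nonzero_ideals n" for I'
  proof -
    have "I' \<in> ideal_class I'" unfolding ideal_class_def
      using equiv_class_self[OF equiv_ideal_class_rel that] .
    hence "(SOME K. K \<in> ideal_class I') \<in> ideal_class I'" by (rule someI)
    then obtain K where K: "(SOME K. K \<in> ideal_class I') = K" "(I', K) \<in> ideal_class_rel n"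
      by (simp add: ideal_class_def)
    have "ideal_class I' = ideal_class K"
      unfolding ideal_class_def by (rule equiv_class_eq[OF equiv_ideal_class_rel K(2)])
    moreover have "K \<in> nonzero_ideals n" using K(2) unfolding ideal_class_rel_iff by blast
    ultimately show ?thesis unfolding K(1) by simp
  qed
  define I' J' where "I' = (SOME K. K \<in> ideal_class I)" and "J' = (SOME K. K \<in> ideal_class J)"
  have I': "I' \<in> nonzero_ideals n" "ideal_class I' = ideal_class I" using some[OF I] by (simp_all add: I'_def)
  have J': "J' \<in> nonzero_ideals n" "ideal_class J' = ideal_class J" using some[OF J] by (simp_all add: J'_def)
  obtain a b where ab: "a \<in> \<O> - {0}" "b \<in> \<O> - {0}" "a \<diamondop> I' = b \<diamondop> I"
    using I'(2) unfolding ideal_class_eq_iff[OF I'(1) I] by blast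
  obtain c d where cd: "c \<in> \<O> - {0}" "d \<in> \<O> - {0}" "c \<diamondop> J' = d \<diamondop> J"
    using J'(2) unfolding ideal_class_eq_iff[OF J'(1) J] by blast
  have id: "ideal I O\<^sub>K" "ideal J O\<^sub>K" "ideal I' O\<^sub>K" "ideal J' O\<^sub>K"
    using I J I'(1) J'(1) by (simp_all add: nonzero_ideals_iff)
  have "(a * c) \<diamondop> (I' \<star> J') = (a \<diamondop> I') \<star> (c \<diamondop> J')"
    using id cd(1) by (simp only: scale_mult mult_scale Diff_iff scale_scale)
  also have "\<dots> = (b * d) \<diamondop> (I \<star> J)"
    unfolding ab(3) cd(3) using id cd(2) by (simp only: scale_mult mult_scale Diff_iff scale_scale)
  finally have "ideal_class (I' \<star> J') = ideal_class (I \<star> J)"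
    using ab cd I J I'(1) J'(1)
    by (intro ideal_class_eqI[of _ _ "a * c" "b * d"]) (auto intro: nonzero_mult carrier_mult)
  thus ?thesis by (simp add: class_group_def I'_def J'_def)
qed

lemma class_group_one: "\<one>\<^sub>C = ideal_class (\<O>)"
  by (simp add: class_group_def)

lemma ideal_class_principal:
  assumes "a \<in> \<O>" "a \<noteq> 0"
  shows "ideal_class (principal a) = \<one>\<^sub>C"
  unfolding class_group_one
  by (rule ideal_class_eqI[OF nonzero_principal[OF assms] nonzero_carrier carrier_1 assms(1)])
    (use assms in \<open>simp_all add: image_image\<close>)

lemma comm_group_class_group: "comm_group class_group"
proof (rule comm_groupI)
  fix X Y assume "X \<in> carrier class_group" "Y \<in> carrier class_group"
  then obtain I J where IJ: "I \<in> nonzero_ideals n" "X = ideal_class I"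
    "J \<in> nonzero_ideals n" "Y = ideal_class J" by (metis class_group_cases)
  show "X \<odot> Y \<in> carrier class_group"
    unfolding IJ(2,4) ideal_class_mult[OF IJ(1,3)] by (rule ideal_class_carrier[OF nonzero_mult[OF IJ(1,3)]])
  show "X \<odot> Y = Y \<odot> X"
    unfolding IJ(2,4) ideal_class_mult[OF IJ(1,3)] ideal_class_mult[OF IJ(3,1)]
    using IJ(1,3) by (simp add: ideal_mult_commute nonzero_ideals_iff)
next
  fix X Y Z assume "X \<in> carrier class_group" "Y \<in> carrier class_group" "Z \<in> carrier class_group"
  then obtain I J K where IJ: "I \<in> nonzero_ideals n" "X = ideal_class I"
    "J \<in> nonzero_ideals n" "Y = ideal_class J" "K \<in> nonzero_ideals n" "Z = ideal_class K"
    by (metis class_group_cases)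
  have id: "ideal I O\<^sub>K" "ideal J O\<^sub>K" "ideal K O\<^sub>K" using IJ by (simp_all add: nonzero_ideals_iff)
  show "X \<odot> Y \<odot> Z = X \<odot> (Y \<odot> Z)"
    unfolding IJ(2,4,6) ideal_class_mult[OF IJ(1,3)] ideal_class_mult[OF IJ(3,5)]
      ideal_class_mult[OF nonzero_mult[OF IJ(1,3)] IJ(5)] ideal_class_mult[OF IJ(1) nonzero_mult[OF IJ(3,5)]]
    by (simp only: ideal_mult_assoc[OF id])
next
  show "\<one>\<^sub>C \<in> carrier class_group"
    unfolding class_group_one by (rule ideal_class_carrier[OF nonzero_carrier])
next
  fix X assume "X \<in> carrier class_group"
  then obtain I where I: "I \<in> nonzero_ideals n" "X = ideal_class I" by (rule class_group_cases)
  have id: "ideal I O\<^sub>K" "I \<noteq> {0}" using I(1) by (simp_all add: nonzero_ideals_iff)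
  show "\<one>\<^sub>C \<odot> X = X"
    unfolding class_group_one I(2) ideal_class_mult[OF nonzero_carrier I(1)] ideal_mult_one[OF id(1)] ..
  \<comment> \<open>The conjugate ideal represents the inverse class.\<close>
  obtain N where N: "N > 0" "I \<star> cnj ` I = principal (of_int N)" using mult_cnj_principal[OF id] by blast
  have cI: "ideal (cnj ` I) O\<^sub>K" by (rule ideal_cnj[OF id(1)])
  obtain x where x: "x \<in> I" "x \<noteq> 0" using id idealD(2)[OF id(1)] by blast
  have "cnj x \<in> cnj ` I" "cnj x \<noteq> 0" using x by simp_all
  hence "cnj ` I \<noteq> {0}" by blast
  hence c: "cnj ` I \<in> nonzero_ideals n" using cI by (simp add: nonzero_ideals_iff)
  have "ideal_class (cnj ` I) \<odot> X = ideal_class (principal (of_int N))"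
    unfolding I(2) ideal_class_mult[OF c I(1)] ideal_mult_commute[OF cI id(1)] N(2) ..
  also have "\<dots> = \<one>\<^sub>C" by (rule ideal_class_principal[OF carrier_of_int]) (use N(1) in simp)
  finally show "\<exists>Y\<in>carrier class_group. Y \<odot> X = \<one>\<^sub>C"
    using ideal_class_carrier[OF c] by blast
qed

lemma class_number_eq_order: "class_number_neg n = Coset.order class_group"
  by (simp add: class_number_neg_def Coset.order_def class_group_def)

lemma ideal_class_ramified_eq_one_imp:
  assumes "d * e = int n" "d > 0" "e > 4" "ideal_class (ramified d) = \<one>\<^sub>C"
  shows "d = 1"
proof -
  obtain a b where ab: "a \<in> \<O> - {0}" "b \<in> \<O> - {0}" "a \<diamondop> ramified d = principal b"
    using assms(4) unfolding class_group_one ideal_class_eq_iff[OF nonzero_ramified nonzero_carrier] by blast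
  thus ?thesis using ramified_principal_imp_1[OF assms(1-3)] by blast
qed

lemma ideal_class_ramified_square:
  assumes "d dvd int n"
  shows "ideal_class (ramified d) \<odot> ideal_class (ramified d) = \<one>\<^sub>C"
proof -
  obtain e where e: "d * e = int n" using assms by (metis dvd_def)
  have "d \<noteq> 0" using e n_pos by auto
  thus ?thesis
    unfolding ideal_class_mult[OF nonzero_ramified nonzero_ramified]
      ramified_square[OF e coprime_codivisors[OF e]]
    by (intro ideal_class_principal carrier_of_int) simp
qed

section \<open>Classes of ramified ideals and divisibility of the class number\<close>

text \<open>Ramified ideals have principal squares, so the class of the product over S turns
  symmetric difference into multiplication. Leaving m outside the products keeps every cofactor
  above 4, so only the empty set gives the trivial class and the 2^t classes are distinct.\<close>

lemma ramified_classes_subgroup: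
  fixes p :: "nat \<Rightarrow> nat" and t m :: nat
  assumes p: "\<And>i. i < t \<Longrightarrow> prime (p i)" "inj_on p {..<t}" and n: "n = (\<Prod>i<t. p i) * m" "m > 4"
  defines "K \<equiv> (\<lambda>S. ideal_class (ramified (int (\<Prod>i\<in>S. p i)))) ` Pow {..<t}"
  shows "subgroup K class_group" "card K = 2 ^ t" "finite K"
proof -
  interpret G: comm_group class_group by (rule comm_group_class_group)
  define D where "D S = int (\<Prod>i\<in>S. p i)" for S
  define c where "c S = ideal_class (ramified (D S))" for S
  have K: "K = c ` Pow {..<t}" by (simp add: K_def c_def D_def)
  show fin: "finite K" by (simp add: K)
  have D_dvd: "D S dvd int (\<Prod>i<t. p i)" if "S \<subseteq> {..<t}" for S
    unfolding D_def int_dvd_int_iff using that by (intro prod_dvd_prod_subset) auto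
  have Dn: "D S dvd int n" if "S \<subseteq> {..<t}" for S
    using D_dvd[OF that] unfolding n(1) by simp
  have cop: "coprime (D S) (D T)" if "S \<subseteq> {..<t}" "T \<subseteq> {..<t}" "S \<inter> T = {}" for S T
  proof -
    have "coprime (p i) (p j)" if "i \<in> S" "j \<in> T" for i j
    proof (rule primes_coprime)
      show "prime (p i)" "prime (p j)" using that \<open>S \<subseteq> {..<t}\<close> \<open>T \<subseteq> {..<t}\<close> p(1) by auto
      have "i \<noteq> j" using that \<open>S \<inter> T = {}\<close> by blast
      thus "p i \<noteq> p j" using p(2) that \<open>S \<subseteq> {..<t}\<close> \<open>T \<subseteq> {..<t}\<close> by (auto simp: inj_on_def)
    qed
    thus ?thesis unfolding D_def coprime_int_iff by (intro prod_coprime_left prod_coprime_right) auto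
  qed
  have D_union: "D (S \<union> T) = D S * D T" if "S \<subseteq> {..<t}" "T \<subseteq> {..<t}" "S \<inter> T = {}" for S T
  proof -
    have "finite S" "finite T" using that finite_subset[OF _ finite_lessThan] by blast+
    thus ?thesis using that(3) by (simp add: D_def prod.union_disjoint)
  qed
  have c_carrier: "c S \<in> carrier class_group" for S
    unfolding c_def by (rule ideal_class_carrier[OF nonzero_ramified])
  have c_union: "c (S \<union> T) = c S \<odot> c T" if "S \<subseteq> {..<t}" "T \<subseteq> {..<t}" "S \<inter> T = {}" for S T
    unfolding c_def ideal_class_mult[OF nonzero_ramified nonzero_ramified] D_union[OF that]
    using ramified_mult[OF cop[OF that]] Dn[of "S \<union> T"] that D_union[OF that] by simp
  have c_sq: "c S \<odot> c S = \<one>\<^sub>C" if "S \<subseteq> {..<t}" for S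
    unfolding c_def by (rule ideal_class_ramified_square[OF Dn[OF that]])
  have c_inv: "inv\<^bsub>class_group\<^esub> (c S) = c S" if "S \<subseteq> {..<t}" for S
    using c_sq[OF that] c_carrier by (simp add: G.inv_equality)
  have c_mult: "c S \<odot> c T = c ((S - T) \<union> (T - S))" if ST: "S \<subseteq> {..<t}" "T \<subseteq> {..<t}" for S T
  proof -
    let ?I = "S \<inter> T"
    have "c S = c (S - T) \<odot> c ?I"
      using c_union[of "S - T" ?I] ST by (simp add: Un_Diff_Int Int_Diff_disjoint Diff_Int_distrib2 Int_commute inf.coboundedI1 subset_iff)
    moreover have "c T = c ?I \<odot> c (T - S)"
    proof -
      have "?I \<union> (T - S) = T" "?I \<subseteq> {..<t}" "T - S \<subseteq> {..<t}" "?I \<inter> (T - S) = {}" using ST by auto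
      thus ?thesis using c_union[of ?I "T - S"] by simp
    qed
    moreover have "c ?I \<odot> c ?I = \<one>\<^sub>C" using c_sq[of ?I] ST by auto
    moreover have "c ((S - T) \<union> (T - S)) = c (S - T) \<odot> c (T - S)"
      using ST by (intro c_union) auto
    ultimately show ?thesis using c_carrier by (metis G.m_assoc G.m_closed G.r_one)
  qed
  have c_empty: "c {} = \<one>\<^sub>C"
    unfolding c_def D_def class_group_one using ramified_1 by simp
  show "subgroup K class_group"
  proof (rule G.subgroupI)
    show "K \<subseteq> carrier class_group" using c_carrier by (auto simp: K)
    show "K \<noteq> {}" by (auto simp: K)
    show "inv\<^bsub>class_group\<^esub> a \<in> K" if "a \<in> K" for a using that c_inv by (auto simp: K)
    show "a \<odot> b \<in> K" if ab: "a \<in> K" "b \<in> K" for a b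
    proof -
      obtain S T where "S \<subseteq> {..<t}" "a = c S" "T \<subseteq> {..<t}" "b = c T" using ab by (auto simp: K)
      moreover from this have "(S - T) \<union> (T - S) \<in> Pow {..<t}" by auto
      ultimately show ?thesis unfolding K using c_mult by (metis imageI)
    qed
  qed
  have "inj_on c (Pow {..<t})"
  proof (rule inj_onI)
    fix S T assume ST: "S \<in> Pow {..<t}" "T \<in> Pow {..<t}" "c S = c T"
    let ?U = "(S - T) \<union> (T - S)"
    have U: "?U \<subseteq> {..<t}" using ST by auto
    have "c ?U = \<one>\<^sub>C" using c_mult[of S T] c_sq[of T] ST by auto
    moreover obtain e where e: "int (\<Prod>i<t. p i) = D ?U * e" using D_dvd[OF U] by blast
    have "(\<Prod>i<t. p i) > 0" using p(1) by (intro prod_pos) (auto simp: prime_gt_0_nat)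
    moreover have D0: "D ?U > 0"
    proof -
      have "(\<Prod>i\<in>?U. p i) > 0" using p(1) U by (intro prod_pos) (auto simp: prime_gt_0_nat)
      thus ?thesis by (simp only: D_def of_nat_0_less_iff)
    qed
    ultimately have "e > 0" using e by (metis of_nat_0_less_iff zero_less_mult_pos)
    hence "e * int m > 4" using n(2) mult_mono[of 1 e 5 "int m"] by simp
    moreover have "D ?U * (e * int m) = int n" unfolding n(1) using e by simp
    ultimately have D1: "D ?U = 1"
      using ideal_class_ramified_eq_one_imp[OF _ D0, of "e * int m"] \<open>c ?U = \<one>\<^sub>C\<close>
      by (simp add: c_def)
    have "?U = {}"
    proof (rule ccontr)
      assume "?U \<noteq> {}"
      then obtain i where i: "i \<in> ?U" by blast
      have "p i dvd (\<Prod>i\<in>?U. p i)" using i U finite_subset[OF U] by (intro dvd_prodI) auto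
      moreover have "int (\<Prod>i\<in>?U. p i) = int 1" using D1 unfolding D_def of_nat_1 .
      hence "(\<Prod>i\<in>?U. p i) = 1" by (simp only: of_nat_eq_iff)
      ultimately have "p i dvd 1" by simp
      thus False using p(1)[of i] i U by (auto simp: subset_iff)
    qed
    thus "S = T" by auto
  qed
  thus "card K = 2 ^ t" by (simp add: K card_image card_Pow)
qed

text \<open>E^2 lies outside K because squares in K are trivial and E^4 is not, so adjoining E^2
  doubles K. Squares in the larger group lie in K, so E lies outside it and a second doubling
  applies; Lagrange's theorem concludes.\<close>

lemma dvd_class_number_of_fourth_power:
  assumes K: "subgroup K class_group" "finite K" and sq: "\<And>k. k \<in> K \<Longrightarrow> k \<odot> k = \<one>\<^sub>C"
    and E: "E \<in> carrier class_group" "E [^]\<^bsub>class_group\<^esub> (4::nat) \<in> K" "E [^]\<^bsub>class_group\<^esub> (4::nat) \<noteq> \<one>\<^sub>C"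
  shows "4 * card K dvd class_number_neg n"
proof -
  interpret G: comm_group class_group by (rule comm_group_class_group)
  let ?F = "E \<odot> E"
  have F: "?F \<in> carrier class_group" using E(1) by simp
  have E4: "E [^]\<^bsub>class_group\<^esub> (4::nat) = ?F \<odot> ?F"
    using E(1) by (simp add: eval_nat_numeral G.m_assoc)
  have "?F \<notin> K" using sq[of ?F] E(3) unfolding E4 by blast
  moreover have "?F \<odot> ?F \<in> K" using E(2) unfolding E4 .
  ultimately have 1: "subgroup (K \<union> (\<lambda>k. ?F \<odot> k) ` K) class_group"
    "finite (K \<union> (\<lambda>k. ?F \<odot> k) ` K)"
    "card (K \<union> (\<lambda>k. ?F \<odot> k) ` K) = 2 * card K"
    using G.subgroup_extend_by_square_root[OF K F] by blast+
  define K1 where "K1 = K \<union> (\<lambda>k. ?F \<odot> k) ` K"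
  have Kc: "k \<in> carrier class_group" if "k \<in> K" for k using subgroup.mem_carrier[OF K(1) that] .
  have K1sq: "k \<odot> k \<in> K" if k: "k \<in> K1" for k
  proof (cases "k \<in> K")
    case True
    thus ?thesis using subgroup.m_closed[OF K(1)] by blast
  next
    case False
    then obtain l where l: "l \<in> K" "k = ?F \<odot> l" using k by (auto simp: K1_def)
    have "k \<odot> k = (?F \<odot> ?F) \<odot> (l \<odot> l)"
      unfolding l(2) using F Kc[OF l(1)] by (simp add: G.m_ac)
    thus ?thesis using E(2) unfolding E4 sq[OF l(1)] using F by simp
  qed
  have "E \<notin> K1"
  proof
    assume "E \<in> K1"
    hence "?F \<in> K" by (rule K1sq)
    thus False using \<open>?F \<notin> K\<close> by blast
  qed
  moreover have "?F \<in> K1"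
    unfolding K1_def using subgroup.one_closed[OF K(1)] F
    by (intro UnI2 image_eqI[of _ _ "\<one>\<^sub>C"]) simp_all
  moreover have "subgroup K1 class_group" "finite K1" "card K1 = 2 * card K" using 1 by (simp_all add: K1_def)
  ultimately have 2: "subgroup (K1 \<union> (\<lambda>k. E \<odot> k) ` K1) class_group"
    "card (K1 \<union> (\<lambda>k. E \<odot> k) ` K1) = 2 * (2 * card K)"
    using G.subgroup_extend_by_square_root[of K1 E] E(1) by auto
  \<comment> \<open>no finiteness needed: an infinite class group would have order \<open>0\<close>\<close>
  have "card (K1 \<union> (\<lambda>k. E \<odot> k) ` K1) dvd Coset.order class_group"
    using G.lagrange[OF 2(1)] by (metis dvd_triv_right)
  thus ?thesis unfolding class_number_eq_order 2(2) by simp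
qed

text \<open>The first equation gives a class \<open>[M]\<close> with \<open>[M]\<^sup>2 = [(P, \<omega>)]\<close>, and the second one turns
  \<open>[M] [(d, \<omega>)]\<close> into the inverse of a square \<open>[D]\<^sup>2\<close>. Hence \<open>[D]\<^sup>4 = [(P, \<omega>)] \<noteq> 1\<close>.\<close>

lemma pow2_dvd_class_number:
  fixes p :: "nat \<Rightarrow> nat" and t m P :: nat and Z w y b d e x' y' z' :: int
  assumes p: "\<And>i. i < t \<Longrightarrow> prime (p i)" "inj_on p {..<t}" and n: "n = P * m" "m > 4"
    and P: "P = (\<Prod>i<t. p i)" "P > 1"
    and Z: "Z > 0" "odd Z" "coprime Z (int n)"
    and wy: "int P * w\<^sup>2 + int m * y\<^sup>2 = 4 * Z\<^sup>2" "coprime (int P * w) Z" "[b * y = int P * w] (mod Z)"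
    and de: "d * e = int n" "d > 0" "d dvd int P"
    and second: "d * x'\<^sup>2 + e * y'\<^sup>2 = Z * z'\<^sup>2" "z' > 0" "[d * x' = b * y'] (mod Z)"
  shows "2 ^ (t + 2) dvd class_number_neg n"
proof -
  interpret G: comm_group class_group by (rule comm_group_class_group)
  have P0: "int P > 0" using P(2) by simp
  \<comment> \<open>The first equation as an element (P w + y \<omega>)/2 of norm P Z^2 in the ideal
    (P, \<omega>).\<close>
  define \<xi> where "\<xi> = elem (int P * w) y"
  have Pm: "int P * int m = int n" using n by simp
  have norm: "(int P * w)\<^sup>2 + int n * y\<^sup>2 = 4 * (int P * Z\<^sup>2)"
  proof -
    have "(int P * w)\<^sup>2 + int n * y\<^sup>2 = int P * (int P * w\<^sup>2 + int m * y\<^sup>2)"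
      unfolding Pm[symmetric] by (simp add: power2_eq_square algebra_simps)
    thus ?thesis unfolding wy(1) by simp
  qed
  have par: "even (int P * w + y)" unfolding parity_norm norm by simp
  have \<xi>c: "\<xi> \<in> \<O>" unfolding \<xi>_def carrier_iff using par by blast
  have \<xi>n: "\<xi> * cnj \<xi> = of_int (int P * Z\<^sup>2)" unfolding \<xi>_def elem_norm norm by simp
  have oddn: "odd n" using mod4 by presburger
  have oddP: "odd P" "odd m" using oddn unfolding n(1) by simp_all
  \<comment> \<open>P is odd, so 2 is invertible modulo (P, \<omega>) and the denominator of \<xi>
    is harmless.\<close>
  have two_ram: "v \<in> ramified (int P)" if "v \<in> \<O>" "2 * v \<in> ramified (int P)" for v
  proof -
    obtain k where k: "int P = 2 * k + 1" using oddP(1) by (metis even_of_nat oddE)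
    have "of_int (int P) * v \<in> ramified (int P)"
      using idealD(5)[OF ideal_ramified that(1) int_mem_ramified] .
    moreover have "of_int k * (2 * v) \<in> ramified (int P)"
      using idealD(4)[OF ideal_ramified carrier_of_int that(2)] .
    ultimately have "of_int (int P) * v - of_int k * (2 * v) \<in> ramified (int P)"
      by (rule idealD(7)[OF ideal_ramified])
    thus ?thesis unfolding k by (simp add: algebra_simps)
  qed
  have \<xi>ram: "\<xi> \<in> ramified (int P)"
  proof (rule two_ram[OF \<xi>c])
    have "of_int (int P) * of_int w + \<omega> * of_int y \<in> ramified (int P)"
      by (rule ramifiedI[OF carrier_of_int carrier_of_int])
    moreover have "2 * \<xi> = of_int (int P) * of_int w + \<omega> * of_int y"
      unfolding \<xi>_def elem_def by (simp add: field_simps)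
    ultimately show "2 * \<xi> \<in> ramified (int P)" by simp
  qed
  have ramP: "ramified (int P) \<star> cnj ` ramified (int P) = principal (of_int (int P))"
    unfolding cnj_ramified by (rule ramified_square[OF Pm coprime_codivisors[OF Pm]])
  \<comment> \<open>Such a prime l would divide P w by the coordinates and Z by the norms.\<close>
  have prim: "\<xi> \<noteq> of_int l * \<gamma>" if l: "prime l" and \<gamma>: "\<gamma> \<in> ramified (int P)" for l \<gamma>
  proof
    assume eq: "\<xi> = of_int l * \<gamma>"
    obtain x1 y1 where xy: "even (x1 + y1)" "\<gamma> = elem x1 y1"
      using idealD(1)[OF ideal_ramified \<gamma>] unfolding carrier_iff by blast
    have "elem (int P * w) y = elem (l * x1) (l * y1)"
      using eq unfolding \<xi>_def xy(2) by (simp add: elem_def algebra_simps)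
    hence lw: "int P * w = l * x1" "y = l * y1" by (simp_all add: elem_eq_iff)
    obtain c where c: "\<gamma> * cnj \<gamma> = of_int c" using norm_int[OF idealD(1)[OF ideal_ramified \<gamma>]] by metis
    have "of_int c \<in> principal (of_int (int P))"
      unfolding c[symmetric] ramP[symmetric] using \<gamma> by (intro mult_memI) auto
    hence "int P dvd c" using P0 by (subst (asm) of_int_mem_principal_iff) auto
    then obtain c' where c': "c = int P * c'" by blast
    have "of_int (int P * Z\<^sup>2) = (of_int l * of_int l) * (\<gamma> * cnj \<gamma>)"
      unfolding \<xi>n[symmetric] eq by simp
    also have "\<dots> = of_int (int P * (l\<^sup>2 * c'))" unfolding c c' by (simp add: power2_eq_square)
    finally have "int P * Z\<^sup>2 = int P * (l\<^sup>2 * c')" by (simp only: of_int_eq_iff)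
    hence "Z\<^sup>2 = l\<^sup>2 * c'" using P0 by simp
    hence "l\<^sup>2 dvd Z\<^sup>2" by simp
    hence "l dvd Z" by simp
    moreover have "l dvd int P * w" using lw(1) by simp
    ultimately have "is_unit l" using wy(2) coprime_common_divisor by blast
    thus False using l by auto
  qed
  obtain M where M: "ideal M O\<^sub>K" "M \<star> M \<star> ramified (int P) = principal \<xi>"
    "M \<star> cnj ` M = principal (of_int Z)" "of_int Z \<in> M"
    and Mmem: "\<And>\<beta> \<gamma>. \<beta> \<in> ramified (int P) \<Longrightarrow> of_int (int P) * \<gamma> = \<xi> * cnj \<beta> \<Longrightarrow> \<gamma> \<in> M"
    by (rule square_root_of_primitive[OF ideal_ramified P0 ramP \<xi>ram \<xi>n Z(1)]) (erule (1) prim, rule that)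
  \<comment> \<open>The choice \<beta> = P in the description of members of
    \<open>M\<close>.\<close>
  have \<xi>M: "\<xi> \<in> M" by (rule Mmem[OF int_mem_ramified]) (simp add: mult.commute)
  have copyZ: "coprime y Z"
  proof (rule ccontr)
    assume "\<not> coprime y Z"
    then obtain l where l: "prime l" "l dvd y" "l dvd Z"
      using Z(1) by (elim not_coprime_prime_divisor) auto
    have "l dvd 4 * (int P * Z\<^sup>2) - int n * y\<^sup>2" using l by (intro dvd_diff) (simp_all add: power2_eq_square)
    moreover have "4 * (int P * Z\<^sup>2) - int n * y\<^sup>2 = (int P * w)\<^sup>2" using norm by linarith
    ultimately have "l dvd (int P * w)\<^sup>2" by simp
    hence "l dvd int P * w" using l(1) prime_dvd_power by blast
    thus False using l wy(2) coprime_common_divisor not_prime_unit by blast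
  qed
  \<comment> \<open>\<open>M\<close> contains Z and 2 \<xi>, which is y (b + \<omega>) modulo Z, and
    y is invertible modulo Z. In this way the root b links \<open>M\<close> to the second
    equation.\<close>
  have bM: "of_int b + \<omega> \<in> M"
  proof -
    obtain u v where uv: "u * y + v * Z = 1" using bezout_int[of y Z] copyZ by (auto simp: coprime_iff_gcd_eq_1)
    obtain k where k: "b * y - int P * w = Z * k" using wy(3) by (auto simp: cong_iff_dvd_diff)
    have "of_int b + \<omega> = of_int (u * y + v * Z) * (of_int b + \<omega>)" unfolding uv by simp
    also have "\<dots> = of_int u * (of_int (b * y) + of_int y * \<omega>) + (of_int v * (of_int b + \<omega>)) * of_int Z"
      by (simp add: algebra_simps)
    also have "b * y = int P * w + Z * k" using k by simp
    also have "of_int u * (of_int (int P * w + Z * k) + of_int y * \<omega>) + (of_int v * (of_int b + \<omega>)) * of_int Z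
      = (2 * of_int u) * \<xi> + (of_int (u * k) + of_int v * (of_int b + \<omega>)) * of_int Z"
      unfolding \<xi>_def elem_def by (simp add: algebra_simps)
    also have "\<dots> \<in> M"
    proof (intro idealD(3)[OF M(1)] idealD(4)[OF M(1)] \<xi>M M(4))
      show "2 * of_int u \<in> \<O>" using carrier_of_int[of "2 * u"] by simp
      show "of_int (u * k) + of_int v * (of_int b + \<omega>) \<in> \<O>"
        by (intro carrier_add carrier_mult carrier_of_int carrier_omega)
    qed
    finally show ?thesis .
  qed
  let ?R = "ramified d"
  have dn: "d dvd int n" using de(1) by (metis dvd_triv_left)
  have MR: "ideal (M \<star> ?R) O\<^sub>K" by (rule ideal_mult_ideal[OF M(1) ideal_ramified])
  \<comment> \<open>The second equation as an element of norm d Z z'^2. Its congruence modulo Z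
    makes \<alpha> an integer combination of b + \<omega> and Z.\<close>
  define \<alpha> where "\<alpha> = of_int (d * x') + of_int y' * \<omega>"
  have \<alpha>R: "\<alpha> \<in> ?R" using ramifiedI[OF carrier_of_int carrier_of_int, of d x' y'] by (simp add: \<alpha>_def mult.commute)
  have \<alpha>M: "\<alpha> \<in> M"
  proof -
    obtain k where k: "d * x' - b * y' = Z * k" using second(3) by (auto simp: cong_iff_dvd_diff)
    have "\<alpha> = of_int y' * (of_int b + \<omega>) + of_int k * of_int Z"
    proof -
      have "d * x' = b * y' + Z * k" using k by simp
      thus ?thesis unfolding \<alpha>_def by (simp only: of_int_add of_int_mult) (simp add: algebra_simps)
    qed
    also have "\<dots> \<in> M" by (intro idealD(3)[OF M(1)] idealD(4)[OF M(1) carrier_of_int] bM M(4))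
    finally show ?thesis .
  qed
  have "coprime Z d" using Z(3) dn by (meson coprime_divisors dvd_refl)
  then obtain u v where uv: "u * Z + v * d = 1" using bezout_int[of Z d] by (auto simp: coprime_iff_gcd_eq_1)
  \<comment> \<open>\<alpha> lies in both \<open>M\<close> and \<open>?R\<close>, which contain the
    coprime integers Z and d, hence in their product.\<close>
  have \<alpha>MR: "\<alpha> \<in> M \<star> ?R"
  proof -
    have "\<alpha> = \<alpha> * of_int (u * Z + v * d)" unfolding uv by simp
    also have "\<dots> = of_int u * (of_int Z * \<alpha>) + of_int v * (\<alpha> * of_int d)" by (simp add: algebra_simps)
    also have "\<dots> \<in> M \<star> ?R"
      by (intro idealD(3)[OF MR] idealD(4)[OF MR carrier_of_int] mult_memI M(4) \<alpha>R \<alpha>M int_mem_ramified)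
    finally show ?thesis .
  qed
  have \<alpha>n: "\<alpha> * cnj \<alpha> = of_int ((d * Z) * z'\<^sup>2)"
  proof -
    have "\<alpha> * cnj \<alpha> = (of_int (d * x'))\<^sup>2 - (of_int y')\<^sup>2 * (\<omega> * \<omega>)"
      unfolding \<alpha>_def by (simp add: power2_eq_square algebra_simps)
    also have "\<dots> = of_int ((d * x')\<^sup>2 + int n * y'\<^sup>2)" unfolding omega_square by simp
    also have "(d * x')\<^sup>2 + int n * y'\<^sup>2 = d * (d * x'\<^sup>2 + e * y'\<^sup>2)"
      unfolding de(1)[symmetric] by (simp add: power2_eq_square algebra_simps)
    finally show ?thesis unfolding second(1) by (simp add: mult.assoc)
  qed
  have cM: "ideal (cnj ` M) O\<^sub>K" by (rule ideal_cnj[OF M(1)])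
  have cnj_mult: "cnj ` (A \<star> B) \<subseteq> cnj ` A \<star> cnj ` B" for A B
  proof
    fix x assume "x \<in> cnj ` (A \<star> B)"
    then obtain s where s: "s \<in> A \<star> B" "x = cnj s" by blast
    have "cnj s \<in> cnj ` A \<star> cnj ` B" using s(1)
    proof induction
      case (prod i j)
      thus ?case using mult_memI[OF imageI[OF prod(1), of cnj] imageI[OF prod(2), of cnj]] by simp
    next
      case (sum s1 s2)
      thus ?case using ideal_prod.sum[OF sum(3,4)] by simp
    qed
    thus "x \<in> cnj ` A \<star> cnj ` B" using s(2) by simp
  qed
  have cnj_MR: "cnj ` (M \<star> ?R) = cnj ` M \<star> ?R"
  proof (rule equalityI)
    show "cnj ` (M \<star> ?R) \<subseteq> cnj ` M \<star> ?R" using cnj_mult[of M ?R] unfolding cnj_ramified .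
    have "cnj ` (cnj ` M \<star> ?R) \<subseteq> cnj ` cnj ` M \<star> ?R"
      using cnj_mult[of "cnj ` M" ?R] unfolding cnj_ramified .
    hence "cnj ` (cnj ` M \<star> ?R) \<subseteq> M \<star> ?R" by (simp add: image_image)
    hence "cnj ` cnj ` (cnj ` M \<star> ?R) \<subseteq> cnj ` (M \<star> ?R)" by (rule image_mono)
    thus "cnj ` M \<star> ?R \<subseteq> cnj ` (M \<star> ?R)" by (simp add: image_image)
  qed
  have MRn: "(M \<star> ?R) \<star> cnj ` (M \<star> ?R) = principal (of_int (d * Z))"
  proof -
    have "(M \<star> ?R) \<star> (cnj ` M \<star> ?R) = M \<star> ((?R \<star> cnj ` M) \<star> ?R)"
      using ideal_mult_assoc[OF M(1) ideal_ramified ideal_mult_ideal[OF cM ideal_ramified], of d d]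
        ideal_mult_assoc[OF ideal_ramified cM ideal_ramified, of d d] by simp
    also have "\<dots> = M \<star> (cnj ` M \<star> (?R \<star> ?R))"
      using ideal_mult_commute[OF ideal_ramified cM, of d] ideal_mult_assoc[OF cM ideal_ramified ideal_ramified, of d d]
      by simp
    also have "\<dots> = (M \<star> cnj ` M) \<star> (?R \<star> ?R)"
      using ideal_mult_assoc[OF M(1) cM ideal_mult_ideal[OF ideal_ramified ideal_ramified], of d d] by simp
    also have "\<dots> = of_int Z \<diamondop> principal (of_int d)"
      unfolding M(3) ramified_square[OF de(1) coprime_codivisors[OF de(1)]]
      by (rule principal_mult[OF ideal_principal[OF carrier_of_int]])
    also have "\<dots> = principal (of_int (d * Z))" unfolding scale_scale by (simp add: mult.commute)
    finally show ?thesis unfolding cnj_MR .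
  qed
  have "d * Z > 0" using de(2) Z(1) by simp
  then obtain D \<beta> where D: "ideal D O\<^sub>K" "\<beta> \<in> \<O>" "\<beta> \<noteq> 0" "D \<star> D \<star> (M \<star> ?R) = principal \<beta>"
    by (rule square_root_exists[OF MR _ MRn \<alpha>MR \<alpha>n second(2)])
  have M0: "M \<in> nonzero_ideals n"
  proof -
    have "(of_int Z :: complex) \<noteq> 0" using Z(1) by simp
    thus ?thesis using M(1,4) by (auto simp: nonzero_ideals_iff)
  qed
  have D0: "D \<in> nonzero_ideals n"
  proof -
    have "D \<noteq> {0}"
    proof
      assume D0: "D = {0}"
      have "D \<star> D \<subseteq> {0}" unfolding D0 by (rule mult_subsetI) auto
      hence "D \<star> D \<star> (M \<star> ?R) \<subseteq> {0}" by (intro mult_subsetI) auto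
      thus False unfolding D(4) using mem_principal_self[of \<beta>] D(3) by auto
    qed
    thus ?thesis using D(1) by (simp add: nonzero_ideals_iff)
  qed
  define cM cD cR cP where "cM = ideal_class M" and "cD = ideal_class D"
    and "cR = ideal_class ?R" and "cP = ideal_class (ramified (int P))"
  have carr: "cM \<in> carrier class_group" "cD \<in> carrier class_group" "cR \<in> carrier class_group" "cP \<in> carrier class_group"
    unfolding cM_def cD_def cR_def cP_def by (intro ideal_class_carrier M0 D0 nonzero_ramified)+
  have \<xi>0: "\<xi> \<noteq> 0" using \<xi>n P0 Z(1) by auto
  have rel1: "cM \<odot> cM \<odot> cP = \<one>\<^sub>C"
    unfolding cM_def cP_def ideal_class_mult[OF M0 M0] ideal_class_mult[OF nonzero_mult[OF M0 M0] nonzero_ramified]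
      M(2) by (rule ideal_class_principal[OF \<xi>c \<xi>0])
  have rel2: "cD \<odot> cD \<odot> (cM \<odot> cR) = \<one>\<^sub>C"
    unfolding cM_def cD_def cR_def ideal_class_mult[OF D0 D0] ideal_class_mult[OF M0 nonzero_ramified]
      ideal_class_mult[OF nonzero_mult[OF D0 D0] nonzero_mult[OF M0 nonzero_ramified]] D(4)
    by (rule ideal_class_principal[OF D(2,3)])
  have sqR: "cR \<odot> cR = \<one>\<^sub>C" unfolding cR_def by (rule ideal_class_ramified_square[OF dn])
  let ?D2 = "cD \<odot> cD"
  have D4: "cD [^]\<^bsub>class_group\<^esub> (4::nat) = ?D2 \<odot> ?D2"
    using carr(2) by (simp add: eval_nat_numeral G.m_assoc)
  \<comment> \<open>Squaring [D]^2 [M] [(d, \<omega>)] = 1 removes the ramified class, and [M]^2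
    [(P, \<omega>)] = 1 then identifies [D]^4.\<close>
  have "(?D2 \<odot> (cM \<odot> cR)) \<odot> (?D2 \<odot> (cM \<odot> cR))
     = (?D2 \<odot> ?D2) \<odot> ((cM \<odot> cM) \<odot> (cR \<odot> cR))"
    using carr by (simp add: G.m_ac)
  hence "(?D2 \<odot> ?D2) \<odot> (cM \<odot> cM) = \<one>\<^sub>C"
    unfolding rel2 sqR using carr by simp
  moreover have "cP \<odot> (cM \<odot> cM) = \<one>\<^sub>C"
    using rel1 carr by (simp add: G.m_comm)
  ultimately have "?D2 \<odot> ?D2 = cP"
    using G.right_cancel[of "cM \<odot> cM" "?D2 \<odot> ?D2" cP] carr by simp
  hence D4P: "cD [^]\<^bsub>class_group\<^esub> (4::nat) = cP" unfolding D4 .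
  define K where "K = (\<lambda>S. ideal_class (ramified (int (\<Prod>i\<in>S. p i)))) ` Pow {..<t}"
  have nt: "n = (\<Prod>i<t. p i) * m" using n(1) P(1) by simp
  have K: "subgroup K class_group" "card K = 2 ^ t" "finite K"
    unfolding K_def using ramified_classes_subgroup[of t p m, OF p(1) p(2) nt n(2)] by blast+
  have "cP \<in> K" unfolding K_def cP_def P(1) by (rule image_eqI[OF refl]) simp
  moreover have "cP \<noteq> \<one>\<^sub>C"
  proof
    assume "cP = \<one>\<^sub>C"
    moreover have "int m > 4" using n(2) by simp
    ultimately have "int P = 1" using ideal_class_ramified_eq_one_imp[OF Pm P0] unfolding cP_def by blast
    thus False using P(2) by simp
  qed
  moreover have "k \<odot> k = \<one>\<^sub>C" if kK: "k \<in> K" for k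
  proof -
    obtain S where S: "k = ideal_class (ramified (int (\<Prod>i\<in>S. p i)))" "S \<in> Pow {..<t}"
      using kK unfolding K_def by (rule imageE)
    have "(\<Prod>i\<in>S. p i) dvd P" unfolding P(1) using S(2) by (intro prod_dvd_prod_subset) auto
    hence "(\<Prod>i\<in>S. p i) dvd n" unfolding n(1) by (rule dvd_mult2)
    hence "int (\<Prod>i\<in>S. p i) dvd int n" by (simp only: int_dvd_int_iff)
    thus ?thesis unfolding S(1) by (rule ideal_class_ramified_square)
  qed
  ultimately have "4 * card K dvd class_number_neg n"
    using dvd_class_number_of_fourth_power[OF K(1,3) _ carr(2)] unfolding D4P by blast
  thus ?thesis unfolding K(2) by (simp add: power_add mult.commute)
qed

end

theorem theorem1p1:
  fixes t q P n :: nat and p :: "nat \<Rightarrow> nat"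
  assumes "odd t"
    and "\<And>i. i < t \<Longrightarrow> prime (p i)"
    and "prime q"
    and "inj_on p {..<t}"
    and "\<And>i. i < t \<Longrightarrow> p i \<noteq> q"
    and "\<And>i. i < t \<Longrightarrow> [p i = 5] (mod 8)"
    and "[q = 7] (mod 8)"
    and "P = (\<Prod>i<t. p i)"
    and "n = P * q"
    and "vec_space.rank t (legendre_matrix t p) = t - 1"
    and "\<And>i. i < t \<Longrightarrow> Legendre (int (p i)) (int q) = 1"
    and "congruent_number n"
  shows "[class_number_neg n = 0] (mod 2 ^ (t + 2))"
proof -
  interpret C: corank_one_primes t q p
    using assms by unfold_locales (auto simp: cong_def)
  have P: "C.P = P" unfolding C.P_def assms(8) ..
  have nn: "C.nn = int n" unfolding C.nn_def P assms(9) by simp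
  interpret imag_quadratic n
  proof
    show "squarefree n" using C.squarefree_nn unfolding nn squarefree_int_iff .
    show "n mod 4 = 3"
    proof -
      have "P mod 4 = 1" "q mod 4 = 3" using C.P_mod_8 C.q_mod unfolding P by presburger+
      thus ?thesis unfolding assms(9) using mod_mult_eq[of P 4 q] by simp
    qed
  qed
  obtain Z w y where sol: "C.principal_genus_solution Z w y"
    using C.solution_exists assms(12) unfolding P assms(9) by blast
  have Z: "Z > 0" "odd Z" "coprime (int P * w) Z" "int P * w\<^sup>2 + int q * y\<^sup>2 = 4 * Z\<^sup>2"
    using sol unfolding C.principal_genus_solution_def P by auto
  have wZ: "coprime w Z" and PZ: "coprime (int P) Z" using Z(3) by simp_all
  have P4: "P > 4" using C.P_gt_4 unfolding P .
  have q4: "q > 4" using C.q_mod by presburger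
  have qprime: "prime (int q)" using assms(3) by simp
  \<comment> \<open>A prime common to Z and y, or to Z and q, would divide P w^2 by the equation,
    against coprimality of P w and Z.\<close>
  have yZ: "coprime y Z"
  proof (rule ccontr)
    assume "\<not> coprime y Z"
    then obtain l where l: "prime l" "l dvd y" "l dvd Z"
      using Z(1) by (elim not_coprime_prime_divisor) auto
    have "l dvd 4 * Z\<^sup>2 - int q * y\<^sup>2" using l by (simp add: power2_eq_square)
    also have "4 * Z\<^sup>2 - int q * y\<^sup>2 = int P * w\<^sup>2" unfolding Z(4)[symmetric] by simp
    finally have "l dvd int P * w" using l(1) by (auto simp: prime_dvd_mult_iff prime_dvd_power_iff)
    hence "is_unit l" using coprime_common_divisor[OF Z(3)] l(3) by blast
    thus False using l(1) not_prime_unit by blast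
  qed
  have qZ: "coprime (int q) Z"
  proof (rule prime_imp_coprime[OF qprime])
    show "\<not> int q dvd Z"
    proof
      assume d: "int q dvd Z"
      have "int q dvd 4 * Z\<^sup>2 - int q * y\<^sup>2" using d by (simp add: power2_eq_square)
      also have "4 * Z\<^sup>2 - int q * y\<^sup>2 = int P * w\<^sup>2" unfolding Z(4)[symmetric] by simp
      finally have "int q dvd int P * w" using qprime by (auto simp: prime_dvd_mult_iff prime_dvd_power_iff)
      hence "is_unit (int q)" using coprime_common_divisor[OF Z(3)] d by blast
      thus False using qprime by simp
    qed
  qed
  have nZ: "coprime Z (int n)" unfolding assms(9) using PZ qZ by (simp add: coprime_commute)
  obtain y' where y': "[y * y' = 1] (mod Z)" using cong_solve_coprime_int[OF yZ] by blast
  \<comment> \<open>This is P w / y modulo Z. The equation multiplied by P and reduced modulo Z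
    shows b^2 = -n; this root is shared by the ideal \<open>M\<close> and the ternary form.\<close>
  define b where "b = int P * w * y'"
  have by_eq: "[b * y = int P * w] (mod Z)"
  proof -
    have "[int P * w * (y * y') = int P * w * 1] (mod Z)" using y' by (rule cong_scalar_left)
    thus ?thesis by (simp add: b_def mult_ac)
  qed
  have b2: "[b\<^sup>2 = - int n] (mod Z)"
  proof -
    have "[(b * y)\<^sup>2 = (int P * w)\<^sup>2] (mod Z)" using by_eq by (rule cong_pow)
    moreover have "[(int P * w)\<^sup>2 = - int n * y\<^sup>2] (mod Z)"
    proof -
      have "(int P * w)\<^sup>2 - - int n * y\<^sup>2 = int P * (int P * w\<^sup>2 + int q * y\<^sup>2)"
        unfolding assms(9) by (simp add: power2_eq_square algebra_simps)
      also have "\<dots> = Z * (4 * int P * Z)" unfolding Z(4) by (simp add: power2_eq_square)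
      finally show ?thesis unfolding cong_iff_dvd_diff by simp
    qed
    ultimately have "[b\<^sup>2 * y\<^sup>2 = - int n * y\<^sup>2] (mod Z)"
      unfolding power_mult_distrib[symmetric] by (rule cong_trans)
    moreover have "coprime (y\<^sup>2) Z" using yZ by simp
    ultimately show ?thesis using cong_mult_rcancel[of "y\<^sup>2" Z "b\<^sup>2" "- int n"] by blast
  qed
  obtain S where S: "S \<subseteq> {..<t}"
    "\<And>i. i < t \<Longrightarrow> i \<notin> S \<Longrightarrow> Legendre ((\<Prod>j\<in>S. int (p j)) * Z) (int (p i)) = 1"
    "\<And>i. i \<in> S \<Longrightarrow> Legendre ((\<Prod>j\<in>{..<t} - S. int (p j)) * int q * Z) (int (p i)) = 1"
    "Legendre ((\<Prod>j\<in>S. int (p j)) * Z) (int q) = 1"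
    by (rule C.genus_divisor[OF sol]) (rule that)
  \<comment> \<open>With e = n/d, the symbols in \<open>S\<close> say that e Z is a square modulo d
    and d Z a square modulo e. Together with the root b modulo Z these are the three congruences of
    \<open>ternary_form_isotropic\<close>.\<close>
  define d where "d = (\<Prod>j\<in>S. int (p j))"
  define e' where "e' = (\<Prod>j\<in>{..<t} - S. int (p j))"
  define e where "e = e' * int q"
  have fS: "finite S" using S(1) finite_subset by blast
  have de': "d * e' = int P"
    unfolding d_def e'_def assms(8) using prod.subset_diff[OF S(1) finite_lessThan, of "\<lambda>i. int (p i)"]
    by (simp add: mult.commute)
  hence de: "d * e = int n" unfolding e_def assms(9) by (simp add: mult.assoc[symmetric])
  have pos: "d > 0" "e' > 0"
    unfolding d_def e'_def using S(1) assms(2) by (auto intro!: prod_pos simp: prime_gt_0_nat subset_iff)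
  have epos: "e > 0" unfolding e_def using pos(2) q4 by simp
  have c1: "\<exists>c. [c\<^sup>2 = e * Z] (mod d)"
    unfolding d_def
  proof (rule square_root_mod_prod[OF fS])
    show "coprime (int (p i)) (int (p j))" if "i \<in> S" "j \<in> S" "i \<noteq> j" for i j
      using that S(1) by (intro C.coprime_p) auto
    show "\<exists>c. [c\<^sup>2 = e * Z] (mod int (p i))" if "i \<in> S" for i
      using S(3)[OF that] unfolding Legendre_1_iff e_def e'_def by blast
  qed
  have c2: "\<exists>c. [c\<^sup>2 = d * Z] (mod e)"
    unfolding e_def
  proof (rule square_root_mod_mult)
    show "coprime e' (int q)" unfolding e'_def using C.coprime_p_q by (intro prod_coprime_left) auto
    show "\<exists>c. [c\<^sup>2 = d * Z] (mod int q)" using S(4) unfolding Legendre_1_iff d_def by blast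
    show "\<exists>c. [c\<^sup>2 = d * Z] (mod e')"
      unfolding e'_def
    proof (rule square_root_mod_prod)
      show "coprime (int (p i)) (int (p j))" if "i \<in> {..<t} - S" "j \<in> {..<t} - S" "i \<noteq> j" for i j
        using that by (intro C.coprime_p) auto
      show "\<exists>c. [c\<^sup>2 = d * Z] (mod int (p i))" if "i \<in> {..<t} - S" for i
        using S(2)[of i] that unfolding Legendre_1_iff d_def by auto
    qed simp
  qed
  obtain k1 k2 where k: "[k1\<^sup>2 = e * Z] (mod d)" "[k2\<^sup>2 = d * Z] (mod e)" using c1 c2 by blast
  have copde: "coprime d e" by (rule coprime_codivisors[OF de])
  have "coprime Z (d * e)" using nZ unfolding de .
  hence copZ: "coprime d Z" "coprime e Z" by (simp_all add: coprime_commute)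
  have sqf: "squarefree (d * e)" unfolding de by (rule squarefree_int)
  have n1: "d * e > 1" unfolding de assms(9) using P4 q4 by (simp add: less_1_mult)
  have b2': "[b\<^sup>2 = - (d * e)] (mod Z)" using b2 unfolding de .
  obtain x1 y1 z1 where tern: "z1 > 0" "d * x1\<^sup>2 + e * y1\<^sup>2 = Z * z1\<^sup>2" "[d * x1 = b * y1] (mod Z)"
    by (rule ternary_form_isotropic[OF pos(1) epos Z(1) copde copZ sqf n1 k b2']) (rule that)
  have "2 ^ (t + 2) dvd class_number_neg n"
  proof (rule pow2_dvd_class_number[of t p P q Z w y b d e x1 y1 z1])
    show "P = (\<Prod>i<t. p i)" "n = P * q" by (fact assms)+
    show "q > 4" by (rule q4)
    show "1 < P" using P4 by simp
    show "d dvd int P" unfolding de'[symmetric] by simp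
  qed (use assms(2,4) Z nZ by_eq de pos tern in auto)
  thus ?thesis by (simp add: cong_0_iff)
qed

end
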